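(* Let $k$ be any commutative ring and $G$ a finite group. Then $$\beta_k(G)=\sup\{\beta_p(G)\mid p\in\operatorname{char}(k)\}.$$
   Context: All rings are commutative with $1$, and $\mathbb N=\{0,1,2,\dots\}$. For an $\mathbb N$-graded ring $A=\bigoplus_{d\ge0}A_d$ put $A_{\le n}:=\bigoplus_{d=0}^nA_d$ and $\beta(A):=\inf\{n\in\mathbb N\mid A\text{ is generated as a ring by }A_{\le n}\}$ (with $\inf\emptyset=\infty$). For a ring $k$ and a finite group $G$, $\beta_k(G):=\sup_A\beta(A^G)\in\mathbb N\cup\{\infty\}$, where $A$ runs through all $\mathbb N$-graded $k$-algebras with a $G$-action (by degree-preserving $k$-algebra automorphisms) and with $\beta(A)\le1$; $A^G$ is the graded subring of invariants. For $p$ equal to $0$ or a prime, $\beta_p(G):=\beta_F(G)$ where $F$ is any field of characteristic $p$ (for a field $F$, $\beta_F(G)$ depends only on the characteristic of $F$). For a ring $k$ define the set $\operatorname{char}(k):=\{0\}$ if $\mathbb Q\subseteq k$ (i.e. $k$ contains $\mathbb Q$ as a subring), and $\operatorname{char}(k):=\{p\text{ prime}\mid p\text{ is not invertible in }k\}$ otherwise. The supremum is taken in $\mathbb N\cup\{\infty\}$. *)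

theory Defs
  imports "HOL-Algebra.Algebra" "HOL-Algebra.Algebraic_Closure_Type" "HOL-Library.Extended_Nat"
begin

text \<open>A commutative ring that is the direct sum of additive subgroups \<open>\<A> d\<close>,
  \<open>d \<in> \<nat>\<close>, with \<open>\<A> d \<cdot> \<A> e \<subseteq> \<A> (d + e)\<close>.\<close>

locale graded_cring = cring R for R (structure) +
  fixes \<A> :: "nat \<Rightarrow> 'a set"
  assumes component_subgroup: "additive_subgroup (\<A> d) R"
    and component_mult: "\<lbrakk>x \<in> \<A> d; y \<in> \<A> e\<rbrakk> \<Longrightarrow> x \<otimes> y \<in> \<A> (d + e)"
    and decomposition: "x \<in> carrier R \<Longrightarrow>
      \<exists>!f. (\<forall>d. f d \<in> \<A> d) \<and> finite {d. f d \<noteq> \<zero>} \<and> x = (\<Oplus>d\<in>{d. f d \<noteq> \<zero>}. f d)"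

definition component_le :: "('a, 'm) ring_scheme \<Rightarrow> (nat \<Rightarrow> 'a set) \<Rightarrow> nat \<Rightarrow> 'a set" where
  "component_le R \<A> n = {\<Oplus>\<^bsub>R\<^esub>d\<in>{..n}. f d | f. \<forall>d\<in>{..n}. f d \<in> \<A> d}"

definition beta :: "('a, 'm) ring_scheme \<Rightarrow> (nat \<Rightarrow> 'a set) \<Rightarrow> enat" where
  "beta R \<A> = Inf {enat n | n. generate_ring R (component_le R \<A> n) = carrier R}"

locale graded_algebra = algebra k A + graded_cring A \<A>
  for k (structure) and A (structure) and \<A> +
  assumes component_smult: "\<lbrakk>c \<in> carrier k; x \<in> \<A> d\<rbrakk> \<Longrightarrow> c \<odot>\<^bsub>A\<^esub> x \<in> \<A> d"

text \<open>In \<^locale>\<open>group_action\<close> the group acts by permutations of the carrier; the further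
  axioms make these permutations degree-preserving \<open>k\<close>-algebra automorphisms.\<close>

locale graded_algebra_action = graded_algebra k A \<A> + group_action G "carrier A" \<phi>
  for k (structure) and G (structure) and A (structure) and \<A> and \<phi> +
  assumes action_ring_hom: "g \<in> carrier G \<Longrightarrow> \<phi> g \<in> ring_hom A A"
    and action_smult:
      "\<lbrakk>g \<in> carrier G; c \<in> carrier k; x \<in> carrier A\<rbrakk> \<Longrightarrow> \<phi> g (c \<odot>\<^bsub>A\<^esub> x) = c \<odot>\<^bsub>A\<^esub> \<phi> g x"
    and action_degree: "\<lbrakk>g \<in> carrier G; x \<in> \<A> d\<rbrakk> \<Longrightarrow> \<phi> g x \<in> \<A> d"

definition fixed_points :: "('g, 'h) monoid_scheme \<Rightarrow> ('a, 'm) ring_scheme \<Rightarrow>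
    ('g \<Rightarrow> 'a \<Rightarrow> 'a) \<Rightarrow> 'a set" where
  "fixed_points G A \<phi> = {x \<in> carrier A. \<forall>g\<in>carrier G. \<phi> g x = x}"

definition beta_invariants :: "('g, 'h) monoid_scheme \<Rightarrow> ('a, 'm) ring_scheme \<Rightarrow>
    (nat \<Rightarrow> 'a set) \<Rightarrow> ('g \<Rightarrow> 'a \<Rightarrow> 'a) \<Rightarrow> enat" where
  "beta_invariants G A \<A> \<phi> =
     beta (A\<lparr>carrier := fixed_points G A \<phi>\<rparr>) (\<lambda>d. \<A> d \<inter> fixed_points G A \<phi>)"

text \<open>\<open>\<beta>\<^sub>k(G)\<close>. A supremum over the proper class of all graded \<open>k\<close>-algebras is not
  a HOL term, so the algebras have their elements in \<^typ>\<open>'k + nat + 'u\<close> for a free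
  type \<^typ>\<open>'u\<close>: any given algebra has a copy of this form for suitable \<^typ>\<open>'u\<close>.
  The summand \<^typ>\<open>'k + nat\<close> makes the value independent of \<^typ>\<open>'u\<close> and hence equal to the
  supremum over all algebras: if \<open>a \<in> A\<^sup>G\<close> of degree \<open>n\<close> is not in the subring generated by
  the invariants of degree \<open>< n\<close>, this persists in any \<open>G\<close>-stable graded subalgebra containing
  \<open>a\<close>. One such subalgebra is generated over \<open>k\<close> by finitely many elements of degrees
  \<open>0\<close> and \<open>1\<close>, and so injects into \<^typ>\<open>'k + nat\<close>.\<close>

definition beta_over :: "'u itself \<Rightarrow> ('k, 'm) ring_scheme \<Rightarrow> ('g, 'h) monoid_scheme \<Rightarrow> enat" where
  "beta_over (_ :: 'u itself) k G =
     Sup {beta_invariants G A \<A> \<phi> | (A :: ('k, 'k + nat + 'u) module) \<A> \<phi>.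
            graded_algebra_action k G A \<A> \<phi> \<and> beta A \<A> \<le> 1}"

definition has_characteristic :: "('a, 'm) ring_scheme \<Rightarrow> nat \<Rightarrow> bool" where
  "has_characteristic R p \<longleftrightarrow> (\<forall>n::nat. [n] \<cdot>\<^bsub>R\<^esub> \<one>\<^bsub>R\<^esub> = \<zero>\<^bsub>R\<^esub> \<longleftrightarrow> p dvd n)"

definition contains_rationals :: "('a, 'm) ring_scheme \<Rightarrow> bool" where
  "contains_rationals R \<longleftrightarrow>
     (\<exists>h \<in> ring_hom (ring_of_type_algebra :: rat ring) R. inj_on h UNIV)"

definition char_set :: "('a, 'm) ring_scheme \<Rightarrow> nat set" where
  "char_set k = (if contains_rationals k then {0}
     else {p. Factorial_Ring.prime p \<and> [p] \<cdot>\<^bsub>k\<^esub> \<one>\<^bsub>k\<^esub> \<notin> Units k})"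

end

theory Submission
  imports Defs
begin

text \<open>If \<open>|G|\<close> is invertible in \<open>k\<close>, every invariant is a sum of traces of products of degree-one
  elements (and of elements of degree zero), so \<open>\<beta>\<^sub>k(G)\<close> is decided by the question whether
  \<open>tr(y\<^sub>1 \<cdots> y\<^sub>n)\<close> lies in the ring generated by invariants of lower degree. The identity
  \<open>\<Sum>\<^sub>g tr(a \<cdot> g b) = tr(a) tr(b)\<close> provides universal relations with integral coefficients between the traces
  of the products \<open>g\<^sub>1 y\<^sub>1 \<cdots> g\<^sub>n y\<^sub>n\<close>. Elimination over \<open>\<int>\<close> shows that for a given \<open>p\<close> (a prime or \<open>0\<close>)
  either these relations express some multiple \<open>e tr(y\<^sub>1 \<cdots> y\<^sub>n)\<close> with \<open>p\<close> not dividing \<open>e\<close>, or there is a function on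
  \<open>G\<^sup>n\<close> that vanishes modulo \<open>p\<close> on all relations but not identically. In the second case, if \<open>p \<in> char(k)\<close>, the function
  induces a functional on the multilinear part of a polynomial ring over \<open>k\<close> which is a derivation
  modulo \<open>p\<close> on invariants, and so exhibits an indecomposable invariant of degree \<open>n\<close>.
  If \<open>p\<close> divides \<open>|G|\<close>, the constant function \<open>1\<close> is of this kind for every \<open>n\<close>, which
  takes care of the modular case. Altogether \<open>\<beta>\<^sub>k(G)\<close> is the supremum of all \<open>n \<ge> 1\<close> for which the second
  case occurs for some \<open>p \<in> char(k)\<close>, and \<open>char(F) = {p}\<close> for a field of characteristic \<open>p\<close>.\<close>

section \<open>Integers and the characteristic set\<close>

text \<open>The obstacle is that \<open>k\<close> need not be an algebra over a field and that
  \<open>char_set k\<close> may be infinite, so the upper bound cannot be assembled one field at a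
  time. Both bounds use only integers inside \<open>k\<close>. Above: the relations hold for all
  degree-one elements at once, so for a fixed length the admissible multipliers e form an ideal of
  the integers; its generator escapes every p in \<open>char_set k\<close> simultaneously and is
  therefore a unit of \<open>k\<close>. Below: one computes modulo the ideal pk, and all that
  matters about p is that no integer outside pZ lies in pk. The two bounds meet by duality. The
  relations exhibited are sums over orbits of G shifting a part T of the indices, and a functional
  respects them modulo p if its sums over these orbits vanish. In a product of two invariants a
  monomial splits into a part T and the rest, and invariance makes the coefficients constant on the
  same orbits. So the condition that blocks the upper bound is the one that makes the functional a
  derivation. That functional sees only monomials with each index once, which is why a quotient of
  finite rank over \<open>k\<close> can replace the polynomial ring.\<close>

text \<open>For \<open>p = 0\<close> divisibility by \<open>p\<close> means vanishing, so Gaussian elimination over \<open>\<rat>\<close> and over the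
  prime fields is treated at once.\<close>

lemma lattice_dichotomy:
  fixes p :: nat and L :: "('x \<Rightarrow> int) set"
  assumes "finite U" and p: "p = 0 \<or> Factorial_Ring.prime p"
    and "\<And>a b v w. \<lbrakk>v \<in> L; w \<in> L\<rbrakk> \<Longrightarrow> (\<lambda>x. a * v x + b * w x) \<in> L" and "L \<noteq> {}"
  shows "(\<exists>e. \<not> int p dvd e \<and> (\<forall>u. \<exists>w\<in>L. \<forall>x\<in>U. w x = e * u x)) \<or>
    (\<exists>l. (\<forall>w\<in>L. int p dvd (\<Sum>x\<in>U. l x * w x)) \<and> (\<exists>x\<in>U. \<not> int p dvd l x))"
  using assms(1,3,4)
proof (induction U arbitrary: L rule: finite_induct)
  case empty
  have "\<not> int p dvd 1" using p by auto
  moreover have "\<exists>w\<in>L. \<forall>x\<in>{}. w x = 1 * u x" for u :: "'x \<Rightarrow> int" using empty(2) by auto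
  ultimately show ?case by blast
next
  case (insert a Y)
  have prod: "\<not> int p dvd x * y" if "\<not> int p dvd x" "\<not> int p dvd y" for x y
    using p that by (auto simp: prime_dvd_mult_iff)
  show ?case
  proof (cases "\<exists>v\<in>L. \<not> int p dvd v a")
    case False
    \<comment> \<open>With every \<open>a\<close>-coordinate divisible by p, evaluation at
      \<open>a\<close> is the required functional.\<close>
    have "int p dvd (\<Sum>x\<in>insert a Y. (if x = a then 1 else 0) * w x)" if "w \<in> L" for w
    proof -
      have "(\<Sum>x\<in>insert a Y. (if x = a then 1 else 0) * w x) = w a + (\<Sum>x\<in>Y. 0)"
        using insert.hyps by (auto simp: sum.insert intro!: sum.neutral)
      then show ?thesis using False that by simp
    qed
    moreover have "\<not> int p dvd 1" using p by auto
    ultimately show ?thesis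
      by (intro disjI2 exI[of _ "\<lambda>x. if x = a then 1 else 0"]) auto
  next
    case True
    then obtain v where v: "v \<in> L" "\<not> int p dvd v a" by blast
    \<comment> \<open>Elimination without division: \<open>v a * w - w a * v\<close> has coordinate
      zero at \<open>a\<close>, and the factor \<open>v a\<close> does no harm because p does not
      divide it.\<close>
    define L' where "L' = {w \<in> L. w a = 0}"
    have L': "(\<lambda>x. s * v x + t * w x) \<in> L'" if "v \<in> L'" "w \<in> L'" for s t v w
      using that insert.prems(1) by (auto simp: L'_def)
    have elim: "(\<lambda>x. v a * w x + (- w a) * v x) \<in> L'" if "w \<in> L" for w
      unfolding L'_def using insert.prems(1)[OF that v(1), of "v a" "- w a"] by simp
    from elim[OF v(1)] have "L' \<noteq> {}" by blast
    with insert.IH[of L'] L'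
    have "(\<exists>e. \<not> int p dvd e \<and> (\<forall>u. \<exists>w\<in>L'. \<forall>x\<in>Y. w x = e * u x)) \<or>
      (\<exists>l. (\<forall>w\<in>L'. int p dvd (\<Sum>x\<in>Y. l x * w x)) \<and> (\<exists>x\<in>Y. \<not> int p dvd l x))"
      by presburger
    then show ?thesis
    proof (elim disjE exE conjE)
      fix e assume e: "\<not> int p dvd e" "\<forall>u. \<exists>w\<in>L'. \<forall>x\<in>Y. w x = e * u x"
      have "\<exists>w\<in>L. \<forall>x\<in>insert a Y. w x = (e * v a) * u x" for u
      proof -
        \<comment> \<open>Adding \<open>e * u a\<close> times \<open>v\<close> to this target gives
          \<open>e * v a * u\<close> on \<open>Y\<close>; at \<open>a\<close>, where
          \<open>w\<close> is zero, it gives the same multiple of \<open>u a\<close>.\<close>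
        obtain w where w: "w \<in> L'" "\<forall>x\<in>Y. w x = e * (v a * u x - u a * v x)"
          using e(2)[rule_format, of "\<lambda>x. v a * u x - u a * v x"] by auto
        have w': "(\<lambda>x. 1 * w x + (e * u a) * v x) \<in> L"
          using w(1) v(1) by (intro insert.prems(1)) (auto simp: L'_def)
        show ?thesis
          by (rule bexI[OF _ w']) (use w in \<open>auto simp: L'_def algebra_simps\<close>)
      qed
      with prod[OF e(1) v(2)] show ?thesis by blast
    next
      fix l assume l: "\<forall>w\<in>L'. int p dvd (\<Sum>x\<in>Y. l x * w x)" "\<exists>x\<in>Y. \<not> int p dvd l x"
      \<comment> \<open>The value at \<open>a\<close> is chosen so that \<open>l'\<close> kills the
        pivot \<open>v\<close>. Pairing \<open>l'\<close> with \<open>w\<close> then equals pairing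
        \<open>l\<close> with the eliminated vector.\<close>
      define l' where "l' x = (if x = a then - (\<Sum>y\<in>Y. l y * v y) else v a * l x)" for x
      have "int p dvd (\<Sum>x\<in>insert a Y. l' x * w x)" if "w \<in> L" for w
      proof -
        have "(\<Sum>x\<in>insert a Y. l' x * w x) = l' a * w a + (\<Sum>x\<in>Y. v a * l x * w x)"
          using insert.hyps by (auto simp: l'_def intro!: sum.cong)
        also have "\<dots> = (\<Sum>x\<in>Y. l x * (v a * w x + (- w a) * v x))"
          by (simp add: l'_def sum_distrib_left sum_distrib_right sum_subtractf sum.distrib
              sum_negf algebra_simps)
        finally show ?thesis using l(1) elim[OF that] by simp
      qed
      moreover obtain x where x: "x \<in> Y" "\<not> int p dvd l x" using l(2) by blast
      then have "\<not> int p dvd l' x" using prod[OF v(2) x(2)] insert.hyps by (auto simp: l'_def)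
      ultimately show ?thesis using x(1) by blast
    qed
  qed
qed

text \<open>\<open>E\<close> is an ideal of the integers, so it has a generator d. A p dividing d
  would divide all of \<open>E\<close>; hence d serves every p in \<open>P\<close> at once, even for
  infinite \<open>P\<close>.\<close>

lemma int_ideal_avoiding:
  fixes E :: "int set"
  assumes comb: "\<And>a b x y. \<lbrakk>x \<in> E; y \<in> E\<rbrakk> \<Longrightarrow> a * x + b * y \<in> E" and "E \<noteq> {}"
    and P: "\<And>p. p \<in> P \<Longrightarrow> \<exists>e\<in>E. \<not> int p dvd e"
  shows "\<exists>e\<in>E. \<forall>p\<in>P. \<not> int p dvd e"
proof -
  have "\<exists>d\<in>E. \<forall>e\<in>E. d dvd e"
  proof (cases "E \<subseteq> {0}")
    case True
    then show ?thesis using assms(2) by auto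
  next
    case False
    then obtain x where x: "x \<in> E" "x \<noteq> 0" by auto
    have "\<exists>d. d \<in> E \<and> d \<noteq> 0 \<and> (\<forall>y. y \<in> E \<and> y \<noteq> 0 \<longrightarrow> nat \<bar>d\<bar> \<le> nat \<bar>y\<bar>)"
      using ex_has_least_nat[of "\<lambda>x. x \<in> E \<and> x \<noteq> 0" x "\<lambda>x. nat \<bar>x\<bar>"] x by auto
    then obtain d where d: "d \<in> E" "d \<noteq> 0" and
      least: "\<And>y. y \<in> E \<Longrightarrow> y \<noteq> 0 \<Longrightarrow> nat \<bar>d\<bar> \<le> nat \<bar>y\<bar>" by blast
    have "d dvd e" if "e \<in> E" for e
    proof -
      have "1 * e + (- (e div d)) * d \<in> E" using comb d(1) that by blast
      moreover have "1 * e + (- (e div d)) * d = e mod d"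
        by (simp add: minus_div_mult_eq_mod)
      ultimately have "e mod d \<in> E" by simp
      moreover have "nat \<bar>e mod d\<bar> < nat \<bar>d\<bar>" using abs_mod_less[OF d(2)] d(2) by simp
      ultimately have "e mod d = 0" using least[of "e mod d"] by linarith
      then show ?thesis by auto
    qed
    with d(1) show ?thesis by blast
  qed
  then show ?thesis using P by (meson dvd_trans)
qed

section \<open>Integers inside a commutative ring\<close>

context cring
begin

lemma int_unit_add: "add_pow R (a + b) \<one> = add_pow R a \<one> \<oplus> add_pow R (b::int) \<one>"
  by (simp add: add.int_pow_mult)

lemma int_unit_mult: "add_pow R (a * b) \<one> = add_pow R a \<one> \<otimes> add_pow R (b::int) \<one>"
  using add_pow_ldistr_int[of \<one> "add_pow R b \<one>" a] add.int_pow_pow[of \<one> a b]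
  by (simp add: mult.commute)

lemma int_unit_closed: "add_pow R (a::int) \<one> \<in> carrier R"
  by simp

lemma int_unit_nat: "add_pow R (int n) \<one> = add_pow R n \<one>"
  by (simp add: add_pow_int_ge)

lemma UnitsI_comm: "\<lbrakk>x \<otimes> y = \<one>; x \<in> carrier R; y \<in> carrier R\<rbrakk> \<Longrightarrow> x \<in> Units R"
  unfolding Units_def using m_comm[of x y] by auto

text \<open>The embedding sends n/d to the solution z of d z = n, which exists and is unique because
  d is invertible. \<open>rep\<close> admits every fraction representing q, so sums and products may
  be computed with whatever denominator is convenient; \<open>uniq\<close> shows that the choice is
  immaterial.\<close>

lemma contains_rationalsI:
  assumes nontrivial: "\<one> \<noteq> \<zero>" and units: "\<And>m::int. m \<noteq> 0 \<Longrightarrow> add_pow R m \<one> \<in> Units R"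
  shows "contains_rationals R"
proof -
  define rep where "rep q z \<longleftrightarrow> z \<in> carrier R \<and>
    (\<exists>n d. d \<noteq> 0 \<and> q * of_int d = of_int n \<and> add_pow R d \<one> \<otimes> z = add_pow R n \<one>)" for q :: rat and z
  have repI: "rep q z" if "z \<in> carrier R" "d \<noteq> 0" "q * of_int d = of_int n"
      "add_pow R d \<one> \<otimes> z = add_pow R n \<one>" for q z d n
    unfolding rep_def using that by blast
  have cancel: "x = y" if "add_pow R d \<one> \<otimes> x = add_pow R d \<one> \<otimes> y" "d \<noteq> 0" "x \<in> carrier R" "y \<in> carrier R"
    for d :: int and x y
    using that units[of d] by (simp add: Units_l_cancel)
  have ex: "\<exists>z. rep q z" for q
  proof -
    obtain n d where q: "quotient_of q = (n, d)" by fastforce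
    then have d: "d > 0" "q = of_int n / of_int d"
      using quotient_of_denom_pos quotient_of_div by auto
    then have "add_pow R d \<one> \<in> Units R" using units by simp
    then have "rep q (inv (add_pow R d \<one>) \<otimes> add_pow R n \<one>)"
      using d by (intro repI[of _ d _ n]) (auto simp: m_assoc[symmetric])
    then show ?thesis by blast
  qed
  have uniq: "z = z'" if r: "rep q z" and r': "rep q z'" for q z z'
  proof -
    obtain n d where 1: "d \<noteq> 0" "q * of_int d = of_int n" "add_pow R d \<one> \<otimes> z = add_pow R n \<one>"
      using r unfolding rep_def by (elim conjE exE)
    obtain n' d' where 2: "d' \<noteq> 0" "q * of_int d' = of_int n'" "add_pow R (d') \<one> \<otimes> z' = add_pow R (n') \<one>"
      using r' unfolding rep_def by (elim conjE exE)
    have z: "z \<in> carrier R" "z' \<in> carrier R" using r r' by (auto simp: rep_def)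
    have "of_int (n * d') = (of_int (n' * d) :: rat)"
      using 1(2)[symmetric] 2(2)[symmetric] by simp
    then have "n * d' = n' * d" by (simp only: of_int_eq_iff)
    then have nd: "add_pow R n \<one> \<otimes> add_pow R (d') \<one> = add_pow R (n') \<one> \<otimes> add_pow R d \<one>"
      by (metis int_unit_mult)
    have "add_pow R (d * d') \<one> \<otimes> z = add_pow R (d') \<one> \<otimes> (add_pow R d \<one> \<otimes> z)"
      using z by (simp add: int_unit_mult m_ac)
    also have "\<dots> = add_pow R (n') \<one> \<otimes> add_pow R d \<one>" by (metis 1(3) nd m_comm int_unit_closed)
    also have "\<dots> = add_pow R (d * d') \<one> \<otimes> z'"
      using z by (simp add: int_unit_mult m_ac flip: 2(3))
    finally show ?thesis using cancel z 1(1) 2(1) by simp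
  qed
  define h where "h q = (SOME z. rep q z)" for q
  have h: "rep q (h q)" for q unfolding h_def using ex by (rule someI_ex)
  have hc: "h q \<in> carrier R" for q using h by (auto simp: rep_def)
  have add: "h (q + r) = h q \<oplus> h r" for q r
  proof (rule uniq[OF h])
    obtain n d where 1: "d \<noteq> 0" "q * of_int d = of_int n" "add_pow R d \<one> \<otimes> h q = add_pow R n \<one>"
      using h[of q] unfolding rep_def by (elim conjE exE)
    obtain m e where 2: "e \<noteq> 0" "r * of_int e = of_int m" "add_pow R e \<one> \<otimes> h r = add_pow R m \<one>"
      using h[of r] unfolding rep_def by (elim conjE exE)
    have "add_pow R (d * e) \<one> \<otimes> (h q \<oplus> h r) =
      add_pow R e \<one> \<otimes> (add_pow R d \<one> \<otimes> h q) \<oplus> add_pow R d \<one> \<otimes> (add_pow R e \<one> \<otimes> h r)"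
      using hc by (simp add: int_unit_mult r_distr m_ac)
    also have "\<dots> = add_pow R (e * n + d * m) \<one>" by (simp only: 1(3) 2(3) int_unit_add int_unit_mult)
    finally have eq: "add_pow R (d * e) \<one> \<otimes> (h q \<oplus> h r) = add_pow R (e * n + d * m) \<one>" .
    have "(q + r) * of_int (d * e) = of_int e * (q * of_int d) + of_int d * (r * of_int e)"
      by (simp add: algebra_simps)
    then have "(q + r) * of_int (d * e) = of_int (e * n + d * m)" by (simp add: 1(2) 2(2))
    then show "rep (q + r) (h q \<oplus> h r)"
      using repI[OF _ _ _ eq] 1(1) 2(1) hc by simp
  qed
  have mult: "h (q * r) = h q \<otimes> h r" for q r
  proof (rule uniq[OF h])
    obtain n d where 1: "d \<noteq> 0" "q * of_int d = of_int n" "add_pow R d \<one> \<otimes> h q = add_pow R n \<one>"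
      using h[of q] unfolding rep_def by (elim conjE exE)
    obtain m e where 2: "e \<noteq> 0" "r * of_int e = of_int m" "add_pow R e \<one> \<otimes> h r = add_pow R m \<one>"
      using h[of r] unfolding rep_def by (elim conjE exE)
    have "add_pow R (d * e) \<one> \<otimes> (h q \<otimes> h r) = (add_pow R d \<one> \<otimes> h q) \<otimes> (add_pow R e \<one> \<otimes> h r)"
      using hc by (simp add: int_unit_mult m_ac)
    also have "\<dots> = add_pow R (n * m) \<one>" by (simp only: 1(3) 2(3) int_unit_mult)
    finally have eq: "add_pow R (d * e) \<one> \<otimes> (h q \<otimes> h r) = add_pow R (n * m) \<one>" .
    have "(q * r) * of_int (d * e) = (q * of_int d) * (r * of_int e)" by simp
    then have "(q * r) * of_int (d * e) = of_int (n * m)" by (simp only: 1(2) 2(2) of_int_mult)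
    then show "rep (q * r) (h q \<otimes> h r)"
      using repI[OF _ _ _ eq] 1(1) 2(1) hc by simp
  qed
  have one: "h 1 = \<one>"
    by (rule uniq[OF h]) (rule repI[of _ 1 _ 1], auto)
  have "inj h"
  proof (rule injI)
    fix q r assume eq: "h q = h r"
    have "h ((q - r) + r) = h (q - r) \<oplus> h r" by (rule add)
    then have zero: "h (q - r) = \<zero>"
      using eq hc[of "q - r"] hc[of r] by (simp add: local.add.l_cancel_one)
    obtain n d where 1: "d \<noteq> 0" "(q - r) * of_int d = of_int n" "add_pow R d \<one> \<otimes> h (q - r) = add_pow R n \<one>"
      using h[of "q - r"] unfolding rep_def by (elim conjE exE)
    have "add_pow R n \<one> = \<zero>" using 1(3) zero by simp
    then have "n = 0" using units[of n] nontrivial by (metis Units_r_inv Units_inv_closed l_null)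
    then show "q = r" using 1 by simp
  qed
  moreover have "h \<in> ring_hom ring_of_type_algebra R"
    using add mult one hc by (auto simp: ring_hom_def ring_of_type_algebra_def)
  ultimately show ?thesis unfolding contains_rationals_def by blast
qed

lemma contains_rationals_units:
  assumes "contains_rationals R" "m \<noteq> 0"
  shows "add_pow R (m::int) \<one> \<in> Units R" "add_pow R m \<one> \<noteq> \<zero>"
proof -
  obtain h where h: "h \<in> ring_hom (ring_of_type_algebra :: rat ring) R" "inj h"
    using assms(1) by (auto simp: contains_rationals_def)
  have hom: "h (q + r) = h q \<oplus> h r" "h (q * r) = h q \<otimes> h r" "h 1 = \<one>" "h q \<in> carrier R" for q r
    using h(1) by (auto simp: ring_hom_def ring_of_type_algebra_def)
  have "h (0 + 0) = h 0 \<oplus> h 0" by (rule hom)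
  then have h0: "h 0 = \<zero>" using hom(4) by (simp add: local.add.l_cancel_one)
  have hn: "h (of_nat n) = add_pow R n \<one>" for n :: nat
    by (induction n) (simp_all add: h0 hom a_comm)
  have hm: "h (of_int m) = add_pow R m \<one>" for m :: int
  proof (cases "m \<ge> 0")
    case True
    then show ?thesis using hn[of "nat m"] by (simp add: add_pow_int_ge)
  next
    case False
    have "h (of_int m) \<oplus> h (of_nat (nat (- m))) = \<zero>"
      unfolding hom(1)[symmetric] using False h0 by simp
    then have "h (of_int m) = \<ominus> (add_pow R (nat (- m)) \<one>)"
      by (simp add: hn hom(4) minus_equality)
    then show ?thesis using False by (simp add: add_pow_int_lt)
  qed
  have "add_pow R m \<one> \<otimes> h (1 / of_int m) = \<one>"
    using hom(2)[of "of_int m" "1 / of_int m"] assms(2) hom(3) by (simp add: hm)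
  then show "add_pow R m \<one> \<in> Units R"
    by (rule UnitsI_comm) (simp_all add: hom(4))
  show "add_pow R m \<one> \<noteq> \<zero>"
    using injD[OF h(2), of "of_int m" 0] assms(2) by (auto simp: hm h0)
qed

lemma int_unit_units:
  assumes "\<And>p::nat. Factorial_Ring.prime p \<Longrightarrow> int p dvd m \<Longrightarrow> add_pow R p \<one> \<in> Units R" "m \<noteq> 0"
  shows "add_pow R (m::int) \<one> \<in> Units R"
proof -
  have *: "add_pow R n \<one> \<in> Units R"
    if "\<And>p::nat. Factorial_Ring.prime p \<Longrightarrow> p dvd n \<Longrightarrow> add_pow R p \<one> \<in> Units R" "n \<noteq> 0" for n :: nat
    using that
  proof (induction n rule: prime_divisors_induct)
    case zero
    then show ?case by simp
  next
    case (unit x)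
    then show ?case by simp
  next
    case (factor p x)
    then have "add_pow R x \<one> \<in> Units R" "add_pow R p \<one> \<in> Units R" by auto
    then have "add_pow R (int p * int x) \<one> \<in> Units R"
      unfolding int_unit_mult int_unit_nat by (rule Units_m_closed[rotated])
    then show ?case using int_unit_nat[of "p * x"] by simp
  qed
  have n: "add_pow R (nat \<bar>m\<bar>) \<one> \<in> Units R"
    by (rule *) (use assms in \<open>auto simp: int_dvd_int_iff[symmetric] simp del: int_dvd_int_iff\<close>)
  show ?thesis
  proof (cases "m \<ge> 0")
    case True
    then show ?thesis using n by (simp add: add_pow_int_ge)
  next
    case False
    then have "add_pow R m \<one> = \<ominus> (add_pow R (nat \<bar>m\<bar>) \<one>)" by (simp add: add_pow_int_lt)
    also have "\<dots> = \<ominus> \<one> \<otimes> add_pow R (nat \<bar>m\<bar>) \<one>" by (simp add: l_minus)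
    finally show ?thesis using n Units_m_closed[OF Units_minus_one_closed] by simp
  qed
qed

text \<open>If the rationals are not contained in the ring, each prime divisor of \<open>m\<close>
  lies outside \<open>char_set R\<close> and is thus invertible; so is their product.\<close>

lemma char_set_units:
  assumes "\<And>p. p \<in> char_set R \<Longrightarrow> \<not> int p dvd m"
  shows "add_pow R m \<one> \<in> Units R"
proof (cases "contains_rationals R")
  case True
  then show ?thesis using assms[of 0] contains_rationals_units(1) by (auto simp: char_set_def)
next
  case False
  then have primes: "add_pow R p \<one> \<in> Units R" if "Factorial_Ring.prime p" "int p dvd m" for p
    using assms[of p] that by (auto simp: char_set_def)
  show ?thesis
  proof (cases "m = 0")
    case True
    \<comment> \<open>Every prime divides 0, so here all nonzero integers are invertible. As the
      ring does not contain the rationals, it must be the zero ring, in which 0 is a unit.\<close>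
    then have "add_pow R (i::int) \<one> \<in> Units R" if "i \<noteq> 0" for i
      using primes that int_unit_units[of i] by simp
    then have "\<one> = \<zero>" using False contains_rationalsI by blast
    then show ?thesis using True Units_one_closed by simp
  next
    case False
    then show ?thesis using primes int_unit_units by blast
  qed
qed

lemma char_set_prime_or_zero: "p \<in> char_set R \<Longrightarrow> p = 0 \<or> Factorial_Ring.prime p"
  by (auto simp: char_set_def split: if_splits)

text \<open>The counterpart of \<open>char_set_units\<close> for the lower bound. For a prime p,
  Bezout would turn such an equation into an inverse of p; for p = 0 a nonzero integer would vanish
  in a ring containing the rationals.\<close>

lemma char_set_no_unit_multiple:
  assumes "p \<in> char_set R" "\<not> int p dvd m" "c \<in> carrier R"
  shows "add_pow R m \<one> \<noteq> add_pow R p \<one> \<otimes> c"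
proof
  assume eq: "add_pow R m \<one> = add_pow R p \<one> \<otimes> c"
  show False
  proof (cases "contains_rationals R")
    case True
    then have "p = 0" using assms(1) by (simp add: char_set_def)
    then show False using eq assms contains_rationals_units(2)[OF True, of m] by simp
  next
    case False
    then have p: "Factorial_Ring.prime p" "add_pow R p \<one> \<notin> Units R"
      using assms(1) by (auto simp: char_set_def)
    have "coprime (int p) m" using p(1) assms(2) by (simp add: prime_imp_coprime)
    then obtain u v where uv: "u * int p + v * m = 1"
      using bezout_int[of "int p" m] by (metis coprime_imp_gcd_eq_1)
    have "\<one> = add_pow R (u * int p + v * m) \<one>" by (simp add: uv)
    also have "\<dots> = add_pow R u \<one> \<otimes> add_pow R p \<one> \<oplus> add_pow R v \<one> \<otimes> (add_pow R p \<one> \<otimes> c)"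
      by (simp only: int_unit_add int_unit_mult eq int_unit_nat)
    also have "\<dots> = add_pow R p \<one> \<otimes> (add_pow R u \<one> \<oplus> add_pow R v \<one> \<otimes> c)"
      using assms(3) by (simp add: r_distr m_ac)
    finally have "add_pow R p \<one> \<otimes> (add_pow R u \<one> \<oplus> add_pow R v \<one> \<otimes> c) = \<one>" by simp
    moreover have "add_pow R u \<one> \<oplus> add_pow R v \<one> \<otimes> c \<in> carrier R" using assms(3) by simp
    ultimately have "add_pow R p \<one> \<in> Units R"
      using UnitsI_comm by simp
    then show False using p(2) by simp
  qed
qed

end

lemma char_set_field:
  assumes "field F" "has_characteristic F p"
  shows "char_set F = {p}"
proof -
  interpret field F by fact
  have char: "add_pow F n \<one>\<^bsub>F\<^esub> = \<zero>\<^bsub>F\<^esub> \<longleftrightarrow> p dvd n" for n :: nat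
    using assms(2) by (simp add: has_characteristic_def)
  have unit: "add_pow F n \<one>\<^bsub>F\<^esub> \<in> Units F \<longleftrightarrow> \<not> p dvd n" for n :: nat
    using char[of n] by (simp add: field_Units)
  have "p \<noteq> 1" using char[of 1] by auto
  show ?thesis
  proof (cases "p = 0")
    case True
    have "contains_rationals F"
      by (rule contains_rationalsI) (use True unit in \<open>auto intro!: int_unit_units dest: prime_gt_0_nat\<close>)
    then show ?thesis using True by (simp add: char_set_def)
  next
    case False
    have "\<not> contains_rationals F"
      using contains_rationals_units(2)[of "int p"] False char[of p] int_unit_nat by auto
    moreover have "Factorial_Ring.prime p"
    proof (rule prime_natI)
      show "p \<ge> 2" using False \<open>p \<noteq> 1\<close> by linarith
      fix m n assume mn: "p dvd m * n"
      have "add_pow F (int m * int n) \<one>\<^bsub>F\<^esub> = \<zero>\<^bsub>F\<^esub>"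
        using char[of "m * n"] mn int_unit_nat[of "m * n"] by simp
      then have "add_pow F m \<one>\<^bsub>F\<^esub> \<otimes>\<^bsub>F\<^esub> add_pow F n \<one>\<^bsub>F\<^esub> = \<zero>\<^bsub>F\<^esub>"
        by (simp only: int_unit_mult int_unit_nat)
      then show "p dvd m \<or> p dvd n" using char by (metis integral add.nat_pow_closed one_closed)
    qed
    moreover have "q = p" if "Factorial_Ring.prime q" "p dvd q" for q
      using that \<open>p \<noteq> 1\<close> by (auto simp: prime_nat_iff)
    ultimately show ?thesis by (auto simp: char_set_def unit)
  qed
qed

section \<open>Relations between traces\<close>

text \<open>For \<open>T = UNIV\<close> this is the diagonal action of G on monomials. For smaller
  \<open>T\<close> it twists one factor of a product by g and leaves the other alone, as in a * g
  b.\<close>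

definition shift :: "('g, 'h) monoid_scheme \<Rightarrow> 'g \<Rightarrow> nat set \<Rightarrow> (nat \<rightharpoonup> 'g) \<Rightarrow> (nat \<rightharpoonup> 'g)" where
  "shift G g T f = (\<lambda>i. if i \<in> T then map_option ((\<otimes>\<^bsub>G\<^esub>) g) (f i) else f i)"

definition pointed_maps :: "('g, 'h) monoid_scheme \<Rightarrow> nat \<Rightarrow> (nat \<rightharpoonup> 'g) set" where
  "pointed_maps G n = {f. dom f = {..<n} \<and> ran f \<subseteq> carrier G \<and> f 0 = Some \<one>\<^bsub>G\<^esub>}"

text \<open>Translation by \<open>G\<close> does not change the trace of \<open>g\<^sub>1 y\<^sub>1 \<cdots> g\<^sub>n y\<^sub>n\<close>, so tuples are normalised to have the
  unit at index \<open>0\<close>, and only index sets \<open>T\<close> avoiding \<open>0\<close> have to be shifted.\<close>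

definition indecomposable :: "('g, 'h) monoid_scheme \<Rightarrow> nat \<Rightarrow> nat \<Rightarrow> bool" where
  "indecomposable G n p \<longleftrightarrow> (\<exists>l :: (nat \<rightharpoonup> 'g) \<Rightarrow> int.
     (\<forall>f\<in>pointed_maps G n. \<forall>T. T \<subseteq> {1..<n} \<longrightarrow> T \<noteq> {} \<longrightarrow>
        int p dvd (\<Sum>g\<in>carrier G. l (shift G g T f))) \<and>
     (\<exists>f\<in>pointed_maps G n. \<not> int p dvd l f))"

lemma finite_maps_within:
  assumes "finite D" "finite C"
  shows "finite {f :: 'a \<rightharpoonup> 'b. dom f \<subseteq> D \<and> ran f \<subseteq> C}"
proof -
  have "{f. dom f \<subseteq> D \<and> ran f \<subseteq> C} \<subseteq> (\<Union>D'\<in>Pow D. {f. dom f = D' \<and> ran f \<subseteq> C})" by auto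
  moreover have "finite (\<Union>D'\<in>Pow D. {f :: 'a \<rightharpoonup> 'b. dom f = D' \<and> ran f \<subseteq> C})"
    using assms finite_set_of_finite_maps[OF _ assms(2)] by (auto dest: finite_subset)
  ultimately show ?thesis by (rule finite_subset)
qed

lemma finite_pointed_maps: "finite (carrier G) \<Longrightarrow> finite (pointed_maps G n)"
  by (rule finite_subset[OF _ finite_maps_within[of "{..<n}" "carrier G"]])
    (auto simp: pointed_maps_def)

definition unit_map :: "('g, 'h) monoid_scheme \<Rightarrow> nat \<Rightarrow> (nat \<rightharpoonup> 'g)" where
  "unit_map G n = (\<lambda>i. if i < n then Some \<one>\<^bsub>G\<^esub> else None)"

lemma unit_map_pointed:
  assumes "group G" "n > 0"
  shows "unit_map G n \<in> pointed_maps G n"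
proof -
  interpret group G by fact
  show ?thesis using assms(2)
    by (auto simp: pointed_maps_def unit_map_def ran_def split: if_splits)
qed

lemma pointed_mapsE:
  assumes "f \<in> pointed_maps G n" "i < n"
  obtains x where "f i = Some x" "x \<in> carrier G"
proof -
  have "i \<in> dom f" using assms by (simp add: pointed_maps_def)
  then obtain x where "f i = Some x" by blast
  moreover have "x \<in> carrier G" using assms(1) ranI[of f i x, OF \<open>f i = Some x\<close>]
    by (auto simp: pointed_maps_def)
  ultimately show ?thesis by (rule that)
qed

lemma indecomposable_if_dvd_order:
  assumes "group G" "n > 0" "p \<noteq> 1" "p dvd card (carrier G)"
  shows "indecomposable G n p"
  unfolding indecomposable_def
  using unit_map_pointed[OF assms(1,2)] assms(3,4)
  by (intro exI[of _ "\<lambda>_. 1"]) (auto simp flip: int_dvd_int_iff)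

lemma dom_shift [simp]: "dom (shift G g T f) = dom f"
  by (auto simp: shift_def dom_def)

lemma (in group) ran_shift:
  assumes "ran f \<subseteq> carrier G" "g \<in> carrier G"
  shows "ran (shift G g T f) \<subseteq> carrier G"
proof
  fix y assume "y \<in> ran (shift G g T f)"
  then obtain i where "shift G g T f i = Some y" by (auto simp: ran_def)
  then show "y \<in> carrier G" using assms
    by (auto simp: shift_def split: if_splits intro!: ranI)
qed

lemma (in group) shift_pointed:
  assumes "f \<in> pointed_maps G n" "g \<in> carrier G" "0 \<notin> T"
  shows "shift G g T f \<in> pointed_maps G n"
proof -
  have "shift G g T f 0 = f 0" using assms(3) by (simp add: shift_def)
  then show ?thesis using assms ran_shift[of f g T] by (simp add: pointed_maps_def)
qed

text \<open>Shifting along a set that meets the domain is a free action: g can be read off at a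
  single index of \<open>T\<close>.\<close>

lemma (in group) inj_shift:
  assumes "f i = Some x" "x \<in> carrier G" "i \<in> T"
  shows "inj_on (\<lambda>g. shift G g T f) (carrier G)"
proof (rule inj_onI)
  fix g h assume gh: "g \<in> carrier G" "h \<in> carrier G" "shift G g T f = shift G h T f"
  have "shift G g T f i = shift G h T f i" by (simp only: gh(3))
  then have "g \<otimes> x = h \<otimes> x" using assms by (simp add: shift_def)
  then show "g = h" using gh assms by simp
qed

lemma (in abelian_monoid) finsum_mem:
  assumes "\<zero> \<in> H" "\<And>x y. \<lbrakk>x \<in> H; y \<in> H\<rbrakk> \<Longrightarrow> x \<oplus> y \<in> H" "H \<subseteq> carrier G" "f \<in> B \<rightarrow> H"
  shows "finsum G f B \<in> H"
  using assms(4)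
proof (induction B rule: infinite_finite_induct)
  case (insert b B)
  then have "f b \<in> carrier G" "f \<in> B \<rightarrow> carrier G" using assms(3) by auto
  then show ?case using insert assms(2) by simp
qed (use assms(1) in simp_all)

lemma (in module) add_pow_smult:
  assumes "x \<in> carrier M"
  shows "add_pow M (e::int) x = add_pow R e \<one> \<odot>\<^bsub>M\<^esub> x"
proof -
  have nat: "add_pow M n x = add_pow R n \<one> \<odot>\<^bsub>M\<^esub> x" for n :: nat
    using assms by (induction n) (simp_all add: smult_l_distr)
  show ?thesis
  proof (cases "e \<ge> 0")
    case True
    then show ?thesis using nat[of "nat e"] by (simp add: add_pow_int_ge)
  next
    case False
    then show ?thesis using nat[of "nat (- e)"] assms
      by (simp add: add_pow_int_lt smult_l_minus)
  qed
qed

lemma component_leI: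
  assumes "abelian_monoid R" "x \<in> \<A> d" "d \<le> N" "\<And>e. \<zero>\<^bsub>R\<^esub> \<in> \<A> e" "x \<in> carrier R"
  shows "x \<in> component_le R \<A> N"
proof -
  interpret abelian_monoid R by fact
  have "(\<Oplus>\<^bsub>R\<^esub>e\<in>{..N}. if d = e then x else \<zero>\<^bsub>R\<^esub>) = x"
    using finsum_singleton[of d "{..N}" "\<lambda>_. x"] assms(3,5) by simp
  then show ?thesis unfolding component_le_def using assms(2,4)
    by (intro CollectI exI[of _ "\<lambda>e. if d = e then x else \<zero>\<^bsub>R\<^esub>"]) auto
qed

text \<open>The infimum of a nonempty set of naturals is attained. Allowing any
  \<open>n \<le> N\<close> on the right keeps this valid for arbitrary families, where generation up
  to n need not pass on to N.\<close>

lemma beta_le_iff: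
  "beta R \<A> \<le> enat N \<longleftrightarrow> (\<exists>n\<le>N. generate_ring R (component_le R \<A> n) = carrier R)"
proof
  let ?S = "{enat n | n. generate_ring R (component_le R \<A> n) = carrier R}"
  assume le: "beta R \<A> \<le> enat N"
  then have "?S \<noteq> {}" unfolding beta_def by (metis Inf_enat_def infinity_ileE)
  then have "Inf ?S \<in> ?S" using wellorder_InfI by (metis (lifting) ex_in_conv)
  with le show "\<exists>n\<le>N. generate_ring R (component_le R \<A> n) = carrier R"
    unfolding beta_def by auto
next
  assume "\<exists>n\<le>N. generate_ring R (component_le R \<A> n) = carrier R"
  then show "beta R \<A> \<le> enat N" unfolding beta_def by (auto intro!: Inf_lower2)
qed

section \<open>Trace identities for a finite group action\<close>

locale finite_graded_action = K: cring k + A: cring A + G: group G +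
  graded_algebra_action k G A \<A> \<phi>
  for k :: "('k, 'm) ring_scheme" and G :: "('g, 'h) monoid_scheme"
    and A :: "('k, 'a, 'n) module_scheme" (structure) and \<A> and \<phi> +
  assumes finite_G: "finite (carrier G)"
begin

abbreviation "F \<equiv> fixed_points G A \<phi>"

definition tr where "tr x = (\<Oplus>g\<in>carrier G. \<phi> g x)"

lemma comp_subset: "x \<in> \<A> d \<Longrightarrow> x \<in> carrier A"
  using component_subgroup[of d] by (auto simp: additive_subgroup_def dest: subgroup.mem_carrier)

lemma comp_zero: "\<zero> \<in> \<A> d"
  using component_subgroup[of d] by (rule additive_subgroup.zero_closed)

lemma comp_add: "x \<in> \<A> d \<Longrightarrow> y \<in> \<A> d \<Longrightarrow> x \<oplus> y \<in> \<A> d"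
  using component_subgroup[of d] by (rule additive_subgroup.a_closed)

lemma act_hom: "g \<in> carrier G \<Longrightarrow> ring_hom_cring A A (\<phi> g)"
  using action_ring_hom by (simp add: ring_hom_cring_def ring_hom_cring_axioms_def A.is_cring)

lemma act_closed: "g \<in> carrier G \<Longrightarrow> x \<in> carrier A \<Longrightarrow> \<phi> g x \<in> carrier A"
  using element_image[of g x] by simp

lemma act_mult: "\<lbrakk>g \<in> carrier G; x \<in> carrier A; y \<in> carrier A\<rbrakk> \<Longrightarrow> \<phi> g (x \<otimes> y) = \<phi> g x \<otimes> \<phi> g y"
  by (rule ring_hom_mult[OF action_ring_hom])

lemma act_add: "\<lbrakk>g \<in> carrier G; x \<in> carrier A; y \<in> carrier A\<rbrakk> \<Longrightarrow> \<phi> g (x \<oplus> y) = \<phi> g x \<oplus> \<phi> g y"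
  by (rule ring_hom_add[OF action_ring_hom])

lemma act_one: "g \<in> carrier G \<Longrightarrow> \<phi> g \<one> = \<one>"
  by (rule ring_hom_one[OF action_ring_hom])

lemma act_minus: "\<lbrakk>g \<in> carrier G; x \<in> carrier A\<rbrakk> \<Longrightarrow> \<phi> g (\<ominus> x) = \<ominus> \<phi> g x"
  by (rule ring_hom_cring.hom_a_inv[OF act_hom])

lemma act_unit: "x \<in> carrier A \<Longrightarrow> \<phi> \<one>\<^bsub>G\<^esub> x = x"
  using fun_cong[OF id_eq_one, of x] by simp

lemma act_finprod:
  assumes "g \<in> carrier G" "y \<in> B \<rightarrow> carrier A"
  shows "\<phi> g (finprod A y B) = finprod A (\<lambda>i. \<phi> g (y i)) B"
  using ring_hom_cring.hom_finprod[OF act_hom[OF assms(1)] assms(2)] by (simp add: comp_def)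

lemma fixed_subring: "subring F A"
proof (rule A.subringI)
  show "F \<subseteq> carrier A" by (auto simp: fixed_points_def)
qed (auto simp: fixed_points_def act_one act_add act_mult act_minus)

lemma fixed_carrier: "x \<in> F \<Longrightarrow> x \<in> carrier A"
  by (simp add: fixed_points_def)

lemma fixed_cring: "cring (A\<lparr>carrier := F\<rparr>)"
  using A.subcringI'[OF fixed_subring] A.subcring_iff[of F] fixed_carrier by auto

lemma tr_closed: "x \<in> carrier A \<Longrightarrow> tr x \<in> carrier A"
  unfolding tr_def by (intro A.finsum_closed) (auto simp: act_closed)

lemma translation_bij: "h \<in> carrier G \<Longrightarrow> (\<lambda>g. h \<otimes>\<^bsub>G\<^esub> g) ` carrier G = carrier G"
  using G.surj_const_mult .

lemma tr_fixed:
  assumes "x \<in> carrier A"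
  shows "tr x \<in> F"
proof -
  have "\<phi> h (tr x) = tr x" if h: "h \<in> carrier G" for h
  proof -
    have "\<phi> h (tr x) = (\<Oplus>g\<in>carrier G. \<phi> h (\<phi> g x))"
      unfolding tr_def using ring_hom_cring.hom_finsum[OF act_hom[OF h], of "\<lambda>g. \<phi> g x" "carrier G"]
      by (simp add: act_closed assms Pi_def)
    also have "\<dots> = (\<Oplus>g\<in>carrier G. \<phi> (h \<otimes>\<^bsub>G\<^esub> g) x)"
      using h assms by (intro A.finsum_cong') (auto simp: composition_rule act_closed)
    also have "\<dots> = (\<Oplus>g\<in>(\<lambda>g. h \<otimes>\<^bsub>G\<^esub> g) ` carrier G. \<phi> g x)"
      using h assms translation_bij[OF h]
      by (intro A.finsum_reindex[symmetric]) (auto simp: act_closed G.inj_on_cmult)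
    finally show ?thesis using translation_bij[OF h] by (simp add: tr_def)
  qed
  then show ?thesis using tr_closed[OF assms] by (simp add: fixed_points_def)
qed

lemma tr_add: "x \<in> carrier A \<Longrightarrow> y \<in> carrier A \<Longrightarrow> tr (x \<oplus> y) = tr x \<oplus> tr y"
proof -
  assume xy: "x \<in> carrier A" "y \<in> carrier A"
  have "tr (x \<oplus> y) = (\<Oplus>g\<in>carrier G. \<phi> g x \<oplus> \<phi> g y)"
    unfolding tr_def using xy by (intro A.finsum_cong') (auto simp: act_add act_closed)
  then show ?thesis unfolding tr_def using xy by (simp add: A.finsum_addf act_closed Pi_def)
qed

lemma tr_zero: "tr \<zero> = \<zero>"
  using tr_add[of \<zero> \<zero>] tr_closed[of \<zero>] by (simp add: A.add.l_cancel_one)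

lemma tr_minus: "x \<in> carrier A \<Longrightarrow> tr (\<ominus> x) = \<ominus> tr x"
  using tr_add[of "\<ominus> x" x] tr_closed[of x] tr_closed[of "\<ominus> x"]
  by (simp add: A.l_neg tr_zero A.minus_equality)

lemma tr_finsum:
  "f \<in> B \<rightarrow> carrier A \<Longrightarrow> tr (finsum A f B) = (\<Oplus>b\<in>B. tr (f b))"
proof (induction B rule: infinite_finite_induct)
  case (insert b B)
  then have "f b \<in> carrier A" "f \<in> B \<rightarrow> carrier A" by auto
  moreover have "(\<lambda>b. tr (f b)) \<in> B \<rightarrow> carrier A" using \<open>f \<in> B \<rightarrow> carrier A\<close> tr_closed by auto
  ultimately show ?case using insert by (simp add: tr_add tr_closed)
qed (simp_all add: tr_zero)

lemma tr_smult:
  assumes "c \<in> carrier k" "x \<in> carrier A"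
  shows "tr (c \<odot> x) = c \<odot> tr x"
proof -
  have "tr (c \<odot> x) = (\<Oplus>g\<in>carrier G. c \<odot> \<phi> g x)"
    unfolding tr_def using assms by (intro A.finsum_cong') (auto simp: action_smult act_closed)
  then show ?thesis
    unfolding tr_def using assms finite_G by (subst finsum_smult_ldistr) (auto simp: act_closed)
qed

lemma tr_of_fixed:
  assumes "x \<in> F"
  shows "tr x = add_pow A (card (carrier G)) x"
proof -
  have "tr x = (\<Oplus>g\<in>carrier G. x)"
    unfolding tr_def using assms by (intro A.finsum_cong') (auto simp: fixed_points_def)
  then show ?thesis using A.add.finprod_const[OF fixed_carrier[OF assms]] by simp
qed

lemma tr_mult_fixed:
  assumes "x \<in> carrier A" "t \<in> F"
  shows "tr (x \<otimes> t) = tr x \<otimes> t"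
proof -
  have t: "t \<in> carrier A" using assms(2) by (rule fixed_carrier)
  have "tr (x \<otimes> t) = (\<Oplus>g\<in>carrier G. \<phi> g x \<otimes> t)"
    unfolding tr_def using assms t
    by (intro A.finsum_cong') (auto simp: act_mult act_closed fixed_points_def)
  then show ?thesis
    unfolding tr_def using assms finite_G t by (subst A.finsum_ldistr) (auto simp: act_closed)
qed

text \<open>Moving the sum over g inside the outer trace replaces \<open>b\<close> by its trace,
  which is invariant and can be pulled out.\<close>

lemma sum_tr_mult_act:
  assumes "a \<in> carrier A" "b \<in> carrier A"
  shows "(\<Oplus>g\<in>carrier G. tr (a \<otimes> \<phi> g b)) = tr a \<otimes> tr b"
proof -
  have "(\<Oplus>g\<in>carrier G. tr (a \<otimes> \<phi> g b)) = tr (\<Oplus>g\<in>carrier G. a \<otimes> \<phi> g b)"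
    using assms by (intro tr_finsum[symmetric]) (auto simp: act_closed)
  also have "\<dots> = tr (a \<otimes> tr b)"
    unfolding tr_def[of b] using assms finite_G by (subst A.finsum_rdistr) (auto simp: act_closed)
  also have "\<dots> = tr a \<otimes> tr b" using assms by (simp add: tr_mult_fixed tr_fixed)
  finally show ?thesis .
qed

lemma tr_degree: "x \<in> \<A> d \<Longrightarrow> tr x \<in> \<A> d"
  unfolding tr_def
  by (intro A.finsum_mem comp_zero comp_add) (auto simp: comp_subset action_degree)

section \<open>Products of degree-one elements as additive generators\<close>

lemma finprod_degree:
  "\<lbrakk>finite B; B \<noteq> {}; y \<in> B \<rightarrow> \<A> 1\<rbrakk> \<Longrightarrow> finprod A y B \<in> \<A> (card B)"
proof (induction B rule: finite_ne_induct)
  case (singleton b)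
  then have "y b \<in> carrier A" using comp_subset by auto
  then show ?case using singleton by simp
next
  case (insert b B)
  then have "y b \<in> \<A> 1" "y \<in> B \<rightarrow> \<A> 1" by auto
  moreover have "y b \<in> carrier A" "y \<in> B \<rightarrow> carrier A" using calculation comp_subset by auto
  ultimately show ?case using insert component_mult[of "y b" 1 "finprod A y B" "card B"] by simp
qed

text \<open>Only nonempty products: there is then a factor at index 0, which can absorb coefficients
  and which later stays fixed under shifts. Degree zero is added separately in
  \<open>generators\<close>.\<close>

definition monomials :: "'a set" where
  "monomials = {finprod A y {..<n} | (n :: nat) y. n > 0 \<and> y \<in> {..<n} \<rightarrow> \<A> 1}"

text \<open>The factor at index 0 absorbs \<open>s\<close>. This is used for multiplication by an
  element of degree zero and for scalars from \<open>k\<close>.\<close>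

lemma finprod_scale:
  assumes "n > 0" "y \<in> {..<n} \<rightarrow> \<A> 1" "\<And>x. x \<in> carrier A \<Longrightarrow> s x \<in> carrier A"
    and "\<And>x z. \<lbrakk>x \<in> carrier A; z \<in> carrier A\<rbrakk> \<Longrightarrow> s (x \<otimes> z) = s x \<otimes> z"
  shows "finprod A (y(0 := s (y 0))) {..<n::nat} = s (finprod A y {..<n})"
proof -
  have y: "y \<in> {..<n} \<rightarrow> carrier A" using assms(2) comp_subset by auto
  have n: "{..<n} = insert 0 {1..<n}" using assms(1) by auto
  have "finprod A (y(0 := s (y 0))) {..<n} = s (y 0) \<otimes> finprod A (y(0 := s (y 0))) {1..<n}"
    unfolding n using y assms by (subst A.finprod_insert) auto
  also have "finprod A (y(0 := s (y 0))) {1..<n} = finprod A y {1..<n}"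
    using y by (intro A.finprod_cong') auto
  also have "s (y 0) \<otimes> finprod A y {1..<n} = s (y 0 \<otimes> finprod A y {1..<n})"
    using y assms(1) by (intro assms(4)[symmetric] A.finprod_closed) auto
  also have "y 0 \<otimes> finprod A y {1..<n} = finprod A y {..<n}"
    unfolding n using y assms(1) by (subst A.finprod_insert) auto
  finally show ?thesis .
qed

lemma monomials_scale:
  assumes "c \<in> \<A> 0" "x \<in> monomials"
  shows "c \<otimes> x \<in> monomials"
proof -
  obtain n :: nat and y where ny: "n > 0" "y \<in> {..<n} \<rightarrow> \<A> 1" "x = finprod A y {..<n}"
    using assms(2) unfolding monomials_def by blast
  have "c \<otimes> x = finprod A (y(0 := c \<otimes> y 0)) {..<n}"
    using ny assms(1) comp_subset by (subst finprod_scale) (auto simp: A.m_assoc)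
  moreover have "c \<otimes> y 0 \<in> \<A> 1" using component_mult[OF assms(1), of "y 0" 1] ny(1,2) by auto
  then have "y(0 := c \<otimes> y 0) \<in> {..<n} \<rightarrow> \<A> 1" using ny(2) by auto
  ultimately show ?thesis using ny(1) unfolding monomials_def by blast
qed

lemma monomials_mult:
  assumes "x \<in> monomials" "z \<in> monomials"
  shows "x \<otimes> z \<in> monomials"
proof -
  obtain n :: nat and y where ny: "n > 0" "y \<in> {..<n} \<rightarrow> \<A> 1" "x = finprod A y {..<n}"
    using assms(1) unfolding monomials_def by blast
  obtain m :: nat and w where mw: "m > 0" "w \<in> {..<m} \<rightarrow> \<A> 1" "z = finprod A w {..<m}"
    using assms(2) unfolding monomials_def by blast
  define v where "v i = (if i < n then y i else w (i - n))" for i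
  have v: "v \<in> {..<n + m} \<rightarrow> \<A> 1" using ny(2) mw(2) by (auto simp: v_def Pi_iff)
  then have vc: "v \<in> {..<n + m} \<rightarrow> carrier A" using comp_subset by auto
  have split: "{..<n + m} = {..<n} \<union> (\<lambda>i. i + n) ` {..<m}"
  proof -
    have "i \<in> (\<lambda>i. i + n) ` {..<m}" if "i < n + m" "\<not> i < n" for i
      using that by (intro image_eqI[of _ _ "i - n"]) auto
    then show ?thesis by auto
  qed
  have "finprod A v {..<n + m} = finprod A v {..<n} \<otimes> finprod A v ((\<lambda>i. i + n) ` {..<m})"
    using vc unfolding split by (intro A.finprod_Un_disjoint) auto
  also have "finprod A v ((\<lambda>i. i + n) ` {..<m}) = finprod A (\<lambda>i. v (i + n)) {..<m}"
    using vc unfolding split by (intro A.finprod_reindex) (auto simp: inj_on_def)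
  also have "\<dots> = z" unfolding mw(3) using mw(2) comp_subset by (intro A.finprod_cong') (auto simp: v_def)
  also have "finprod A v {..<n} = x"
    unfolding ny(3) using ny(2) comp_subset by (intro A.finprod_cong') (auto simp: v_def)
  finally show ?thesis using v ny(1) unfolding monomials_def
    by (intro CollectI exI[of _ "n + m"] exI[of _ v]) auto
qed

lemma monomials_carrier: "x \<in> monomials \<Longrightarrow> x \<in> carrier A"
  unfolding monomials_def using comp_subset by (auto intro!: A.finprod_closed)

text \<open>This set is closed under multiplication, so its additive span is already a ring. The
  unit is listed explicitly, which spares an argument about its degree.\<close>

definition "generators = insert \<one> (\<A> 0 \<union> monomials)"

lemma generators_carrier: "generators \<subseteq> carrier A"
  using comp_subset monomials_carrier by (auto simp: generators_def)

lemma generators_mult: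
  assumes x: "x \<in> generators" and z: "z \<in> generators"
  shows "x \<otimes> z \<in> generators"
proof -
  have c: "x \<in> carrier A" "z \<in> carrier A" using x z generators_carrier by auto
  consider "x = \<one>" | "z = \<one>" | "x \<in> \<A> 0" "z \<in> \<A> 0" | "x \<in> \<A> 0" "z \<in> monomials"
    | "x \<in> monomials" "z \<in> \<A> 0" | "x \<in> monomials" "z \<in> monomials"
    using x z unfolding generators_def by blast
  then show ?thesis
  proof cases
    case 3
    then show ?thesis using component_mult[of x 0 z 0] by (simp add: generators_def)
  next
    case 4
    then show ?thesis using monomials_scale by (simp add: generators_def)
  next
    case 5
    then show ?thesis using monomials_scale[of z x] A.m_comm[OF c] by (simp add: generators_def)
  next
    case 6
    then show ?thesis using monomials_mult by (simp add: generators_def)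
  qed (use x z c in simp_all)
qed

abbreviation "hspan \<equiv> generate (add_monoid A) generators"

lemma span_carrier: "x \<in> hspan \<Longrightarrow> x \<in> carrier A"
  using A.add.generate_in_carrier[of generators] generators_carrier by simp

lemma span_add: "x \<in> hspan \<Longrightarrow> z \<in> hspan \<Longrightarrow> x \<oplus> z \<in> hspan"
  using generate.eng[of x "add_monoid A"] by simp

lemma span_minus: "x \<in> hspan \<Longrightarrow> \<ominus> x \<in> hspan"
  using A.add.generate_m_inv_closed[of generators] generators_carrier by (simp add: a_inv_def)

lemma span_zero: "\<zero> \<in> hspan"
  using generate.one[of "add_monoid A"] by simp

lemma span_mult_generator:
  assumes "x \<in> generators" "z \<in> hspan"
  shows "x \<otimes> z \<in> hspan"
  using assms(2)
proof (induction z rule: generate.induct)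
  case one
  then show ?case using assms(1) generators_carrier span_zero by auto
next
  case (incl h)
  then show ?case using generators_mult[OF assms(1)] by (auto intro: generate.incl)
next
  case (inv h)
  have "x \<otimes> (\<ominus> h) = \<ominus> (x \<otimes> h)" using inv assms(1) generators_carrier by (intro A.r_minus) auto
  moreover have "x \<otimes> h \<in> hspan" using generators_mult[OF assms(1) inv] by (rule generate.incl)
  ultimately show ?case using span_minus by (simp add: a_inv_def)
next
  case (eng h1 h2)
  have "x \<otimes> (h1 \<oplus> h2) = x \<otimes> h1 \<oplus> x \<otimes> h2"
    using eng assms(1) generators_carrier span_carrier by (intro A.r_distr) auto
  then show ?case using eng span_add by simp
qed

lemma span_mult:
  assumes "x \<in> hspan" "z \<in> hspan"
  shows "x \<otimes> z \<in> hspan"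
  using assms(1)
proof (induction x rule: generate.induct)
  case one
  then show ?case using assms(2) span_carrier span_zero by simp
next
  case (incl h)
  then show ?case using span_mult_generator assms(2) by blast
next
  case (inv h)
  have "(\<ominus> h) \<otimes> z = \<ominus> (h \<otimes> z)"
    using inv assms(2) generators_carrier span_carrier by (intro A.l_minus) auto
  moreover have "h \<otimes> z \<in> hspan" using span_mult_generator[OF inv assms(2)] .
  ultimately show ?case using span_minus by (simp add: a_inv_def)
next
  case (eng h1 h2)
  have "(h1 \<oplus> h2) \<otimes> z = h1 \<otimes> z \<oplus> h2 \<otimes> z"
    using eng assms(2) span_carrier by (intro A.l_distr) auto
  then show ?case using eng span_add by simp
qed

text \<open>The span is a ring containing degrees 0 and 1. Since the trace is additive, membership
  of all traces in a subring can afterwards be checked on generators alone.\<close>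

lemma span_eq_carrier:
  assumes "beta A \<A> \<le> 1"
  shows "hspan = carrier A"
proof
  show "hspan \<subseteq> carrier A" using span_carrier by blast
  obtain n where n: "n \<le> 1" "generate_ring A (component_le A \<A> n) = carrier A"
    using assms beta_le_iff[of A \<A> 1] by (auto simp: one_enat_def)
  have comp0: "x \<in> hspan" if "x \<in> \<A> 0" for x
    using that by (intro generate.incl) (simp add: generators_def)
  have comp1: "x \<in> hspan" if "x \<in> \<A> 1" for x
  proof -
    have "x = finprod A (\<lambda>_. x) {..<1::nat}" using comp_subset[OF that] by (simp add: lessThan_Suc)
    then have "x \<in> monomials" unfolding monomials_def using that
      by (intro CollectI exI[of _ "1::nat"] exI[of _ "\<lambda>_. x"]) simp
    then show ?thesis by (intro generate.incl) (simp add: generators_def)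
  qed
  have le: "x \<in> hspan" if x: "x \<in> component_le A \<A> n" for x
  proof -
    obtain f where f: "x = (\<Oplus>d\<in>{..n}. f d)" "\<forall>d\<in>{..n}. f d \<in> \<A> d"
      using x by (auto simp: component_le_def)
    have "f \<in> {..n} \<rightarrow> hspan"
    proof
      fix d assume d: "d \<in> {..n}"
      then have "d = 0 \<or> d = 1" using n(1) by auto
      then show "f d \<in> hspan" using f(2) d comp0 comp1 by auto
    qed
    then show ?thesis unfolding f(1)
      using span_zero span_add span_carrier by (intro A.finsum_mem) auto
  qed
  show "carrier A \<subseteq> hspan"
  proof
    fix x assume "x \<in> carrier A"
    then have "x \<in> generate_ring A (component_le A \<A> n)" using n(2) by simp
    then show "x \<in> hspan"
    proof (induction x rule: generate_ring.induct)
      case one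
      show ?case by (rule generate.incl) (simp add: generators_def)
    qed (auto simp: le span_minus span_add span_mult)
  qed
qed

section \<open>The ring generated by invariants of low degree\<close>

definition invariants_le :: "nat \<Rightarrow> 'a set" where
  "invariants_le N = generate_ring (A\<lparr>carrier := F\<rparr>)
     (component_le (A\<lparr>carrier := F\<rparr>) (\<lambda>d. \<A> d \<inter> F) N)"

lemma component_le_fixed: "component_le (A\<lparr>carrier := F\<rparr>) (\<lambda>d. \<A> d \<inter> F) N \<subseteq> F"
proof -
  interpret FA: cring "A\<lparr>carrier := F\<rparr>" by (rule fixed_cring)
  show ?thesis
    using FA.finsum_closed by (force simp: component_le_def Pi_def)
qed

lemma invariants_le_fixed: "x \<in> invariants_le N \<Longrightarrow> x \<in> F"
proof -
  interpret FA: cring "A\<lparr>carrier := F\<rparr>" by (rule fixed_cring)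
  show "x \<in> invariants_le N \<Longrightarrow> x \<in> F"
    using FA.generate_ring_in_carrier[of "component_le (A\<lparr>carrier := F\<rparr>) (\<lambda>d. \<A> d \<inter> F) N" x]
      component_le_fixed[of N] by (simp add: invariants_le_def)
qed

text \<open>Negation is defined by searching the carrier for an inverse, so it has to be compared
  when the carrier is cut down to \<open>F\<close>.\<close>

lemma minus_consistent: "x \<in> F \<Longrightarrow> \<ominus>\<^bsub>A\<lparr>carrier := F\<rparr>\<^esub> x = \<ominus> x"
proof -
  interpret FA: cring "A\<lparr>carrier := F\<rparr>" by (rule fixed_cring)
  assume x: "x \<in> F"
  then have "\<ominus>\<^bsub>A\<lparr>carrier := F\<rparr>\<^esub> x \<in> F" "\<ominus>\<^bsub>A\<lparr>carrier := F\<rparr>\<^esub> x \<oplus> x = \<zero>"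
    using FA.a_inv_closed FA.l_neg by auto
  then show ?thesis using x A.minus_equality fixed_carrier by metis
qed

lemma invariants_le_subring: "subring (invariants_le N) A"
proof (rule A.subringI)
  show "invariants_le N \<subseteq> carrier A" using invariants_le_fixed fixed_carrier by blast
  show "\<one> \<in> invariants_le N"
    using generate_ring.one[of "A\<lparr>carrier := F\<rparr>"] by (simp add: invariants_le_def)
  show "\<ominus> h \<in> invariants_le N" if "h \<in> invariants_le N" for h
    using that generate_ring.a_inv[of h "A\<lparr>carrier := F\<rparr>"] invariants_le_fixed[OF that]
    by (simp add: invariants_le_def minus_consistent)
  show "h1 \<otimes> h2 \<in> invariants_le N" if "h1 \<in> invariants_le N" "h2 \<in> invariants_le N" for h1 h2
    using that generate_ring.eng_mult[of h1 "A\<lparr>carrier := F\<rparr>"] by (simp add: invariants_le_def)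
  show "h1 \<oplus> h2 \<in> invariants_le N" if "h1 \<in> invariants_le N" "h2 \<in> invariants_le N" for h1 h2
    using that generate_ring.eng_add[of h1 "A\<lparr>carrier := F\<rparr>"] by (simp add: invariants_le_def)
qed

lemma invariants_le_component: "\<lbrakk>x \<in> \<A> d; x \<in> F; d \<le> N\<rbrakk> \<Longrightarrow> x \<in> invariants_le N"
proof -
  interpret FA: cring "A\<lparr>carrier := F\<rparr>" by (rule fixed_cring)
  assume "x \<in> \<A> d" "x \<in> F" "d \<le> N"
  then have "x \<in> component_le (A\<lparr>carrier := F\<rparr>) (\<lambda>d. \<A> d \<inter> F) N"
    using FA.zero_closed comp_zero
    by (intro component_leI[where d = d]) (auto intro: FA.abelian_monoid_axioms)
  then show ?thesis unfolding invariants_le_def by (rule generate_ring.incl)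
qed

lemma zero_add_pow: "add_pow A (0::int) x = \<zero>"
  by (simp add: add_pow_int_ge)

lemma subring_add_pow:
  assumes "subring H A" "x \<in> H"
  shows "add_pow A (e::int) x \<in> H"
proof -
  have nat: "add_pow A n x \<in> H" for n :: nat
    by (induction n) (use assms subringE[OF assms(1)] in auto)
  show ?thesis
    using nat[of "nat e"] nat[of "nat (- e)"] subringE(5)[OF assms(1)]
    by (cases "e \<ge> 0") (auto simp: add_pow_int_ge add_pow_int_lt)
qed

section \<open>Twisted products and the lattice of their relations\<close>

lemma twist_carrier:
  assumes "f \<in> pointed_maps G n" "i < n" "x \<in> \<A> d"
  shows "\<phi> (the (f i)) x \<in> \<A> d"
proof -
  obtain h where "f i = Some h" "h \<in> carrier G" using assms(1,2) by (rule pointed_mapsE)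
  then show ?thesis using assms(3) action_degree by simp
qed

definition twisted :: "(nat \<Rightarrow> 'a) \<Rightarrow> (nat \<rightharpoonup> 'g) \<Rightarrow> nat set \<Rightarrow> 'a" where
  "twisted y f U = finprod A (\<lambda>i. \<phi> (the (f i)) (y i)) U"

lemma twisted_closed:
  assumes "f \<in> pointed_maps G n" "y \<in> {..<n} \<rightarrow> \<A> 1" "U \<subseteq> {..<n}"
  shows "twisted y f U \<in> carrier A"
  unfolding twisted_def using assms comp_subset twist_carrier[OF assms(1)]
  by (intro A.finprod_closed) blast

lemma twisted_unit_map:
  assumes "y \<in> {..<n} \<rightarrow> \<A> 1"
  shows "twisted y (unit_map G n) {..<n} = finprod A y {..<n}"
proof -
  have y: "y i \<in> carrier A" if "i < n" for i using assms comp_subset that by blast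
  then show ?thesis
    unfolding twisted_def by (intro A.finprod_cong') (auto simp: unit_map_def act_unit)
qed

lemma twisted_shift:
  assumes f: "f \<in> pointed_maps G n" and y: "y \<in> {..<n} \<rightarrow> \<A> 1" and T: "T \<subseteq> {1..<n}"
    and g: "g \<in> carrier G"
  shows "twisted y (shift G g T f) {..<n} = twisted y f ({..<n} - T) \<otimes> \<phi> g (twisted y f T)"
proof -
  have T': "T \<subseteq> {..<n}" using T by auto
  then have fin: "finite T" by (rule finite_subset) simp
  have sh: "shift G g T f \<in> pointed_maps G n"
    using f g T by (intro G.shift_pointed) auto
  have c: "\<phi> (the (h i)) (y i) \<in> carrier A" if "h \<in> pointed_maps G n" "i < n" for h i
    using twist_carrier[OF that, of "y i" 1] y that comp_subset by blast
  have "{..<n} = ({..<n} - T) \<union> T" using T' by blast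
  then have "twisted y (shift G g T f) {..<n} =
      twisted y (shift G g T f) ({..<n} - T) \<otimes> twisted y (shift G g T f) T"
    unfolding twisted_def using fin c[OF sh] T'
    by (subst A.finprod_Un_disjoint[symmetric]) (auto simp: Un_absorb2)
  also have "twisted y (shift G g T f) ({..<n} - T) = twisted y f ({..<n} - T)"
    unfolding twisted_def using c[OF f] by (intro A.finprod_cong') (auto simp: shift_def)
  also have "twisted y (shift G g T f) T = \<phi> g (twisted y f T)"
  proof -
    have "\<phi> g (twisted y f T) = finprod A (\<lambda>i. \<phi> g (\<phi> (the (f i)) (y i))) T"
      unfolding twisted_def using c[OF f] T' g by (intro act_finprod) auto
    moreover have "twisted y (shift G g T f) T = finprod A (\<lambda>i. \<phi> g (\<phi> (the (f i)) (y i))) T"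
      unfolding twisted_def
    proof (intro A.finprod_cong')
      show "(\<lambda>i. \<phi> g (\<phi> (the (f i)) (y i))) \<in> T \<rightarrow> carrier A"
        using c[OF f] T' g act_closed by blast
      fix i assume i: "i \<in> T"
      then have "i < n" using T' by auto
      with f obtain h where h: "f i = Some h" "h \<in> carrier G" by (rule pointed_mapsE)
      have "y i \<in> carrier A" using y \<open>i < n\<close> comp_subset by blast
      then show "\<phi> (the (shift G g T f i)) (y i) = \<phi> g (\<phi> (the (f i)) (y i))"
        using h i g by (simp add: shift_def composition_rule)
    qed simp
    ultimately show ?thesis by simp
  qed
  finally show ?thesis .
qed

text \<open>For nonempty \<open>T\<close> both factors on the right are traces of strictly shorter
  products. This is the only source of relations in the proof.\<close>

lemma sum_shift_decomposes:
  assumes f: "f \<in> pointed_maps G n" and y: "y \<in> {..<n} \<rightarrow> \<A> 1" and T: "T \<subseteq> {1..<n}"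
  shows "(\<Oplus>g\<in>carrier G. tr (twisted y (shift G g T f) {..<n})) =
    tr (twisted y f ({..<n} - T)) \<otimes> tr (twisted y f T)"
proof -
  have "T \<subseteq> {..<n}" using T by auto
  then have c: "twisted y f ({..<n} - T) \<in> carrier A" "twisted y f T \<in> carrier A"
    using twisted_closed[OF f y] by auto
  have "(\<Oplus>g\<in>carrier G. tr (twisted y (shift G g T f) {..<n})) =
    (\<Oplus>g\<in>carrier G. tr (twisted y f ({..<n} - T) \<otimes> \<phi> g (twisted y f T)))"
    using twisted_shift[OF f y T] c by (intro A.finsum_cong') (auto intro!: tr_closed act_closed)
  then show ?thesis using sum_tr_mult_act[OF c] by simp
qed

text \<open>The coefficients must work for all \<open>y\<close> at once. Elimination in this lattice
  then yields a multiplier e that is independent of the degree-one elements.\<close>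

definition relations :: "nat \<Rightarrow> nat \<Rightarrow> ((nat \<rightharpoonup> 'g) \<Rightarrow> int) set" where
  "relations N n = {v. \<forall>y\<in>{..<n} \<rightarrow> \<A> 1.
     (\<Oplus>f\<in>pointed_maps G n. add_pow A (v f) (tr (twisted y f {..<n}))) \<in> invariants_le N}"

lemma relations_closed:
  assumes "v \<in> relations N n" "w \<in> relations N n"
  shows "(\<lambda>f. a * v f + b * w f) \<in> relations N n"
proof -
  define P where "P = pointed_maps G n"
  have "(\<Oplus>f\<in>P. add_pow A (a * v f + b * w f) (tr (twisted y f {..<n}))) \<in> invariants_le N"
    if y: "y \<in> {..<n} \<rightarrow> \<A> 1" for y
  proof -
    define m where "m f = tr (twisted y f {..<n})" for f
    have m: "m f \<in> carrier A" if "f \<in> P" for f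
      using that twisted_closed[OF _ y] tr_closed by (simp add: m_def P_def)
    have scale: "(\<Oplus>f\<in>P. add_pow A (c * u f) (m f)) = add_pow A c (\<Oplus>f\<in>P. add_pow A (u f) (m f))"
      for c and u :: "_ \<Rightarrow> int"
    proof -
      have fin: "finite P" using finite_pointed_maps[OF finite_G] by (simp add: P_def)
      have "(\<Oplus>f\<in>P. add_pow A (c * u f) (m f)) = (\<Oplus>f\<in>P. add_pow A c \<one> \<otimes> add_pow A (u f) (m f))"
      proof (intro A.finsum_cong')
        fix f assume "f \<in> P"
        then have mf: "m f \<in> carrier A" by (rule m)
        have "add_pow A (c * u f) (m f) = add_pow A c (add_pow A (u f) (m f))"
          using A.add.int_pow_pow[OF mf, of c "u f"] by (simp add: mult.commute)
        then show "add_pow A (c * u f) (m f) = add_pow A c \<one> \<otimes> add_pow A (u f) (m f)"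
          using mf by (simp add: A.add_pow_ldistr_int)
      qed (use m in auto)
      also have "\<dots> = add_pow A c \<one> \<otimes> (\<Oplus>f\<in>P. add_pow A (u f) (m f))"
        using m fin by (subst A.finsum_rdistr) auto
      also have "\<dots> = add_pow A c (\<Oplus>f\<in>P. add_pow A (u f) (m f))"
        using m by (subst A.add_pow_ldistr_int) (auto intro!: A.finsum_closed)
      finally show ?thesis .
    qed
    have "(\<Oplus>f\<in>P. add_pow A (a * v f + b * w f) (m f)) =
      (\<Oplus>f\<in>P. add_pow A (a * v f) (m f) \<oplus> add_pow A (b * w f) (m f))"
      using m by (intro A.finsum_cong') (auto simp: A.add.int_pow_mult)
    also have "\<dots> = (\<Oplus>f\<in>P. add_pow A (a * v f) (m f)) \<oplus> (\<Oplus>f\<in>P. add_pow A (b * w f) (m f))"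
      using m by (intro A.finsum_addf) auto
    also have "\<dots> \<in> invariants_le N"
      unfolding scale using assms y invariants_le_subring
      by (intro subringE(7)[OF invariants_le_subring] subring_add_pow[OF invariants_le_subring])
        (auto simp: relations_def m_def P_def)
    finally show ?thesis by (simp add: m_def)
  qed
  then show ?thesis by (simp add: relations_def P_def)
qed

text \<open>Pairing with the indicator of a shift orbit is the sum occurring in
  \<open>indecomposable\<close>. So a functional that vanishes modulo p on \<open>relations\<close>
  satisfies the divisibility condition there.\<close>

lemma relations_indicator:
  assumes "T \<subseteq> {1..<n}" "T \<noteq> {}" "f \<in> pointed_maps G n"
    and "\<And>y. y \<in> {..<n} \<rightarrow> \<A> 1 \<Longrightarrow>
      tr (twisted y f ({..<n} - T)) \<otimes> tr (twisted y f T) \<in> invariants_le N"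
  defines "S \<equiv> (\<lambda>g. shift G g T f) ` carrier G"
  shows "(\<lambda>f. if f \<in> S then 1 else 0) \<in> relations N n"
    and "(\<Sum>f\<in>pointed_maps G n. l f * (if f \<in> S then 1 else 0)) = (\<Sum>g\<in>carrier G. l (shift G g T f) :: int)"
proof -
  obtain i where i: "i \<in> T" using assms(2) by blast
  then have "i < n" using assms(1) by auto
  with assms(3) obtain x where "f i = Some x" "x \<in> carrier G" by (rule pointed_mapsE)
  then have inj: "inj_on (\<lambda>g. shift G g T f) (carrier G)" using G.inj_shift i by blast
  have zero: "0 \<notin> T" using assms(1) by auto
  have sub: "S \<subseteq> pointed_maps G n"
    using assms(3) G.shift_pointed[of f n _ T] zero by (auto simp: S_def)
  have fin: "finite (pointed_maps G n)" by (rule finite_pointed_maps[OF finite_G])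
  have "(\<Sum>f\<in>pointed_maps G n. l f * (if f \<in> S then 1 else 0)) = sum l S"
    using sub fin by (intro sum.mono_neutral_cong_right) auto
  then show "(\<Sum>f\<in>pointed_maps G n. l f * (if f \<in> S then 1 else 0)) = (\<Sum>g\<in>carrier G. l (shift G g T f))"
    unfolding S_def using sum.reindex[OF inj, of l] by simp
  have "(\<Oplus>h\<in>pointed_maps G n. add_pow A (if h \<in> S then 1 else 0 :: int) (tr (twisted y h {..<n})))
    \<in> invariants_le N" if y: "y \<in> {..<n} \<rightarrow> \<A> 1" for y
  proof -
    have c: "tr (twisted y h {..<n}) \<in> carrier A" if "h \<in> pointed_maps G n" for h
      using twisted_closed[OF that y] tr_closed by simp
    have "(\<Oplus>h\<in>pointed_maps G n. add_pow A (if h \<in> S then 1 else 0 :: int) (tr (twisted y h {..<n})))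
      = (\<Oplus>h\<in>S. tr (twisted y h {..<n}))"
      using sub fin c by (intro A.add.finprod_mono_neutral_cong_right) (auto simp: zero_add_pow)
    also have "\<dots> = (\<Oplus>g\<in>carrier G. tr (twisted y (shift G g T f) {..<n}))"
      unfolding S_def using inj c sub by (intro A.finsum_reindex) (auto simp: S_def)
    finally show ?thesis
      using sum_shift_decomposes[OF assms(3) y assms(1)] assms(4)[OF y] by simp
  qed
  then show "(\<lambda>f. if f \<in> S then 1 else 0) \<in> relations N n" by (simp add: relations_def)
qed

text \<open>Induction on the length, with \<open>y\<close> arbitrary: a part of a twisted product is
  a shorter product of different degree-one elements.\<close>

lemma tr_product_mem:
  assumes notin: "\<And>n p. \<lbrakk>n > N; p \<in> char_set k\<rbrakk> \<Longrightarrow> \<not> indecomposable G n p"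
    and "n > 0" "y \<in> {..<n::nat} \<rightarrow> \<A> 1"
  shows "tr (finprod A y {..<n}) \<in> invariants_le N"
  using assms(2,3)
proof (induction n arbitrary: y rule: less_induct)
  case (less n)
  show ?case
  proof (cases "n \<le> N")
    case True
    have "finprod A y {..<n} \<in> \<A> n" using finprod_degree[of "{..<n}" y] less.prems by auto
    then show ?thesis using True tr_degree tr_fixed comp_subset invariants_le_component by blast
  next
    case False
    \<comment> \<open>Renumbering \<open>U\<close> by the integers below \<open>card U\<close> makes
      this part an ordinary product of smaller positive length.\<close>
    have part: "tr (twisted y f U) \<in> invariants_le N"
      if "f \<in> pointed_maps G n" "y \<in> {..<n} \<rightarrow> \<A> 1" "U \<subset> {..<n}" "U \<noteq> {}" for f y U
    proof -
      have fin: "finite U" using that(3) finite_subset by blast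
      have m: "card U < n" "card U > 0"
        using psubset_card_mono[OF _ that(3)] fin that(4) by auto
      obtain e where e: "bij_betw e {..<card U} U"
        using ex_bij_betw_nat_finite[OF fin] by (auto simp: atLeast0LessThan)
      have z: "\<phi> (the (f i)) (y i) \<in> \<A> 1" if "i \<in> U" for i
        using twist_carrier[OF \<open>f \<in> pointed_maps G n\<close>] \<open>y \<in> _\<close> \<open>U \<subset> _\<close> that by blast
      have "twisted y f U = finprod A (\<lambda>i. \<phi> (the (f (e i))) (y (e i))) {..<card U}"
        unfolding twisted_def using e z comp_subset
        by (subst A.finprod_reindex[symmetric]) (auto simp: bij_betw_def)
      moreover have "(\<lambda>i. \<phi> (the (f (e i))) (y (e i))) \<in> {..<card U} \<rightarrow> \<A> 1"
        using e z by (auto simp: bij_betw_def)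
      ultimately show ?thesis using less.IH m by simp
    qed
    have rel: "tr (twisted y f ({..<n} - T)) \<otimes> tr (twisted y f T) \<in> invariants_le N"
      if "f \<in> pointed_maps G n" "y \<in> {..<n} \<rightarrow> \<A> 1" "T \<subseteq> {1..<n}" "T \<noteq> {}" for f y T
    proof (rule subringE(6)[OF invariants_le_subring])
      \<comment> \<open>Index 0 never belongs to \<open>T\<close>, so \<open>T\<close> and its
        complement are both nonempty and proper.\<close>
      have "0 \<in> {..<n} - T" using less.prems(1) that(3) by auto
      moreover have "T \<subseteq> {..<n}" using that(3) by auto
      ultimately have "{..<n} - T \<subset> {..<n}" "{..<n} - T \<noteq> {}" "T \<subset> {..<n}" using that(4) by blast+
      then show "tr (twisted y f ({..<n} - T)) \<in> invariants_le N" "tr (twisted y f T) \<in> invariants_le N"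
        using part that by auto
    qed
    \<comment> \<open>Multipliers valid for every \<open>y\<close>; this uniformity is needed at the
      end, where \<open>y\<close> is rescaled.\<close>
    define E where "E = {e :: int. \<forall>y\<in>{..<n} \<rightarrow> \<A> 1.
      add_pow A e (tr (finprod A y {..<n})) \<in> invariants_le N}"
    have closed: "tr (finprod A y {..<n}) \<in> carrier A" if "y \<in> {..<n} \<rightarrow> \<A> 1" for y
      using that comp_subset by (intro tr_closed A.finprod_closed) auto
    have "\<exists>e\<in>E. \<not> int p dvd e" if p: "p \<in> char_set k" for p
    proof -
      have "\<nexists>l. (\<forall>w\<in>relations N n. int p dvd (\<Sum>f\<in>pointed_maps G n. l f * w f)) \<and>
        (\<exists>f\<in>pointed_maps G n. \<not> int p dvd l f)"
      proof
        assume "\<exists>l. (\<forall>w\<in>relations N n. int p dvd (\<Sum>f\<in>pointed_maps G n. l f * w f)) \<and>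
          (\<exists>f\<in>pointed_maps G n. \<not> int p dvd l f)"
        then obtain l where l: "\<And>w. w \<in> relations N n \<Longrightarrow> int p dvd (\<Sum>f\<in>pointed_maps G n. l f * w f)"
          "\<exists>f\<in>pointed_maps G n. \<not> int p dvd l f" by blast
        have "int p dvd (\<Sum>g\<in>carrier G. l (shift G g T f))"
          if "f \<in> pointed_maps G n" "T \<subseteq> {1..<n}" "T \<noteq> {}" for f T
          using l(1) relations_indicator[OF that(2,3,1) rel[OF that(1) _ that(2,3)]] by fastforce
        then have "indecomposable G n p" unfolding indecomposable_def using l(2) by blast
        then show False using notin False p by simp
      qed
      moreover have "(\<lambda>_. 0) \<in> relations N n"
      proof -
        have "(\<Oplus>f\<in>pointed_maps G n. add_pow A (0::int) (tr (twisted y f {..<n}))) = \<zero>" for y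
          by (rule A.add.finprod_one_eqI) (simp add: zero_add_pow)
        then show ?thesis using subringE(2)[OF invariants_le_subring] by (simp add: relations_def)
      qed
      then have "relations N n \<noteq> {}" by blast
      then have "(\<exists>e. \<not> int p dvd e \<and>
          (\<forall>u. \<exists>w\<in>relations N n. \<forall>f\<in>pointed_maps G n. w f = e * u f)) \<or>
        (\<exists>l. (\<forall>w\<in>relations N n. int p dvd (\<Sum>f\<in>pointed_maps G n. l f * w f)) \<and>
          (\<exists>f\<in>pointed_maps G n. \<not> int p dvd l f))"
        using finite_pointed_maps[OF finite_G] K.char_set_prime_or_zero[OF p] relations_closed
        by (intro lattice_dichotomy)
      ultimately have "\<exists>e. \<not> int p dvd e \<and>
          (\<forall>u. \<exists>w\<in>relations N n. \<forall>f\<in>pointed_maps G n. w f = e * u f)"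
        by argo
      then obtain e where e: "\<not> int p dvd e"
        "\<forall>u. \<exists>w\<in>relations N n. \<forall>f\<in>pointed_maps G n. w f = e * u f"
        by (elim exE conjE)
      \<comment> \<open>The unit vector at \<open>unit_map G n\<close> isolates the untwisted
        product among all twisted ones.\<close>
      obtain w where w: "w \<in> relations N n"
        "\<And>f. f \<in> pointed_maps G n \<Longrightarrow> w f = e * (if f = unit_map G n then 1 else 0)"
        using e(2)[rule_format, of "\<lambda>f. if f = unit_map G n then 1 else 0"] by blast
      have "add_pow A e (tr (finprod A y {..<n})) \<in> invariants_le N" if y: "y \<in> {..<n} \<rightarrow> \<A> 1" for y
      proof -
        have u: "unit_map G n \<in> pointed_maps G n"
          using unit_map_pointed[OF G.is_group less.prems(1)] .
        define m where "m f = add_pow A e (tr (twisted y f {..<n}))" for f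
        have m: "m \<in> pointed_maps G n \<rightarrow> carrier A"
          using twisted_closed[OF _ y] tr_closed by (auto simp: m_def)
        have "(\<Oplus>f\<in>pointed_maps G n. add_pow A (w f) (tr (twisted y f {..<n}))) =
          (\<Oplus>f\<in>pointed_maps G n. if unit_map G n = f then m f else \<zero>)"
          using m by (intro A.finsum_cong') (auto simp: w(2) m_def zero_add_pow)
        also have "\<dots> = m (unit_map G n)"
          using u m finite_pointed_maps[OF finite_G] by (intro A.finsum_singleton) auto
        finally have eq: "(\<Oplus>f\<in>pointed_maps G n. add_pow A (w f) (tr (twisted y f {..<n}))) =
          add_pow A e (tr (finprod A y {..<n}))" by (simp add: m_def twisted_unit_map[OF y])
        have "(\<Oplus>f\<in>pointed_maps G n. add_pow A (w f) (tr (twisted y f {..<n}))) \<in> invariants_le N"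
          using w(1) y unfolding relations_def by blast
        then show ?thesis unfolding eq .
      qed
      then show ?thesis using e(1) by (auto simp: E_def)
    qed
    moreover have "a * x + b * z \<in> E" if "x \<in> E" "z \<in> E" for a b x z
    proof -
      have "add_pow A (a * x + b * z) t \<in> invariants_le N"
        if "add_pow A x t \<in> invariants_le N" "add_pow A z t \<in> invariants_le N" "t \<in> carrier A" for t
      proof -
        have "add_pow A (a * x + b * z) t = add_pow A a (add_pow A x t) \<oplus> add_pow A b (add_pow A z t)"
          using A.add.int_pow_mult[OF that(3), of "a * x" "b * z"]
            A.add.int_pow_pow[OF that(3), of a x] A.add.int_pow_pow[OF that(3), of b z]
          by (simp add: mult.commute)
        then show ?thesis
          using that subring_add_pow[OF invariants_le_subring] subringE(7)[OF invariants_le_subring]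
          by simp
      qed
      then show ?thesis using that closed by (simp add: E_def)
    qed
    moreover have "0 \<in> E" using subringE(2)[OF invariants_le_subring] by (simp add: E_def zero_add_pow)
    ultimately obtain e where e: "e \<in> E" "\<forall>p\<in>char_set k. \<not> int p dvd e"
      using int_ideal_avoiding[of E "char_set k"] by blast
    then have "add_pow k e \<one>\<^bsub>k\<^esub> \<in> Units k" using K.char_set_units by blast
    then obtain c where c: "c \<in> carrier k" "add_pow k e \<one>\<^bsub>k\<^esub> \<otimes>\<^bsub>k\<^esub> c = \<one>\<^bsub>k\<^esub>"
      by (metis K.Units_inv_closed K.Units_r_inv)
    have t: "finprod A y {..<n} \<in> carrier A" using less.prems(2) comp_subset by (intro A.finprod_closed) auto
    \<comment> \<open>Applying the multiplier e to the tuple rescaled by \<open>c\<close> gives e c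
      = 1 times the trace. Inserting \<open>c\<close> at index 0 alone scales the whole product by
      \<open>c\<close> once.\<close>
    have "y(0 := c \<odot> y 0) \<in> {..<n} \<rightarrow> \<A> 1"
      using less.prems c(1) component_smult by (auto simp: Pi_iff)
    then have "add_pow A e (tr (finprod A (y(0 := c \<odot> y 0)) {..<n})) \<in> invariants_le N"
      using e(1) by (simp add: E_def)
    also have "finprod A (y(0 := c \<odot> y 0)) {..<n} = c \<odot> finprod A y {..<n}"
      using less.prems c(1) by (intro finprod_scale) (auto simp: smult_assoc2)
    also have "add_pow A e (tr (c \<odot> finprod A y {..<n})) =
        add_pow k e \<one>\<^bsub>k\<^esub> \<odot> (c \<odot> tr (finprod A y {..<n}))"
      using c(1) t by (simp add: tr_smult tr_closed add_pow_smult)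
    also have "\<dots> = tr (finprod A y {..<n})"
      using c t tr_closed[OF t] by (simp flip: smult_assoc1)
    finally show ?thesis .
  qed
qed

theorem beta_invariants_le:
  assumes "beta A \<A> \<le> 1"
    and notin: "\<And>n p. \<lbrakk>n > N; p \<in> char_set k\<rbrakk> \<Longrightarrow> \<not> indecomposable G n p"
  shows "beta_invariants G A \<A> \<phi> \<le> enat N"
proof -
  \<comment> \<open>A p in \<open>char_set k\<close> dividing the order of G would make degree
    \<open>Suc N\<close> indecomposable, beyond the assumed bound. So the order is invertible in
    \<open>k\<close>.\<close>
  have "\<not> int p dvd int (card (carrier G))" if p: "p \<in> char_set k" for p
  proof
    assume "int p dvd int (card (carrier G))"
    moreover have "p \<noteq> 1" using K.char_set_prime_or_zero[OF p] by auto
    ultimately have "indecomposable G (Suc N) p"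
      using indecomposable_if_dvd_order[OF G.is_group, of "Suc N" p] by simp
    then show False using notin[OF _ p, of "Suc N"] by simp
  qed
  then have "add_pow k (int (card (carrier G))) \<one>\<^bsub>k\<^esub> \<in> Units k" by (rule K.char_set_units)
  then obtain c where c: "c \<in> carrier k" "add_pow k (int (card (carrier G))) \<one>\<^bsub>k\<^esub> \<otimes>\<^bsub>k\<^esub> c = \<one>\<^bsub>k\<^esub>"
    by (metis K.Units_inv_closed K.Units_r_inv)
  note SE = subringE[OF invariants_le_subring[of N]]
  have tr_mem: "tr x \<in> invariants_le N" if "x \<in> carrier A" for x
  proof -
    have gen: "tr h \<in> invariants_le N" if h: "h \<in> generators" for h
    proof -
      consider "h = \<one>" | "h \<in> \<A> 0" | "h \<in> monomials" using h by (auto simp: generators_def)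
      then show ?thesis
      proof cases
        case 1
        have "\<one> \<in> F" using subringE(3)[OF fixed_subring] .
        then have "tr h = add_pow A (int (card (carrier G))) \<one>"
          using 1 by (simp add: tr_of_fixed add_pow_int_ge)
        then show ?thesis using subring_add_pow[OF invariants_le_subring SE(3)] by simp
      next
        case 2
        then show ?thesis using tr_degree tr_fixed comp_subset invariants_le_component by blast
      next
        case 3
        then obtain n :: nat and y where ny: "n > 0" "y \<in> {..<n} \<rightarrow> \<A> 1" "h = finprod A y {..<n}"
          unfolding monomials_def by blast
        then show ?thesis using tr_product_mem[OF notin] by blast
      qed
    qed
    have "x \<in> hspan" using that span_eq_carrier[OF assms(1)] by simp
    then show ?thesis
    proof (induction x rule: generate.induct)
      case (inv h)
      then show ?case using gen[OF inv] SE(5) generators_carrier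
        by (auto simp: tr_minus simp flip: a_inv_def)
    next
      case (eng h1 h2)
      then show ?case using SE(7) span_carrier by (simp add: tr_add)
    qed (auto simp: tr_zero SE(2) gen)
  qed
  \<comment> \<open>With \<open>c\<close> inverse to the order of G in \<open>k\<close>, an
    invariant x is the trace of \<open>c \<odot> x\<close>.\<close>
  have "x \<in> invariants_le N" if x: "x \<in> F" for x
  proof -
    have xc: "x \<in> carrier A" using x by (rule fixed_carrier)
    have "tr (c \<odot> x) = c \<odot> add_pow A (int (card (carrier G))) x"
      using c(1) xc x by (simp add: tr_smult tr_of_fixed add_pow_int_ge)
    also have "\<dots> = (add_pow k (int (card (carrier G))) \<one>\<^bsub>k\<^esub> \<otimes>\<^bsub>k\<^esub> c) \<odot> x"
      using c(1) xc by (simp add: add_pow_smult K.m_comm flip: smult_assoc1)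
    also have "\<dots> = x" using xc by (simp add: c(2))
    finally show ?thesis using tr_mem[of "c \<odot> x"] c(1) xc by simp
  qed
  then have "generate_ring (A\<lparr>carrier := F\<rparr>)
      (component_le (A\<lparr>carrier := F\<rparr>) (\<lambda>d. \<A> d \<inter> F) N) = F"
    using invariants_le_fixed unfolding invariants_le_def by blast
  then show ?thesis unfolding beta_invariants_def beta_le_iff by auto
qed

end

section \<open>The multilinear algebra\<close>

lemma (in abelian_group) finsum_int_pow:
  assumes "x \<in> carrier G" "finite B"
  shows "(\<Oplus>b\<in>B. add_pow G (l b) x) = add_pow G (\<Sum>b\<in>B. l b :: int) x"
  using assms(2)
proof (induction B rule: finite_induct)
  case empty
  then show ?case by (simp add: add_pow_int_ge)
next
  case (insert b B)
  then show ?case using assms(1) by (simp add: add.int_pow_mult)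
qed

lemma (in abelian_monoid) finsum_swap:
  assumes "finite B" "finite C" "\<And>b c. \<lbrakk>b \<in> B; c \<in> C\<rbrakk> \<Longrightarrow> u b c \<in> carrier G"
  shows "(\<Oplus>b\<in>B. \<Oplus>c\<in>C. u b c) = (\<Oplus>c\<in>C. \<Oplus>b\<in>B. u b c)"
  using assms(1,3)
proof (induction B rule: finite_induct)
  case (insert b B)
  have "(\<Oplus>b\<in>insert b B. \<Oplus>c\<in>C. u b c) = (\<Oplus>c\<in>C. u b c) \<oplus> (\<Oplus>c\<in>C. \<Oplus>b\<in>B. u b c)"
    using insert by (subst finsum_insert) (auto intro!: finsum_closed)
  also have "\<dots> = (\<Oplus>c\<in>C. u b c \<oplus> (\<Oplus>b\<in>B. u b c))"
    using insert.prems by (intro finsum_addf[symmetric]) (auto intro!: finsum_closed)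
  also have "\<dots> = (\<Oplus>c\<in>C. \<Oplus>b\<in>insert b B. u b c)"
    using insert by (intro finsum_cong') (auto intro!: finsum_closed)
  finally show ?case .
qed simp

lemma shift_UNIV: "shift G g UNIV f i = map_option ((\<otimes>\<^bsub>G\<^esub>) g) (f i)"
  by (simp add: shift_def)

lemma shift_UNIV_restrict: "shift G g UNIV f |` T = shift G g UNIV (f |` T)"
  by (auto simp: shift_UNIV restrict_map_def)

lemma shift_restrict_same: "shift G g T f |` T = shift G g UNIV (f |` T)"
  by (auto simp: shift_def restrict_map_def)

lemma shift_restrict_disjoint: "S \<inter> T = {} \<Longrightarrow> shift G g T f |` S = f |` S"
  by (rule ext) (auto simp: shift_def restrict_map_def)

lemma (in group) shift_shift:
  assumes "ran f \<subseteq> carrier G" "g \<in> carrier G" "h \<in> carrier G"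
  shows "shift G g T (shift G h T f) = shift G (g \<otimes> h) T f"
proof
  fix i show "shift G g T (shift G h T f) i = shift G (g \<otimes> h) T f i"
    using assms by (cases "f i") (auto simp: shift_def m_assoc dest: ranI)
qed

lemma (in group) shift_one:
  assumes "ran f \<subseteq> carrier G"
  shows "shift G \<one> T f = f"
proof
  fix i show "shift G \<one> T f i = f i"
    using assms by (cases "f i") (auto simp: shift_def dest: ranI)
qed

definition partial_maps :: "('g, 'h) monoid_scheme \<Rightarrow> nat \<Rightarrow> (nat \<rightharpoonup> 'g) set" where
  "partial_maps G n = {f. dom f \<subseteq> {..<n} \<and> ran f \<subseteq> carrier G}"

text \<open>The multilinear quotient of the polynomial ring in variables \<open>x\<^bsub>i,g\<^esub>\<close> for \<open>i < n\<close> and \<open>g \<in> G\<close>: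
  monomials containing two variables with the same \<open>i\<close> are set to zero, so the
  remaining monomials are the partial maps \<open>i \<mapsto> g\<close>, and two of them multiply by disjoint union.\<close>

definition multilinear_algebra ::
  "('k, 'm) ring_scheme \<Rightarrow> ('g, 'h) monoid_scheme \<Rightarrow> nat \<Rightarrow> ('k, (nat \<rightharpoonup> 'g) \<Rightarrow> 'k) module" where
  "multilinear_algebra k G n =
    \<lparr>carrier = partial_maps G n \<rightarrow>\<^sub>E carrier k,
     monoid.mult = (\<lambda>a b. \<lambda>f\<in>partial_maps G n.
       \<Oplus>\<^bsub>k\<^esub>T\<in>Pow (dom f). a (f |` T) \<otimes>\<^bsub>k\<^esub> b (f |` (dom f - T))),
     monoid.one = (\<lambda>f\<in>partial_maps G n. if f = Map.empty then \<one>\<^bsub>k\<^esub> else \<zero>\<^bsub>k\<^esub>),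
     ring.zero = (\<lambda>f\<in>partial_maps G n. \<zero>\<^bsub>k\<^esub>),
     ring.add = (\<lambda>a b. \<lambda>f\<in>partial_maps G n. a f \<oplus>\<^bsub>k\<^esub> b f),
     module.smult = (\<lambda>c a. \<lambda>f\<in>partial_maps G n. c \<otimes>\<^bsub>k\<^esub> a f)\<rparr>"

definition multilinear_component ::
  "('k, 'm) ring_scheme \<Rightarrow> ('g, 'h) monoid_scheme \<Rightarrow> nat \<Rightarrow> nat \<Rightarrow> ((nat \<rightharpoonup> 'g) \<Rightarrow> 'k) set" where
  "multilinear_component k G n d =
    {a \<in> partial_maps G n \<rightarrow>\<^sub>E carrier k. \<forall>f\<in>partial_maps G n. card (dom f) \<noteq> d \<longrightarrow> a f = \<zero>\<^bsub>k\<^esub>}"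

text \<open>The inverse turns translation of arguments into a left action on functions. The outer
  restriction makes each map undefined off the carrier, as membership in \<open>BijGroup\<close>
  demands.\<close>

definition multilinear_action ::
  "('k, 'm) ring_scheme \<Rightarrow> ('g, 'h) monoid_scheme \<Rightarrow> nat \<Rightarrow> 'g \<Rightarrow>
    ((nat \<rightharpoonup> 'g) \<Rightarrow> 'k) \<Rightarrow> ((nat \<rightharpoonup> 'g) \<Rightarrow> 'k)" where
  "multilinear_action k G n g = (\<lambda>a\<in>partial_maps G n \<rightarrow>\<^sub>E carrier k. \<lambda>f\<in>partial_maps G n.
     a (shift G (inv\<^bsub>G\<^esub> g) UNIV f))"

section \<open>Ring and grading of the multilinear algebra\<close>

locale multilinear = cring k + G: group G
  for k :: "('k, 'm) ring_scheme" (structure) and G :: "('g, 'h) monoid_scheme" +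
  fixes n :: nat
  assumes finite_G: "finite (carrier G)"
begin

abbreviation "maps \<equiv> partial_maps G n"
abbreviation "M \<equiv> multilinear_algebra k G n"
abbreviation "homog \<equiv> multilinear_component k G n"
abbreviation "act \<equiv> multilinear_action k G n"

lemma M_simps:
  "carrier M = maps \<rightarrow>\<^sub>E carrier k"
  "\<one>\<^bsub>M\<^esub> = (\<lambda>f\<in>maps. if f = Map.empty then \<one> else \<zero>)"
  "\<zero>\<^bsub>M\<^esub> = (\<lambda>f\<in>maps. \<zero>)"
  "a \<oplus>\<^bsub>M\<^esub> b = (\<lambda>f\<in>maps. a f \<oplus> b f)"
  "c \<odot>\<^bsub>M\<^esub> a = (\<lambda>f\<in>maps. c \<otimes> a f)"
  "a \<otimes>\<^bsub>M\<^esub> b = (\<lambda>f\<in>maps. \<Oplus>T\<in>Pow (dom f). a (f |` T) \<otimes> b (f |` (dom f - T)))"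
  by (simp_all add: multilinear_algebra_def)

lemma finite_maps: "finite maps"
  unfolding partial_maps_def by (rule finite_maps_within) (use finite_G in auto)

lemma maps_finite_dom: "f \<in> maps \<Longrightarrow> finite (dom f)"
  by (auto simp: partial_maps_def intro: finite_subset)

lemma maps_restrict: "f \<in> maps \<Longrightarrow> f |` T \<in> maps"
proof -
  have "ran (f |` T) \<subseteq> ran f" by (auto simp: ran_def restrict_map_def split: if_splits)
  then show "f \<in> maps \<Longrightarrow> f |` T \<in> maps" by (auto simp: partial_maps_def)
qed

lemma maps_shift: "f \<in> maps \<Longrightarrow> g \<in> carrier G \<Longrightarrow> shift G g T f \<in> maps"
  using G.ran_shift[of f g T] by (simp add: partial_maps_def)

lemma M_app: "a \<in> carrier M \<Longrightarrow> f \<in> maps \<Longrightarrow> a f \<in> carrier k"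
  by (auto simp: M_simps)

lemma M_ext: "\<lbrakk>a \<in> carrier M; b \<in> carrier M; \<And>f. f \<in> maps \<Longrightarrow> a f = b f\<rbrakk> \<Longrightarrow> a = b"
  unfolding M_simps by (rule PiE_ext)

lemma M_lambda: "(\<And>f. f \<in> maps \<Longrightarrow> u f \<in> carrier k) \<Longrightarrow> (\<lambda>f\<in>maps. u f) \<in> carrier M"
  unfolding M_simps by auto

lemma add_app: "f \<in> maps \<Longrightarrow> (a \<oplus>\<^bsub>M\<^esub> b) f = a f \<oplus> b f"
  by (simp add: M_simps)

lemma smult_app: "f \<in> maps \<Longrightarrow> (c \<odot>\<^bsub>M\<^esub> a) f = c \<otimes> a f"
  by (simp add: M_simps)

lemma mult_app: "f \<in> maps \<Longrightarrow>
    (a \<otimes>\<^bsub>M\<^esub> b) f = (\<Oplus>T\<in>Pow (dom f). a (f |` T) \<otimes> b (f |` (dom f - T)))"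
  by (simp add: M_simps)

lemma zero_app: "f \<in> maps \<Longrightarrow> \<zero>\<^bsub>M\<^esub> f = \<zero>"
  by (simp add: M_simps)

lemma one_app: "f \<in> maps \<Longrightarrow> \<one>\<^bsub>M\<^esub> f = (if f = Map.empty then \<one> else \<zero>)"
  by (simp add: M_simps)

lemma add_closed: "a \<in> carrier M \<Longrightarrow> b \<in> carrier M \<Longrightarrow> a \<oplus>\<^bsub>M\<^esub> b \<in> carrier M"
  unfolding M_simps(4) by (rule M_lambda) (auto intro: M_app)

lemma smult_closed: "c \<in> carrier k \<Longrightarrow> a \<in> carrier M \<Longrightarrow> c \<odot>\<^bsub>M\<^esub> a \<in> carrier M"
  unfolding M_simps(5) by (rule M_lambda) (auto intro: M_app)

lemma mult_closed: "a \<in> carrier M \<Longrightarrow> b \<in> carrier M \<Longrightarrow> a \<otimes>\<^bsub>M\<^esub> b \<in> carrier M"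
  unfolding M_simps(6) by (rule M_lambda) (auto simp: M_app maps_restrict intro!: finsum_closed)

lemma zero_closed': "\<zero>\<^bsub>M\<^esub> \<in> carrier M"
  unfolding M_simps(3) by (rule M_lambda) simp

lemma one_closed': "\<one>\<^bsub>M\<^esub> \<in> carrier M"
  unfolding M_simps(2) by (rule M_lambda) simp

lemma abelian_group_M: "abelian_group M"
proof (rule abelian_groupI)
  fix a assume a: "a \<in> carrier M"
  have "(\<lambda>f\<in>maps. \<ominus> a f) \<in> carrier M" by (rule M_lambda) (simp add: M_app[OF a])
  moreover have "(\<lambda>f\<in>maps. \<ominus> a f) \<oplus>\<^bsub>M\<^esub> a = \<zero>\<^bsub>M\<^esub>"
    by (rule M_ext) (auto simp: add_app zero_app l_neg M_app a calculation add_closed zero_closed')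
  ultimately show "\<exists>b\<in>carrier M. b \<oplus>\<^bsub>M\<^esub> a = \<zero>\<^bsub>M\<^esub>" by blast
qed (rule M_ext | simp add: add_closed zero_closed' add_app zero_app M_app a_ac)+

lemma mult_comm:
  assumes "a \<in> carrier M" "b \<in> carrier M"
  shows "a \<otimes>\<^bsub>M\<^esub> b = b \<otimes>\<^bsub>M\<^esub> a"
proof (rule M_ext)
  fix f assume f: "f \<in> maps"
  define D where "D = dom f"
  have bij: "(\<lambda>T. D - T) ` Pow D = Pow D"
  proof -
    have "T \<in> (\<lambda>T. D - T) ` Pow D" if "T \<subseteq> D" for T
      using that by (intro image_eqI[of _ _ "D - T"]) auto
    then show ?thesis by auto
  qed
  have inj: "inj_on (\<lambda>T. D - T) (Pow D)" by (rule inj_onI) auto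
  have "(a \<otimes>\<^bsub>M\<^esub> b) f = (\<Oplus>T\<in>(\<lambda>T. D - T) ` Pow D. a (f |` T) \<otimes> b (f |` (D - T)))"
    using f by (simp add: mult_app bij D_def[symmetric])
  also have "\<dots> = (\<Oplus>T\<in>Pow D. a (f |` (D - T)) \<otimes> b (f |` (D - (D - T))))"
    using inj f assms by (intro finsum_reindex) (auto simp: M_app maps_restrict)
  also have "\<dots> = (\<Oplus>T\<in>Pow D. b (f |` T) \<otimes> a (f |` (D - T)))"
    using f assms
    by (intro finsum_cong') (auto simp: double_diff m_comm M_app maps_restrict)
  finally show "(a \<otimes>\<^bsub>M\<^esub> b) f = (b \<otimes>\<^bsub>M\<^esub> a) f" using f by (simp add: mult_app D_def)
qed (use assms mult_closed in auto)

text \<open>Both bracketings sum over ordered partitions of \<open>dom f\<close> into three blocks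
  U, T - U, D - T. Inner sums are padded with zeros to run over all of \<open>Pow D\<close>, so that
  the order of summation can be exchanged.\<close>

lemma mult_assoc:
  assumes a: "a \<in> carrier M" and b: "b \<in> carrier M" and c: "c \<in> carrier M"
  shows "(a \<otimes>\<^bsub>M\<^esub> b) \<otimes>\<^bsub>M\<^esub> c = a \<otimes>\<^bsub>M\<^esub> (b \<otimes>\<^bsub>M\<^esub> c)"
proof (rule M_ext)
  fix f assume f: "f \<in> maps"
  define D where "D = dom f"
  have finD: "finite (Pow D)" using maps_finite_dom[OF f] by (simp add: D_def)
  define t where "t U T = a (f |` U) \<otimes> b (f |` (T - U)) \<otimes> c (f |` (D - T))" for U T
  note ac = M_app[OF a maps_restrict[OF f]] and bc = M_app[OF b maps_restrict[OF f]]
    and cc = M_app[OF c maps_restrict[OF f]]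
  have tc: "t U T \<in> carrier k" for U T using ac bc cc by (simp add: t_def)
  have domr: "dom (f |` T) = T" if "T \<subseteq> D" for T using that by (auto simp: D_def)
  have "((a \<otimes>\<^bsub>M\<^esub> b) \<otimes>\<^bsub>M\<^esub> c) f = (\<Oplus>T\<in>Pow D. (a \<otimes>\<^bsub>M\<^esub> b) (f |` T) \<otimes> c (f |` (D - T)))"
    using f by (simp add: mult_app D_def)
  also have "\<dots> = (\<Oplus>T\<in>Pow D. \<Oplus>U\<in>Pow D. if U \<subseteq> T then t U T else \<zero>)"
  proof (intro finsum_cong')
    fix T assume "T \<in> Pow D"
    then have T: "T \<subseteq> D" "finite (Pow T)" using finD finite_subset by auto
    have "(a \<otimes>\<^bsub>M\<^esub> b) (f |` T) = (\<Oplus>U\<in>Pow T. a (f |` U) \<otimes> b (f |` (T - U)))"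
      unfolding mult_app[OF maps_restrict[OF f]] domr[OF T(1)]
      using ac bc by (intro finsum_cong') (auto simp: inf.absorb2)
    then have "(a \<otimes>\<^bsub>M\<^esub> b) (f |` T) \<otimes> c (f |` (D - T)) = (\<Oplus>U\<in>Pow T. t U T)"
      unfolding t_def using ac bc cc T(2) by (simp add: finsum_ldistr)
    also have "\<dots> = (\<Oplus>U\<in>Pow D. if U \<subseteq> T then t U T else \<zero>)"
      using T tc finD by (intro add.finprod_mono_neutral_cong_left) auto
    finally show "(a \<otimes>\<^bsub>M\<^esub> b) (f |` T) \<otimes> c (f |` (D - T)) =
      (\<Oplus>U\<in>Pow D. if U \<subseteq> T then t U T else \<zero>)" .
  qed (auto intro!: finsum_closed tc)
  also have "\<dots> = (\<Oplus>U\<in>Pow D. \<Oplus>T\<in>Pow D. if U \<subseteq> T then t U T else \<zero>)"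
    using finD tc by (intro finsum_swap) auto
  also have "\<dots> = (\<Oplus>U\<in>Pow D. a (f |` U) \<otimes> (b \<otimes>\<^bsub>M\<^esub> c) (f |` (D - U)))"
  proof (intro finsum_cong')
    fix U assume "U \<in> Pow D"
    then have U: "U \<subseteq> D" "D - U \<subseteq> D" "finite (Pow (D - U))" using finD finite_subset[of "D - U" D] by auto
    \<comment> \<open>For fixed \<open>U\<close> the sets \<open>T\<close> above it are parametrised
      by the middle block V = T - U, which is the summation variable of the other
      bracketing.\<close>
    have img: "(\<lambda>V. U \<union> V) ` Pow (D - U) = {T \<in> Pow D. U \<subseteq> T}"
    proof -
      have "T \<in> (\<lambda>V. U \<union> V) ` Pow (D - U)" if "T \<subseteq> D" "U \<subseteq> T" for T
        using that by (intro image_eqI[of _ _ "T - U"]) auto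
      then show ?thesis using U by auto
    qed
    have inj: "inj_on (\<lambda>V. U \<union> V) (Pow (D - U))" by (rule inj_onI) auto
    have "(\<Oplus>T\<in>Pow D. if U \<subseteq> T then t U T else \<zero>) = (\<Oplus>T\<in>{T \<in> Pow D. U \<subseteq> T}. t U T)"
      using tc finD by (intro add.finprod_mono_neutral_cong_right) auto
    also have "\<dots> = (\<Oplus>V\<in>Pow (D - U). t U (U \<union> V))"
      unfolding img[symmetric] using inj tc by (intro finsum_reindex) auto
    also have "\<dots> = (\<Oplus>V\<in>Pow (D - U). a (f |` U) \<otimes> (b (f |` V) \<otimes> c (f |` (D - U - V))))"
    proof (intro finsum_cong')
      fix V assume "V \<in> Pow (D - U)"
      then have "U \<union> V - U = V" "D - (U \<union> V) = D - U - V" by auto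
      then show "t U (U \<union> V) = a (f |` U) \<otimes> (b (f |` V) \<otimes> c (f |` (D - U - V)))"
        using ac bc cc by (simp add: t_def m_assoc)
    qed (use ac bc cc in auto)
    also have "\<dots> = a (f |` U) \<otimes> (\<Oplus>V\<in>Pow (D - U). b (f |` V) \<otimes> c (f |` (D - U - V)))"
      using ac bc cc U(3) by (intro finsum_rdistr[symmetric]) auto
    also have "(\<Oplus>V\<in>Pow (D - U). b (f |` V) \<otimes> c (f |` (D - U - V))) = (b \<otimes>\<^bsub>M\<^esub> c) (f |` (D - U))"
      unfolding mult_app[OF maps_restrict[OF f]] domr[OF U(2)]
      using bc cc by (intro finsum_cong') (auto simp: inf.absorb2)
    finally show "(\<Oplus>T\<in>Pow D. if U \<subseteq> T then t U T else \<zero>) =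
      a (f |` U) \<otimes> (b \<otimes>\<^bsub>M\<^esub> c) (f |` (D - U))" .
  qed (auto intro!: ac M_app[OF mult_closed[OF b c]] maps_restrict[OF f])
  also have "\<dots> = (a \<otimes>\<^bsub>M\<^esub> (b \<otimes>\<^bsub>M\<^esub> c)) f"
    using f by (simp add: mult_app D_def)
  finally show "((a \<otimes>\<^bsub>M\<^esub> b) \<otimes>\<^bsub>M\<^esub> c) f = (a \<otimes>\<^bsub>M\<^esub> (b \<otimes>\<^bsub>M\<^esub> c)) f" .
qed (use assms mult_closed in auto)

lemma restrict_empty_iff: "T \<subseteq> dom f \<Longrightarrow> f |` T = Map.empty \<longleftrightarrow> T = {}"
  by (metis Int_absorb1 dom_empty dom_restrict inf.commute restrict_map_to_empty)

lemma restrict_map_dom: "f |` dom f = f"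
  by (rule ext) (simp add: restrict_map_def domIff)

lemma one_mult:
  assumes "a \<in> carrier M"
  shows "\<one>\<^bsub>M\<^esub> \<otimes>\<^bsub>M\<^esub> a = a"
proof (rule M_ext)
  fix f assume f: "f \<in> maps"
  have "(\<one>\<^bsub>M\<^esub> \<otimes>\<^bsub>M\<^esub> a) f = (\<Oplus>T\<in>Pow (dom f). if {} = T then a f else \<zero>)"
    unfolding mult_app[OF f] using f assms
    by (intro finsum_cong')
      (auto simp: one_app maps_restrict restrict_empty_iff M_app restrict_map_dom)
  also have "\<dots> = a f"
    using maps_finite_dom[OF f] M_app[OF assms f] by (intro finsum_singleton) auto
  finally show "(\<one>\<^bsub>M\<^esub> \<otimes>\<^bsub>M\<^esub> a) f = a f" .
qed (use assms mult_closed one_closed' in auto)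

lemma mult_distr:
  assumes "a \<in> carrier M" "b \<in> carrier M" "c \<in> carrier M"
  shows "(a \<oplus>\<^bsub>M\<^esub> b) \<otimes>\<^bsub>M\<^esub> c = a \<otimes>\<^bsub>M\<^esub> c \<oplus>\<^bsub>M\<^esub> b \<otimes>\<^bsub>M\<^esub> c"
proof (rule M_ext)
  fix f assume f: "f \<in> maps"
  note cl = M_app[OF assms(1) maps_restrict[OF f]] M_app[OF assms(2) maps_restrict[OF f]]
    M_app[OF assms(3) maps_restrict[OF f]]
  have "((a \<oplus>\<^bsub>M\<^esub> b) \<otimes>\<^bsub>M\<^esub> c) f = (\<Oplus>T\<in>Pow (dom f).
      a (f |` T) \<otimes> c (f |` (dom f - T)) \<oplus> b (f |` T) \<otimes> c (f |` (dom f - T)))"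
    unfolding mult_app[OF f] using cl
    by (intro finsum_cong') (auto simp: add_app maps_restrict[OF f] l_distr)
  then show "((a \<oplus>\<^bsub>M\<^esub> b) \<otimes>\<^bsub>M\<^esub> c) f = (a \<otimes>\<^bsub>M\<^esub> c \<oplus>\<^bsub>M\<^esub> b \<otimes>\<^bsub>M\<^esub> c) f"
    using cl f by (simp add: add_app mult_app finsum_addf Pi_def)
qed (use assms mult_closed add_closed in auto)

lemma cring_M: "cring M"
proof (rule cringI[OF abelian_group_M])
  show "comm_monoid M"
    by (rule comm_monoidI) (rule mult_closed one_closed' mult_assoc one_mult mult_comm; assumption?)+
qed (rule mult_distr)

lemma algebra_M: "algebra k M"
proof (rule algebraI)
  fix c a b assume c: "c \<in> carrier k" and ab: "a \<in> carrier M" "b \<in> carrier M"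
  show "(c \<odot>\<^bsub>M\<^esub> a) \<otimes>\<^bsub>M\<^esub> b = c \<odot>\<^bsub>M\<^esub> (a \<otimes>\<^bsub>M\<^esub> b)"
  proof (rule M_ext)
    fix f assume f: "f \<in> maps"
    note cl = M_app[OF ab(1) maps_restrict[OF f]] M_app[OF ab(2) maps_restrict[OF f]]
    have "((c \<odot>\<^bsub>M\<^esub> a) \<otimes>\<^bsub>M\<^esub> b) f =
        (\<Oplus>T\<in>Pow (dom f). c \<otimes> (a (f |` T) \<otimes> b (f |` (dom f - T))))"
      unfolding mult_app[OF f] using cl c
      by (intro finsum_cong') (auto simp: smult_app maps_restrict[OF f] m_assoc)
    then show "((c \<odot>\<^bsub>M\<^esub> a) \<otimes>\<^bsub>M\<^esub> b) f = (c \<odot>\<^bsub>M\<^esub> (a \<otimes>\<^bsub>M\<^esub> b)) f"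
      using cl f c maps_finite_dom[OF f] by (simp add: smult_app mult_app finsum_rdistr Pi_def)
  qed (use c ab mult_closed smult_closed in auto)
qed (rule is_cring cring_M |
    (rule M_ext; simp add: smult_app add_app smult_closed add_closed M_app l_distr r_distr m_assoc) |
    simp add: smult_closed)+

sublocale M: cring M by (rule cring_M)

lemma homog_carrier: "a \<in> homog d \<Longrightarrow> a \<in> carrier M"
  by (simp add: multilinear_component_def M_simps)

lemma homog_app: "a \<in> homog d \<Longrightarrow> f \<in> maps \<Longrightarrow> card (dom f) \<noteq> d \<Longrightarrow> a f = \<zero>"
  by (simp add: multilinear_component_def)

lemma homogI: "\<lbrakk>a \<in> carrier M; \<And>f. f \<in> maps \<Longrightarrow> card (dom f) \<noteq> d \<Longrightarrow> a f = \<zero>\<rbrakk> \<Longrightarrow> a \<in> homog d"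
  by (simp add: multilinear_component_def M_simps)

lemma minus_app:
  assumes a: "a \<in> carrier M" and f: "f \<in> maps"
  shows "(\<ominus>\<^bsub>M\<^esub> a) f = \<ominus> a f"
proof -
  have "(\<ominus>\<^bsub>M\<^esub> a \<oplus>\<^bsub>M\<^esub> a) f = \<zero>" using f by (simp only: M.l_neg[OF a] zero_app)
  then have "(\<ominus>\<^bsub>M\<^esub> a) f \<oplus> a f = \<zero>" by (simp add: add_app f)
  then show ?thesis using M_app[OF a f] M_app[OF M.a_inv_closed[OF a] f] minus_equality by metis
qed

lemma finsum_app:
  assumes "u \<in> B \<rightarrow> carrier M" "f \<in> maps"
  shows "(finsum M u B) f = (\<Oplus>b\<in>B. u b f)"
  using assms(1)
proof (induction B rule: infinite_finite_induct)
  case (insert b B)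
  then have "u b \<in> carrier M" "u \<in> B \<rightarrow> carrier M" by auto
  then show ?case using insert assms(2) by (simp add: add_app M_app Pi_def)
qed (simp_all add: zero_app assms(2))

text \<open>At \<open>f\<close> a sum of homogeneous elements takes the value of its component of
  degree \<open>card (dom f)\<close>. This formula, \<open>sum\<close> below, gives existence and
  uniqueness of the decomposition together.\<close>

lemma graded_M: "graded_cring M homog"
proof (intro graded_cring.intro graded_cring_axioms.intro cring_M)
  fix d
  show "additive_subgroup (homog d) M"
  proof (intro additive_subgroup.intro M.add.subgroupI)
    show "homog d \<noteq> {}" using homogI[OF zero_closed'] by (auto simp: zero_app)
  qed (auto simp: homog_carrier homog_app add_app minus_app add_closed
      simp flip: a_inv_def intro!: homogI)
next
  fix a b d e assume ab: "a \<in> homog d" "b \<in> homog e"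
  show "a \<otimes>\<^bsub>M\<^esub> b \<in> homog (d + e)"
  proof (rule homogI)
    fix f assume f: "f \<in> maps" "card (dom f) \<noteq> d + e"
    have "a (f |` T) \<otimes> b (f |` (dom f - T)) = \<zero>" if T: "T \<in> Pow (dom f)" for T
    proof -
      have dom: "dom (f |` T) = T" "dom (f |` (dom f - T)) = dom f - T" using T by auto
      have "card T + card (dom f - T) = card (dom f)"
        using T maps_finite_dom[OF f(1)] by (metis PowD card_mono card_Diff_subset finite_subset le_add_diff_inverse)
      then have "card T \<noteq> d \<or> card (dom f - T) \<noteq> e" using f(2) by auto
      then show ?thesis
        using homog_app[OF ab(1) maps_restrict[OF f(1)], of T] homog_app[OF ab(2) maps_restrict[OF f(1)], of "dom f - T"]
          M_app[OF homog_carrier[OF ab(1)] maps_restrict[OF f(1)]]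
          M_app[OF homog_carrier[OF ab(2)] maps_restrict[OF f(1)]] dom
        by auto
    qed
    then show "(a \<otimes>\<^bsub>M\<^esub> b) f = \<zero>"
      unfolding mult_app[OF f(1)] by (rule add.finprod_one_eqI)
  qed (use ab homog_carrier mult_closed in blast)
next
  fix a assume a: "a \<in> carrier M"
  define u where "u d = (\<lambda>f\<in>maps. if card (dom f) = d then a f else \<zero>)" for d
  have uc: "u d \<in> carrier M" for d unfolding u_def by (rule M_lambda) (simp add: M_app a)
  have uh: "u d \<in> homog d" for d by (rule homogI[OF uc]) (simp add: u_def)
  have nz: "{d. v d \<noteq> \<zero>\<^bsub>M\<^esub>} \<subseteq> (\<lambda>f. card (dom f)) ` maps" if v: "\<And>d. v d \<in> homog d" for v
  proof
    fix d assume d: "d \<in> {d. v d \<noteq> \<zero>\<^bsub>M\<^esub>}"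
    show "d \<in> (\<lambda>f. card (dom f)) ` maps"
    proof (rule ccontr)
      assume "d \<notin> (\<lambda>f. card (dom f)) ` maps"
      then have "v d = \<zero>\<^bsub>M\<^esub>"
        by (intro M_ext[OF homog_carrier[OF v] zero_closed'])
          (metis homog_app[OF v] image_eqI zero_app)
      then show False using d by simp
    qed
  qed
  have fin: "finite {d. v d \<noteq> \<zero>\<^bsub>M\<^esub>}" if "\<And>d. v d \<in> homog d" for v
    by (rule finite_subset[OF nz[OF that]]) (simp add: finite_maps)
  have sum: "(\<Oplus>\<^bsub>M\<^esub>d\<in>{d. v d \<noteq> \<zero>\<^bsub>M\<^esub>}. v d) f = v (card (dom f)) f"
    if v: "\<And>d. v d \<in> homog d" and f: "f \<in> maps" for v f
  proof -
    have vc: "v d f \<in> carrier k" for d using M_app[OF homog_carrier[OF v] f] .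
    have "(\<Oplus>\<^bsub>M\<^esub>d\<in>{d. v d \<noteq> \<zero>\<^bsub>M\<^esub>}. v d) f = (\<Oplus>d\<in>{d. v d \<noteq> \<zero>\<^bsub>M\<^esub>}. v d f)"
      using homog_carrier[OF v] f by (intro finsum_app) auto
    \<comment> \<open>The degree of \<open>f\<close> is inserted because its component may be zero
      and so missing from the index set; in that case it contributes zero.\<close>
    also have "\<dots> = (\<Oplus>d\<in>insert (card (dom f)) {d. v d \<noteq> \<zero>\<^bsub>M\<^esub>}.
        if card (dom f) = d then v d f else \<zero>)"
      using fin[OF v] homog_app[OF v f] vc f
      by (intro add.finprod_mono_neutral_cong_left) (auto simp: zero_app)
    also have "\<dots> = v (card (dom f)) f"
      using fin[OF v] vc by (intro finsum_singleton) auto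
    finally show ?thesis .
  qed
  show "\<exists>!v. (\<forall>d. v d \<in> homog d) \<and> finite {d. v d \<noteq> \<zero>\<^bsub>M\<^esub>} \<and>
    a = (\<Oplus>\<^bsub>M\<^esub>d\<in>{d. v d \<noteq> \<zero>\<^bsub>M\<^esub>}. v d)"
  proof (rule ex1I[of _ u])
    have "a = (\<Oplus>\<^bsub>M\<^esub>d\<in>{d. u d \<noteq> \<zero>\<^bsub>M\<^esub>}. u d)"
    proof (rule M_ext[OF a])
      show "(\<Oplus>\<^bsub>M\<^esub>d\<in>{d. u d \<noteq> \<zero>\<^bsub>M\<^esub>}. u d) \<in> carrier M" using uc by (intro M.finsum_closed) auto
    qed (subst sum[OF uh], auto simp: u_def)
    then show "(\<forall>d. u d \<in> homog d) \<and> finite {d. u d \<noteq> \<zero>\<^bsub>M\<^esub>} \<and>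
      a = (\<Oplus>\<^bsub>M\<^esub>d\<in>{d. u d \<noteq> \<zero>\<^bsub>M\<^esub>}. u d)"
      using uh fin[OF uh] by blast
  next
    fix v assume v: "(\<forall>d. v d \<in> homog d) \<and> finite {d. v d \<noteq> \<zero>\<^bsub>M\<^esub>} \<and>
      a = (\<Oplus>\<^bsub>M\<^esub>d\<in>{d. v d \<noteq> \<zero>\<^bsub>M\<^esub>}. v d)"
    then have vh: "\<And>d. v d \<in> homog d" by blast
    have a_app: "a f = v (card (dom f)) f" if "f \<in> maps" for f
      using v sum[OF vh that] by simp
    show "v = u"
    proof
      fix d show "v d = u d"
        using a_app homog_app[OF vh] by (intro M_ext[OF homog_carrier[OF vh] uc]) (auto simp: u_def)
    qed
  qed
qed

section \<open>The group action on the multilinear algebra\<close>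

lemma act_app: "a \<in> carrier M \<Longrightarrow> f \<in> maps \<Longrightarrow> act g a f = a (shift G (inv\<^bsub>G\<^esub> g) UNIV f)"
  by (simp add: multilinear_action_def M_simps)

lemma act_closed: "a \<in> carrier M \<Longrightarrow> g \<in> carrier G \<Longrightarrow> act g a \<in> carrier M"
  by (auto simp: multilinear_action_def M_simps intro!: maps_shift)

lemma act_outside: "a \<notin> carrier M \<Longrightarrow> act g a = undefined"
  by (simp add: multilinear_action_def M_simps)

lemma act_act:
  assumes "a \<in> carrier M" "g \<in> carrier G" "h \<in> carrier G"
  shows "act g (act h a) = act (g \<otimes>\<^bsub>G\<^esub> h) a"
proof (rule M_ext)
  fix f assume f: "f \<in> maps"
  then have "ran f \<subseteq> carrier G" by (simp add: partial_maps_def)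
  then show "act g (act h a) f = act (g \<otimes>\<^bsub>G\<^esub> h) a f"
    using assms f by (simp add: act_app act_closed maps_shift G.shift_shift G.inv_mult_group)
qed (use assms act_closed in auto)

lemma act_one: "a \<in> carrier M \<Longrightarrow> act \<one>\<^bsub>G\<^esub> a = a"
  by (rule M_ext) (auto simp: act_closed act_app G.shift_one partial_maps_def)

lemma act_mult:
  assumes ab: "a \<in> carrier M" "b \<in> carrier M" and g: "g \<in> carrier G"
  shows "act g (a \<otimes>\<^bsub>M\<^esub> b) = act g a \<otimes>\<^bsub>M\<^esub> act g b"
proof (rule M_ext)
  fix f assume f: "f \<in> maps"
  have f': "shift G (inv\<^bsub>G\<^esub> g) UNIV f \<in> maps" using f g by (intro maps_shift) auto
  show "act g (a \<otimes>\<^bsub>M\<^esub> b) f = (act g a \<otimes>\<^bsub>M\<^esub> act g b) f"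
    unfolding mult_app[OF f] act_app[OF mult_closed[OF ab] f] mult_app[OF f'] dom_shift
    using ab f f' by (intro finsum_cong')
      (auto simp: act_app maps_restrict shift_UNIV_restrict M_app simp flip: shift_UNIV_restrict)
qed (use assms act_closed mult_closed in auto)

lemma shift_UNIV_empty_iff: "shift G g UNIV f = Map.empty \<longleftrightarrow> f = Map.empty"
  using dom_shift[of G g UNIV f] by (metis dom_eq_empty_conv)

lemma action_M: "graded_algebra_action k G M homog act"
proof (intro graded_algebra_action.intro graded_algebra.intro algebra_M graded_M
    graded_algebra_axioms.intro graded_algebra_action_axioms.intro)
  show "c \<odot>\<^bsub>M\<^esub> a \<in> homog d" if "c \<in> carrier k" "a \<in> homog d" for c a d
    using that by (intro homogI) (auto simp: smult_app smult_closed homog_carrier homog_app)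
  show "group_action G (carrier M) act"
  proof (intro group_action.intro group_hom.intro group_hom_axioms.intro G.is_group group_BijGroup)
    have bij: "act g \<in> Bij (carrier M)" if g: "g \<in> carrier G" for g
    proof -
      have "bij_betw (act g) (carrier M) (carrier M)"
        using g act_act by (intro bij_betw_byWitness[where f' = "act (inv\<^bsub>G\<^esub> g)"])
          (auto simp: act_closed act_one)
      moreover have "act g \<in> extensional (carrier M)"
        by (simp add: multilinear_action_def M_simps)
      ultimately show ?thesis by (simp add: Bij_def)
    qed
    show "act \<in> hom G (BijGroup (carrier M))"
    proof (rule homI)
      fix g h assume gh: "g \<in> carrier G" "h \<in> carrier G"
      have "act (g \<otimes>\<^bsub>G\<^esub> h) = compose (carrier M) (act g) (act h)"
      proof
        fix a show "act (g \<otimes>\<^bsub>G\<^esub> h) a = compose (carrier M) (act g) (act h) a"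
          using gh act_act[of a g h] act_outside
          by (cases "a \<in> carrier M") (simp_all add: compose_def)
      qed
      then show "act (g \<otimes>\<^bsub>G\<^esub> h) = act g \<otimes>\<^bsub>BijGroup (carrier M)\<^esub> act h"
        using bij gh by (simp add: BijGroup_def)
    qed (simp add: BijGroup_def bij)
  qed
  show "act g \<in> ring_hom M M" if g: "g \<in> carrier G" for g
  proof (rule ring_hom_memI)
    show "act g (a \<oplus>\<^bsub>M\<^esub> b) = act g a \<oplus>\<^bsub>M\<^esub> act g b" if "a \<in> carrier M" "b \<in> carrier M" for a b
      using that g by (intro M_ext) (auto simp: act_closed add_closed add_app act_app maps_shift)
    show "act g \<one>\<^bsub>M\<^esub> = \<one>\<^bsub>M\<^esub>"
      using g by (intro M_ext)
        (auto simp: act_closed one_closed' one_app act_app maps_shift shift_UNIV_empty_iff)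
  qed (use g act_closed act_mult in auto)
  show "act g (c \<odot>\<^bsub>M\<^esub> a) = c \<odot>\<^bsub>M\<^esub> act g a"
    if "g \<in> carrier G" "c \<in> carrier k" "a \<in> carrier M" for g c a
    using that by (intro M_ext) (auto simp: act_closed smult_closed smult_app act_app maps_shift)
  show "act g a \<in> homog d" if "g \<in> carrier G" "a \<in> homog d" for g a d
    using that by (intro homogI) (auto simp: act_closed act_app homog_carrier homog_app maps_shift)
qed

section \<open>Monomials and generation in degree one\<close>

definition delta :: "(nat \<rightharpoonup> 'g) \<Rightarrow> 'k \<Rightarrow> (nat \<rightharpoonup> 'g) \<Rightarrow> 'k" where
  "delta f c = (\<lambda>h\<in>maps. if h = f then c else \<zero>)"

lemma delta_closed: "c \<in> carrier k \<Longrightarrow> delta f c \<in> carrier M"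
  unfolding delta_def by (rule M_lambda) simp

lemma delta_mult:
  assumes "f \<in> maps" "f' \<in> maps" "f ++ f' \<in> maps" "dom f \<inter> dom f' = {}"
    "c \<in> carrier k" "c' \<in> carrier k"
  shows "delta f c \<otimes>\<^bsub>M\<^esub> delta f' c' = delta (f ++ f') (c \<otimes> c')"
proof (rule M_ext)
  fix h assume h: "h \<in> maps"
  have add_eq: "(f ++ f') i = (if i \<in> dom f then f i else f' i)" for i
    using assms(4) by (cases "f i"; cases "f' i") (auto simp: map_add_def)
  have disj: "f' i = None" if "i \<in> dom f" for i using assms(4) that by blast
  \<comment> \<open>In the convolution at \<open>h\<close> only the splitting along
    \<open>T = dom f\<close> can contribute, and only if \<open>h\<close> is the disjoint union of
    the two maps.\<close>
  have iff: "h |` T = f \<and> h |` (dom h - T) = f' \<longleftrightarrow> dom f = T \<and> h = f ++ f'" if T: "T \<subseteq> dom h" for T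
  proof
    assume *: "h |` T = f \<and> h |` (dom h - T) = f'"
    have "dom (h |` T) = T" using T by (simp add: inf.absorb2)
    then have "dom f = T" using * by simp
    moreover have "h = f ++ f'"
    proof
      fix i
      have e: "(h |` T) i = f i" "(h |` (dom h - T)) i = f' i" using * by simp_all
      show "h i = (f ++ f') i"
      proof (cases "i \<in> T")
        case True
        then show ?thesis using e(1) add_eq[of i] \<open>dom f = T\<close> by simp
      next
        case False
        then have "h i = f' i" using e(2) by (cases "h i") (auto simp: restrict_map_def domIff)
        then show ?thesis using False add_eq[of i] \<open>dom f = T\<close> by simp
      qed
    qed
    ultimately show "dom f = T \<and> h = f ++ f'" by blast
  next
    assume *: "dom f = T \<and> h = f ++ f'"
    then have domf: "dom f = T" and hadd: "h = f ++ f'" by blast+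
    have h_eq: "h i = (if i \<in> T then f i else f' i)" for i
      using add_eq[of i] unfolding hadd domf .
    have T_iff: "i \<in> T \<longleftrightarrow> f i \<noteq> None" for i unfolding domf[symmetric] by (simp add: domIff)
    have "h |` T = f"
    proof
      fix i show "(h |` T) i = f i"
        using h_eq[of i] T_iff[of i] by (simp add: restrict_map_def)
    qed
    moreover have "h |` (dom h - T) = f'"
    proof
      fix i show "(h |` (dom h - T)) i = f' i"
        using h_eq[of i] disj[of i] by (simp add: restrict_map_def domIff[of i h] domf)
    qed
    ultimately show "h |` T = f \<and> h |` (dom h - T) = f'" by blast
  qed
  have "(delta f c \<otimes>\<^bsub>M\<^esub> delta f' c') h =
      (\<Oplus>T\<in>Pow (dom h). if dom f = T then (if h = f ++ f' then c \<otimes> c' else \<zero>) else \<zero>)"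
    unfolding mult_app[OF h]
  proof (intro finsum_cong')
    fix T assume "T \<in> Pow (dom h)"
    then have "T \<subseteq> dom h" by simp
    have "delta f c (h |` T) \<otimes> delta f' c' (h |` (dom h - T)) =
      (if h |` T = f \<and> h |` (dom h - T) = f' then c \<otimes> c' else \<zero>)"
      using h assms(5,6) by (simp add: delta_def maps_restrict)
    then show "delta f c (h |` T) \<otimes> delta f' c' (h |` (dom h - T)) =
      (if dom f = T then (if h = f ++ f' then c \<otimes> c' else \<zero>) else \<zero>)"
      unfolding iff[OF \<open>T \<subseteq> dom h\<close>] by simp
  qed (use assms in auto)
  also have "\<dots> = (if h = f ++ f' then c \<otimes> c' else \<zero>)"
  proof (cases "h = f ++ f'")
    case True
    then have "dom f \<in> Pow (dom h)" by auto
    then show ?thesis using assms maps_finite_dom[OF h] by (intro finsum_singleton) auto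
  next
    case False
    then show ?thesis by simp
  qed
  finally show "(delta f c \<otimes>\<^bsub>M\<^esub> delta f' c') h = delta (f ++ f') (c \<otimes> c') h"
    using h by (simp add: delta_def)
qed (use assms delta_closed mult_closed in auto)

lemma delta_homog: "c \<in> carrier k \<Longrightarrow> delta f c \<in> homog (card (dom f))"
  by (rule homogI[OF delta_closed]) (auto simp: delta_def)

text \<open>Every element is a finite sum of monomials with coefficients, and a monomial is built up
  by splitting off one index at a time. Monomials with at most one index have degree at most
  1.\<close>

lemma beta_M: "beta M homog \<le> 1"
proof -
  define gen where "gen = generate_ring M (component_le M homog 1)"
  have sub: "component_le M homog 1 \<subseteq> carrier M"
  proof
    fix x assume "x \<in> component_le M homog 1"
    then obtain u where u: "x = (\<Oplus>\<^bsub>M\<^esub>d\<in>{..1}. u d)" "\<forall>d\<in>{..1}. u d \<in> homog d"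
      unfolding component_le_def by blast
    show "x \<in> carrier M"
      unfolding u(1) by (rule M.finsum_closed) (use u(2) homog_carrier in blast)
  qed
  have S: "subring gen M" unfolding gen_def using M.generate_ring_is_subring[OF sub] .
  have low: "delta f c \<in> gen" if "c \<in> carrier k" "card (dom f) \<le> 1" for f c
    unfolding gen_def
  proof (rule generate_ring.incl, rule component_leI[where d = "card (dom f)"])
    show "\<zero>\<^bsub>M\<^esub> \<in> homog e" for e using homogI[OF zero_closed'] by (simp add: zero_app)
  qed (use that delta_closed delta_homog M.abelian_monoid_axioms in auto)
  have delta: "delta f c \<in> gen" if "f \<in> maps" "c \<in> carrier k" for f c
    using that
  proof (induction "card (dom f)" arbitrary: f c)
    case 0
    then show ?case using low by simp
  next
    case (Suc m)
    then have "dom f \<noteq> {}" by auto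
    then obtain i where i: "i \<in> dom f" by blast
    define f' where "f' = f |` (dom f - {i})"
    define e where "e = f |` {i}"
    have f': "f' \<in> maps" "e \<in> maps" using Suc.prems maps_restrict by (auto simp: f'_def e_def)
    have dom: "dom f' = dom f - {i}" "dom e = {i}" using i by (auto simp: f'_def e_def)
    have f: "f' ++ e = f"
    proof
      fix j show "(f' ++ e) j = f j"
        using i by (cases "j = i"; cases "f j") (auto simp: f'_def e_def map_add_def restrict_map_def)
    qed
    have "card (dom f') = m" using Suc(2) i dom maps_finite_dom[OF Suc.prems(1)] by simp
    then have "delta f' c \<in> gen" using Suc f' by blast
    moreover have "delta e \<one> \<in> gen" using low dom by simp
    moreover have "delta f c = delta f' c \<otimes>\<^bsub>M\<^esub> delta e \<one>"
      using delta_mult[of f' e c \<one>] f f' dom Suc.prems by simp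
    ultimately show ?case using subringE(6)[OF S] by simp
  qed
  have "a \<in> gen" if a: "a \<in> carrier M" for a
  proof -
    have "a = (\<Oplus>\<^bsub>M\<^esub>f\<in>maps. delta f (a f))"
    proof (rule M_ext[OF a])
      fix h assume h: "h \<in> maps"
      have "(\<Oplus>\<^bsub>M\<^esub>f\<in>maps. delta f (a f)) h = (\<Oplus>f\<in>maps. delta f (a f) h)"
        using h a by (intro finsum_app) (auto intro!: delta_closed M_app)
      also have "\<dots> = (\<Oplus>f\<in>maps. if h = f then a f else \<zero>)"
        using h a by (intro finsum_cong') (auto simp: delta_def M_app)
      also have "\<dots> = a h" using h a finite_maps by (intro finsum_singleton) (auto simp: M_app)
      finally show "a h = (\<Oplus>\<^bsub>M\<^esub>f\<in>maps. delta f (a f)) h" by simp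
    qed (use a in \<open>auto intro!: M.finsum_closed delta_closed M_app\<close>)
    also have "\<dots> \<in> gen"
      using a delta by (intro M.finsum_mem subringE[OF S]) (auto simp: M_app)
    finally show ?thesis .
  qed
  then have "gen = carrier M" using subringE(1)[OF S] by blast
  then have "beta M homog \<le> enat 1" unfolding beta_le_iff gen_def by blast
  then show ?thesis by (simp add: one_enat_def)
qed

sublocale FA: finite_graded_action k G M homog act
  by (intro finite_graded_action.intro finite_graded_action_axioms.intro
      is_cring cring_M G.is_group action_M finite_G)

lemma fixed_shift:
  assumes "a \<in> FA.F" "f \<in> maps" "g \<in> carrier G"
  shows "a (shift G g UNIV f) = a f"
proof -
  have "act (inv\<^bsub>G\<^esub> g) a = a" "a \<in> carrier M" using assms by (auto simp: fixed_points_def)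
  then have "a f = a (shift G (inv\<^bsub>G\<^esub> (inv\<^bsub>G\<^esub> g)) UNIV f)" using act_app[of a f "inv\<^bsub>G\<^esub> g"] assms by simp
  then show ?thesis using assms(3) by simp
qed

section \<open>The functional modulo p\<close>

abbreviation "from_int z \<equiv> add_pow k (z::int) \<one>"

text \<open>The ideal pk. Computing modulo it treats p = 0 and p prime alike and requires no residue
  field.\<close>

definition multiples :: "nat \<Rightarrow> 'k set" where
  "multiples p = {from_int (int p) \<otimes> c | c. c \<in> carrier k}"

lemma multiplesI: "c \<in> carrier k \<Longrightarrow> from_int (int p) \<otimes> c \<in> multiples p"
  by (auto simp: multiples_def)

lemma multiples_carrier: "multiples p \<subseteq> carrier k"
  by (auto simp: multiples_def)

lemma multiples_zero: "\<zero> \<in> multiples p"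
  using multiplesI[OF zero_closed] by simp

lemma multiples_add: "x \<in> multiples p \<Longrightarrow> y \<in> multiples p \<Longrightarrow> x \<oplus> y \<in> multiples p"
proof -
  assume "x \<in> multiples p" "y \<in> multiples p"
  then obtain c d where "c \<in> carrier k" "d \<in> carrier k"
    "x = from_int (int p) \<otimes> c" "y = from_int (int p) \<otimes> d" by (auto simp: multiples_def)
  then show ?thesis using multiplesI[of "c \<oplus> d" p] by (simp add: r_distr)
qed

lemma multiples_mult:
  assumes "x \<in> multiples p" "c \<in> carrier k"
  shows "c \<otimes> x \<in> multiples p"
proof -
  obtain d where d: "d \<in> carrier k" "x = from_int (int p) \<otimes> d"
    using assms(1) by (auto simp: multiples_def)
  then have "c \<otimes> x = from_int (int p) \<otimes> (c \<otimes> d)" using assms(2) by (simp add: m_ac)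
  then show ?thesis using multiplesI[of "c \<otimes> d"] d(1) assms(2) by simp
qed

lemma multiples_int:
  assumes "int p dvd z" "c \<in> carrier k"
  shows "from_int z \<otimes> c \<in> multiples p"
proof -
  obtain m where "z = int p * m" using assms(1) by blast
  then have "from_int z \<otimes> c = from_int (int p) \<otimes> (from_int m \<otimes> c)"
    using assms(2) by (simp add: int_unit_mult m_assoc)
  then show ?thesis using multiplesI assms(2) by simp
qed

lemma pointed_sub: "pointed_maps G n \<subseteq> maps"
  by (auto simp: pointed_maps_def partial_maps_def)

text \<open>Shifts along \<open>U\<close> act freely on the pointed maps. On each orbit the weight
  \<open>w\<close> is constant and can be factored out, leaving the orbit sum of \<open>l\<close>,
  which p divides.\<close>

lemma weighted_sum_multiple:
  assumes U: "U \<subseteq> {1..<n}" "U \<noteq> {}"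
    and l: "\<And>f. f \<in> pointed_maps G n \<Longrightarrow> int p dvd (\<Sum>g\<in>carrier G. l (shift G g U f))"
    and w: "\<And>f. f \<in> pointed_maps G n \<Longrightarrow> w f \<in> carrier k"
    and inv: "\<And>f g. \<lbrakk>f \<in> pointed_maps G n; g \<in> carrier G\<rbrakk> \<Longrightarrow> w (shift G g U f) = w f"
  shows "(\<Oplus>f\<in>pointed_maps G n. from_int (l f) \<otimes> w f) \<in> multiples p"
proof -
  define P where "P = pointed_maps G n"
  have finP: "finite P" unfolding P_def by (rule finite_pointed_maps[OF finite_G])
  obtain t where t: "t \<in> U" "t < n" using U by force
  \<comment> \<open>Representatives of the orbits: exactly one translate along \<open>U\<close> has
    the unit at the chosen index \<open>t\<close>.\<close>
  define Q where "Q = {f \<in> P. f t = Some \<one>\<^bsub>G\<^esub>}"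
  define orb where "orb f = (\<lambda>g. shift G g U f) ` carrier G" for f
  have z: "0 \<notin> U" using U(1) by auto
  have ran: "ran f \<subseteq> carrier G" if "f \<in> P" for f using that by (simp add: P_def pointed_maps_def)
  have orb_sub: "orb f \<subseteq> P" if "f \<in> Q" for f
    using that G.shift_pointed[OF _ _ z] by (auto simp: orb_def Q_def P_def)
  have un: "(\<Union>f\<in>Q. orb f) = P"
  proof
    show "(\<Union>f\<in>Q. orb f) \<subseteq> P" using orb_sub by blast
    show "P \<subseteq> (\<Union>f\<in>Q. orb f)"
    proof
      fix h assume h: "h \<in> P"
      then obtain x where x: "h t = Some x" "x \<in> carrier G"
        using pointed_mapsE[of h G n t] t(2) unfolding P_def by blast
      define f where "f = shift G (inv\<^bsub>G\<^esub> x) U h"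
      have "f \<in> P" unfolding f_def P_def using G.shift_pointed[OF _ _ z] h x by (simp add: P_def)
      moreover have "f t = Some \<one>\<^bsub>G\<^esub>" using t(1) x by (simp add: f_def shift_def)
      moreover have "h = shift G x U f"
        using x ran[OF h] by (simp add: f_def G.shift_shift G.shift_one)
      ultimately show "h \<in> (\<Union>f\<in>Q. orb f)" using x(2) by (auto simp: Q_def orb_def)
    qed
  qed
  have disj: "pairwise (\<lambda>f f'. disjnt (orb f) (orb f')) Q"
  proof (rule pairwiseI)
    fix f f' assume ff: "f \<in> Q" "f' \<in> Q" "f \<noteq> f'"
    have False if gh: "g \<in> carrier G" "h \<in> carrier G" "shift G g U f = shift G h U f'" for g h
    proof -
      have "shift G g U f t = shift G h U f' t" by (simp only: gh(3))
      then have "g = h" using ff t(1) gh by (simp add: Q_def shift_def)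
      then have "shift G (inv\<^bsub>G\<^esub> g) U (shift G g U f) = shift G (inv\<^bsub>G\<^esub> g) U (shift G g U f')"
        using gh(3) by simp
      moreover have "ran f \<subseteq> carrier G" "ran f' \<subseteq> carrier G" using ff ran by (auto simp: Q_def)
      ultimately show False using gh(1) ff(3) by (simp add: G.shift_shift G.shift_one)
    qed
    then show "disjnt (orb f) (orb f')" unfolding disjnt_def orb_def by blast
  qed
  have "(\<Oplus>f\<in>P. from_int (l f) \<otimes> w f) = (\<Oplus>f\<in>Q. \<Oplus>h\<in>orb f. from_int (l h) \<otimes> w h)"
    unfolding un[symmetric]
  proof (rule add.finprod_UN_disjoint[OF _ _ disj])
    show "finite Q" using finP by (simp add: Q_def)
    show "finite (orb f)" for f using finite_G by (simp add: orb_def)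
    show "from_int (l h) \<otimes> w h \<in> carrier k" if "f \<in> Q" "h \<in> orb f" for f h
      using that orb_sub w by (auto simp: P_def)
  qed
  also have "\<dots> \<in> multiples p"
  proof (rule finsum_mem[OF multiples_zero multiples_add multiples_carrier])
    show "(\<lambda>f. \<Oplus>h\<in>orb f. from_int (l h) \<otimes> w h) \<in> Q \<rightarrow> multiples p"
    proof
      fix f assume f: "f \<in> Q"
      then have fP: "f \<in> pointed_maps G n" by (simp add: Q_def P_def)
      have inj: "inj_on (\<lambda>g. shift G g U f) (carrier G)"
        by (rule G.inj_shift[where i = t and x = "\<one>\<^bsub>G\<^esub>"]) (use f t in \<open>auto simp: Q_def\<close>)
      have "(\<Oplus>h\<in>orb f. from_int (l h) \<otimes> w h) =
          (\<Oplus>g\<in>carrier G. from_int (l (shift G g U f)) \<otimes> w (shift G g U f))"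
        unfolding orb_def using inj orb_sub[OF f] w
        by (intro finsum_reindex) (auto simp: P_def orb_def)
      also have "\<dots> = (\<Oplus>g\<in>carrier G. add_pow k (l (shift G g U f)) (w f))"
        using w[OF fP] by (intro finsum_cong') (auto simp: inv[OF fP] add_pow_ldistr_int)
      also have "\<dots> = add_pow k (\<Sum>g\<in>carrier G. l (shift G g U f)) (w f)"
        using w[OF fP] finite_G by (rule finsum_int_pow)
      also have "\<dots> = from_int (\<Sum>g\<in>carrier G. l (shift G g U f)) \<otimes> w f"
        using w[OF fP] by (simp add: add_pow_ldistr_int)
      also have "\<dots> \<in> multiples p" using l[OF fP] w[OF fP] by (rule multiples_int)
      finally show "(\<Oplus>h\<in>orb f. from_int (l h) \<otimes> w h) \<in> multiples p" .
    qed
  qed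
  finally show ?thesis by (simp add: P_def)
qed

definition functional :: "((nat \<rightharpoonup> 'g) \<Rightarrow> int) \<Rightarrow> ((nat \<rightharpoonup> 'g) \<Rightarrow> 'k) \<Rightarrow> 'k" where
  "functional l a = (\<Oplus>f\<in>pointed_maps G n. from_int (l f) \<otimes> a f)"

lemma functional_closed: "a \<in> carrier M \<Longrightarrow> functional l a \<in> carrier k"
  unfolding functional_def using pointed_sub by (intro finsum_closed) (auto simp: M_app subset_iff)

lemma functional_add:
  assumes "a \<in> carrier M" "b \<in> carrier M"
  shows "functional l (a \<oplus>\<^bsub>M\<^esub> b) = functional l a \<oplus> functional l b"
proof -
  have c: "a f \<in> carrier k" "b f \<in> carrier k" "f \<in> maps" if "f \<in> pointed_maps G n" for f
    using that pointed_sub assms M_app by auto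
  have "functional l (a \<oplus>\<^bsub>M\<^esub> b) =
      (\<Oplus>f\<in>pointed_maps G n. from_int (l f) \<otimes> a f \<oplus> from_int (l f) \<otimes> b f)"
    unfolding functional_def using c by (intro finsum_cong') (auto simp: add_app r_distr)
  also have "\<dots> = functional l a \<oplus> functional l b"
    unfolding functional_def using c by (intro finsum_addf) auto
  finally show ?thesis .
qed

text \<open>Modulo \<open>p\<close> the functional is a derivation over the augmentation \<open>a \<mapsto> a(\<emptyset>)\<close> on invariants,
  so it kills everything generated in degrees below \<open>n\<close>.\<close>

lemma functional_mult:
  assumes a: "a \<in> FA.F" and b: "b \<in> FA.F"
    and l: "\<And>f T. \<lbrakk>f \<in> pointed_maps G n; T \<subseteq> {1..<n}; T \<noteq> {}\<rbrakk> \<Longrightarrow>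
      int p dvd (\<Sum>g\<in>carrier G. l (shift G g T f))"
    and la: "functional l a \<in> multiples p" and lb: "functional l b \<in> multiples p"
  shows "functional l (a \<otimes>\<^bsub>M\<^esub> b) \<in> multiples p"
proof -
  define P where "P = pointed_maps G n"
  define D where "D = {..<n}"
  have finP: "finite P" unfolding P_def by (rule finite_pointed_maps[OF finite_G])
  have PD: "dom f = D" "f \<in> maps" if "f \<in> P" for f
    using that pointed_sub by (auto simp: P_def D_def pointed_maps_def)
  have aM: "a \<in> carrier M" and bM: "b \<in> carrier M" using a b FA.fixed_carrier by auto
  have ac: "a (f |` T) \<in> carrier k" and bc: "b (f |` T) \<in> carrier k" if "f \<in> P" for f T
    using M_app[OF aM maps_restrict] M_app[OF bM maps_restrict] PD that by auto
  have af: "a f \<in> carrier k" "b f \<in> carrier k" if "f \<in> P" for f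
    using M_app[OF aM] M_app[OF bM] PD that by auto
  have empty: "Map.empty \<in> maps" by (simp add: partial_maps_def)
  have ae: "a Map.empty \<in> carrier k" "b Map.empty \<in> carrier k"
    using M_app[OF aM empty] M_app[OF bM empty] by auto
  have full: "f |` D = f" if "f \<in> P" for f using PD(1)[OF that] restrict_map_dom[of f] by simp
  have "functional l (a \<otimes>\<^bsub>M\<^esub> b) =
      (\<Oplus>f\<in>P. \<Oplus>T\<in>Pow D. from_int (l f) \<otimes> (a (f |` T) \<otimes> b (f |` (D - T))))"
    unfolding functional_def P_def[symmetric]
  proof (intro finsum_cong')
    fix f assume f: "f \<in> P"
    show "from_int (l f) \<otimes> (a \<otimes>\<^bsub>M\<^esub> b) f =
      (\<Oplus>T\<in>Pow D. from_int (l f) \<otimes> (a (f |` T) \<otimes> b (f |` (D - T))))"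
      unfolding mult_app[OF PD(2)[OF f]] PD(1)[OF f] using ac[OF f] bc[OF f]
      by (intro finsum_rdistr) (auto simp: D_def)
  qed (use ac bc in \<open>auto intro!: finsum_closed\<close>)
  also have "\<dots> = (\<Oplus>T\<in>Pow D. \<Oplus>f\<in>P. from_int (l f) \<otimes> (a (f |` T) \<otimes> b (f |` (D - T))))"
    using finP ac bc by (intro finsum_swap) (auto simp: D_def)
  also have "\<dots> \<in> multiples p"
  proof (rule finsum_mem[OF multiples_zero multiples_add multiples_carrier])
    show "(\<lambda>T. \<Oplus>f\<in>P. from_int (l f) \<otimes> (a (f |` T) \<otimes> b (f |` (D - T)))) \<in> Pow D \<rightarrow> multiples p"
    proof
      fix T assume "T \<in> Pow D"
      then have T: "T \<subseteq> D" by simp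
      \<comment> \<open>Seen from the restriction to \<open>T\<close>, a shift along
        \<open>T\<close> is a diagonal translation, under which coefficients of invariants do not
        change.\<close>
      have shifted: "a (shift G g T f |` T) = a (f |` T)" "b (shift G g T f |` T) = b (f |` T)"
        if "f \<in> P" "g \<in> carrier G" for f g T
        unfolding shift_restrict_same
        using fixed_shift[OF a maps_restrict that(2)] fixed_shift[OF b maps_restrict that(2)]
          PD(2)[OF that(1)] by auto
      \<comment> \<open>The two trivial splittings give the terms of the derivation rule. In all
        others exactly one of \<open>T\<close> and \<open>D - T\<close> avoids index 0, and that one
        is shifted: its factor is unchanged by invariance, the other because its indices are
        untouched.\<close>
      consider "T = {}" | "T = D" | "T \<noteq> {}" "T \<subseteq> {1..<n}" | "T \<noteq> D" "D - T \<subseteq> {1..<n}"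
      proof (cases "0 \<in> T")
        case True
        have "D - T \<subseteq> {1..<n}"
        proof
          fix x assume x: "x \<in> D - T"
          then have "x \<noteq> 0" using True by (metis DiffD2)
          then show "x \<in> {1..<n}" using x by (simp add: D_def)
        qed
        then show ?thesis using that by blast
      next
        case False
        have "T \<subseteq> {1..<n}"
        proof
          fix x assume x: "x \<in> T"
          then have "x \<noteq> 0" using False by metis
          then show "x \<in> {1..<n}" using x T by (auto simp: D_def)
        qed
        then show ?thesis using that by blast
      qed
      then show "(\<Oplus>f\<in>P. from_int (l f) \<otimes> (a (f |` T) \<otimes> b (f |` (D - T)))) \<in> multiples p"
      proof cases
        case 1
        have "(\<Oplus>f\<in>P. from_int (l f) \<otimes> (a (f |` T) \<otimes> b (f |` (D - T)))) =
            (\<Oplus>f\<in>P. a Map.empty \<otimes> (from_int (l f) \<otimes> b f))"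
          using 1 full af ae by (intro finsum_cong') (auto simp: m_ac)
        also have "\<dots> = a Map.empty \<otimes> functional l b"
          unfolding functional_def P_def[symmetric] using finP af ae by (intro finsum_rdistr[symmetric]) auto
        finally show ?thesis using multiples_mult[OF lb ae(1)] by simp
      next
        case 2
        have "(\<Oplus>f\<in>P. from_int (l f) \<otimes> (a (f |` T) \<otimes> b (f |` (D - T)))) =
            (\<Oplus>f\<in>P. b Map.empty \<otimes> (from_int (l f) \<otimes> a f))"
          using 2 full af ae by (intro finsum_cong') (auto simp: m_ac)
        also have "\<dots> = b Map.empty \<otimes> functional l a"
          unfolding functional_def P_def[symmetric] using finP af ae by (intro finsum_rdistr[symmetric]) auto
        finally show ?thesis using multiples_mult[OF la ae(2)] by simp
      next
        case 3
        show ?thesis unfolding P_def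
        proof (rule weighted_sum_multiple[OF 3(2,1)])
          fix f g assume f: "f \<in> pointed_maps G n" and g: "g \<in> carrier G"
          have "shift G g T f |` (D - T) = f |` (D - T)" by (rule shift_restrict_disjoint) auto
          then show "a (shift G g T f |` T) \<otimes> b (shift G g T f |` (D - T)) =
              a (f |` T) \<otimes> b (f |` (D - T))"
            using shifted(1)[of f g T] f g by (simp add: P_def)
        qed (use l 3 ac bc in \<open>auto simp: P_def\<close>)
      next
        case 4
        then have ne: "D - T \<noteq> {}" using T by blast
        show ?thesis unfolding P_def
        proof (rule weighted_sum_multiple[OF 4(2) ne])
          fix f g assume f: "f \<in> pointed_maps G n" and g: "g \<in> carrier G"
          have "shift G g (D - T) f |` T = f |` T" by (rule shift_restrict_disjoint) auto
          then show "a (shift G g (D - T) f |` T) \<otimes> b (shift G g (D - T) f |` (D - T)) =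
              a (f |` T) \<otimes> b (f |` (D - T))"
            using shifted(2)[of f g "D - T"] f g by (simp add: P_def)
        qed (use l 4 ne ac bc in \<open>auto simp: P_def\<close>)
      qed
    qed
  qed
  finally show ?thesis .
qed

text \<open>If degrees below \<open>n\<close> generated the invariants, the functional of every
  invariant would lie in pk. The orbit sum of a monomial \<open>f0\<close> with \<open>l f0\<close>
  not divisible by p contradicts this.\<close>

lemma le_beta_invariants:
  assumes "n > 0" and p: "p \<in> char_set k" and ind: "indecomposable G n p"
  shows "enat n \<le> beta_invariants G M homog act"
proof (rule ccontr)
  assume "\<not> enat n \<le> beta_invariants G M homog act"
  then have lt: "beta_invariants G M homog act < enat n" by simp
  then obtain N where N: "beta_invariants G M homog act = enat N" "N < n"
    by (metis enat_iless enat_ord_simps(2))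
  define R where "R = M\<lparr>carrier := FA.F\<rparr>"
  have "beta_invariants G M homog act \<le> enat N" using N by simp
  then obtain N' where N': "N' \<le> N"
    and gen: "generate_ring R (component_le R (\<lambda>d. homog d \<inter> FA.F) N') = FA.F"
    unfolding beta_invariants_def beta_le_iff R_def by auto
  interpret R: cring R unfolding R_def by (rule FA.fixed_cring)
  obtain l where l_all: "\<forall>f\<in>pointed_maps G n. \<forall>T. T \<subseteq> {1..<n} \<longrightarrow> T \<noteq> {} \<longrightarrow>
      int p dvd (\<Sum>g\<in>carrier G. l (shift G g T f))"
    and "\<exists>f\<in>pointed_maps G n. \<not> int p dvd l f"
    using ind unfolding indecomposable_def by (elim exE conjE)
  then have l: "int p dvd (\<Sum>g\<in>carrier G. l (shift G g T f))"
    if "f \<in> pointed_maps G n" "T \<subseteq> {1..<n}" "T \<noteq> {}" for f T using that by blast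
  obtain f0 where f0: "f0 \<in> pointed_maps G n" "\<not> int p dvd l f0"
    using \<open>\<exists>f\<in>pointed_maps G n. \<not> int p dvd l f\<close> by blast
  have vanish: "functional l a \<in> multiples p" if "\<And>f. f \<in> pointed_maps G n \<Longrightarrow> a f = \<zero>" for a
  proof -
    have "functional l a = \<zero>" unfolding functional_def using that by (intro add.finprod_one_eqI) simp
    then show ?thesis using multiples_zero by simp
  qed
  have all: "functional l a \<in> multiples p" if "a \<in> FA.F" for a
  proof -
    have "a \<in> generate_ring R (component_le R (\<lambda>d. homog d \<inter> FA.F) N')" using gen that by simp
    then have "a \<in> FA.F \<and> functional l a \<in> multiples p"
    proof (induction a rule: generate_ring.induct)
      case one
      \<comment> \<open>The unit is supported at the empty map, which has no index 0 and so is not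
        pointed.\<close>
      have "Map.empty \<notin> pointed_maps G n" by (simp add: pointed_maps_def)
      then have "functional l \<one>\<^bsub>M\<^esub> \<in> multiples p"
        using pointed_sub by (intro vanish) (auto simp: one_app)
      then show ?case using R.one_closed by (simp add: R_def)
    next
      case (incl a)
      then obtain u where u: "a = (\<Oplus>\<^bsub>R\<^esub>d\<in>{..N'}. u d)" "\<And>d. d \<le> N' \<Longrightarrow> u d \<in> homog d \<inter> FA.F"
        by (auto simp: component_le_def)
      \<comment> \<open>Pointed maps have degree \<open>n\<close>, while the generators have degree
        at most \<open>N'\<close>, which is smaller; so the functional does not see them.\<close>
      define H where "H = {a \<in> FA.F. \<forall>f\<in>pointed_maps G n. a f = \<zero>}"
      have "(\<Oplus>\<^bsub>R\<^esub>d\<in>{..N'}. u d) \<in> H"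
      proof (rule R.finsum_mem)
        show "\<zero>\<^bsub>R\<^esub> \<in> H" using R.zero_closed pointed_sub by (auto simp: R_def H_def zero_app)
        show "a \<oplus>\<^bsub>R\<^esub> b \<in> H" if "a \<in> H" "b \<in> H" for a b
          using that R.add.m_closed[of a b] pointed_sub by (auto simp: R_def H_def add_app)
        show "H \<subseteq> carrier R" by (auto simp: R_def H_def)
        show "u \<in> {..N'} \<rightarrow> H"
        proof
          fix d assume d: "d \<in> {..N'}"
          have "u d f = \<zero>" if "f \<in> pointed_maps G n" for f
          proof -
            have "card (dom f) \<noteq> d" using that d N(2) N' by (simp add: pointed_maps_def)
            then show ?thesis using homog_app[of "u d" d f] u(2)[of d] d that pointed_sub by auto
          qed
          then show "u d \<in> H" using u(2)[of d] d by (simp add: H_def)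
        qed
      qed
      then show ?case using u(1) vanish by (simp add: H_def)
    next
      case (a_inv a)
      then have F: "\<ominus>\<^bsub>R\<^esub> a \<in> FA.F" "\<ominus>\<^bsub>R\<^esub> a = \<ominus>\<^bsub>M\<^esub> a"
        using R.a_inv_closed[of a] FA.minus_consistent[of a] by (auto simp: R_def)
      have aM: "a \<in> carrier M" using a_inv FA.fixed_carrier by blast
      have "functional l (\<ominus>\<^bsub>M\<^esub> a) \<oplus> functional l a = functional l \<zero>\<^bsub>M\<^esub>"
        using functional_add[of "\<ominus>\<^bsub>M\<^esub> a" a l] aM by (simp add: M.l_neg)
      also have "\<dots> = \<zero>"
        unfolding functional_def using pointed_sub by (intro add.finprod_one_eqI) (auto simp: zero_app)
      finally have "functional l (\<ominus>\<^bsub>M\<^esub> a) = \<ominus> functional l a"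
        using minus_equality functional_closed aM by (metis M.a_inv_closed)
      also have "\<dots> = \<ominus> \<one> \<otimes> functional l a" using functional_closed[OF aM] by (simp add: l_minus)
      also have "\<dots> \<in> multiples p" using a_inv by (intro multiples_mult) auto
      finally show ?case using F by simp
    next
      case (eng_add a b)
      then have "functional l (a \<oplus>\<^bsub>M\<^esub> b) \<in> multiples p"
        using functional_add[of a b l] FA.fixed_carrier multiples_add by simp
      then show ?case using eng_add R.add.m_closed[of a b] by (simp add: R_def)
    next
      case (eng_mult a b)
      then have "functional l (a \<otimes>\<^bsub>M\<^esub> b) \<in> multiples p"
        using l by (intro functional_mult) auto
      then show ?case using eng_mult R.m_closed[of a b] by (simp add: R_def)
    qed
    then show ?thesis by simp
  qed
  \<comment> \<open>The sum of the monomials in the diagonal orbit of \<open>f0\<close>, an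
    invariant of degree \<open>n\<close>.\<close>
  define t where "t = (\<lambda>f\<in>maps. if \<exists>g\<in>carrier G. f = shift G g UNIV f0 then \<one> else \<zero>)"
  have f0m: "f0 \<in> maps" using f0(1) pointed_sub by blast
  then have ran0: "ran f0 \<subseteq> carrier G" by (simp add: partial_maps_def)
  have "t \<in> FA.F"
  proof -
    have tM: "t \<in> carrier M" unfolding t_def by (rule M_lambda) simp
    have "act g t = t" if g: "g \<in> carrier G" for g
    proof (rule M_ext[OF act_closed[OF tM g] tM])
      fix f assume f: "f \<in> maps"
      then have ran: "ran f \<subseteq> carrier G" by (simp add: partial_maps_def)
      have "(\<exists>h\<in>carrier G. shift G (inv\<^bsub>G\<^esub> g) UNIV f = shift G h UNIV f0) \<longleftrightarrow>
        (\<exists>h\<in>carrier G. f = shift G h UNIV f0)"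
      proof
        assume "\<exists>h\<in>carrier G. shift G (inv\<^bsub>G\<^esub> g) UNIV f = shift G h UNIV f0"
        then obtain h where h: "h \<in> carrier G" "shift G (inv\<^bsub>G\<^esub> g) UNIV f = shift G h UNIV f0" by blast
        then have "shift G g UNIV (shift G (inv\<^bsub>G\<^esub> g) UNIV f) = shift G g UNIV (shift G h UNIV f0)" by simp
        then have "f = shift G (g \<otimes>\<^bsub>G\<^esub> h) UNIV f0"
          using ran ran0 g h(1) by (simp add: G.shift_shift G.shift_one)
        then show "\<exists>h\<in>carrier G. f = shift G h UNIV f0" using g h(1) by blast
      next
        assume "\<exists>h\<in>carrier G. f = shift G h UNIV f0"
        then obtain h where h: "h \<in> carrier G" "f = shift G h UNIV f0" by blast
        then have "shift G (inv\<^bsub>G\<^esub> g) UNIV f = shift G (inv\<^bsub>G\<^esub> g \<otimes>\<^bsub>G\<^esub> h) UNIV f0"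
          using ran0 g by (simp add: G.shift_shift)
        then show "\<exists>h\<in>carrier G. shift G (inv\<^bsub>G\<^esub> g) UNIV f = shift G h UNIV f0" using g h(1) by blast
      qed
      then show "act g t f = t f"
        unfolding act_app[OF tM f] using f g by (simp add: t_def maps_shift)
    qed
    then show ?thesis using tM by (simp add: fixed_points_def)
  qed
  then have "functional l t \<in> multiples p" by (rule all)
  also have "functional l t = (\<Oplus>f\<in>pointed_maps G n. if f0 = f then from_int (l f) else \<zero>)"
    unfolding functional_def
  proof (intro finsum_cong')
    fix f assume f: "f \<in> pointed_maps G n"
    then have fm: "f \<in> maps" using pointed_sub by blast
    \<comment> \<open>Coordinate 0 is the unit on both sides and forces g to be the unit. So the
      orbit has a single pointed member, and the functional of \<open>t\<close> is
      \<open>l f0\<close>.\<close>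
    have "(\<exists>g\<in>carrier G. f = shift G g UNIV f0) \<longleftrightarrow> f0 = f"
    proof
      assume "\<exists>g\<in>carrier G. f = shift G g UNIV f0"
      then obtain g where g: "g \<in> carrier G" "f = shift G g UNIV f0" by blast
      have "f 0 = Some \<one>\<^bsub>G\<^esub>" "f0 0 = Some \<one>\<^bsub>G\<^esub>" using f f0(1) by (auto simp: pointed_maps_def)
      then have "g = \<one>\<^bsub>G\<^esub>" using g by (simp add: shift_UNIV)
      then show "f0 = f" using g(2) G.shift_one[OF ran0] by simp
    next
      assume "f0 = f"
      then show "\<exists>g\<in>carrier G. f = shift G g UNIV f0"
        using G.shift_one[OF ran0, of UNIV] G.one_closed by metis
    qed
    then show "from_int (l f) \<otimes> t f = (if f0 = f then from_int (l f) else \<zero>)"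
      using fm by (simp add: t_def)
  qed auto
  also have "\<dots> = from_int (l f0)"
    using f0(1) finite_pointed_maps[OF finite_G] by (intro finsum_singleton) auto
  finally obtain c where "c \<in> carrier k" "from_int (l f0) = from_int (int p) \<otimes> c"
    by (auto simp: multiples_def)
  then show False using char_set_no_unit_multiple[OF p f0(2), of c] by (simp add: int_unit_nat)
qed

end

section \<open>Transport of structure\<close>

lemma generate_ring_image:
  assumes "ring R" "ring S" and h: "h \<in> ring_hom R S" and H: "H \<subseteq> carrier R"
  shows "generate_ring S (h ` H) = h ` generate_ring R H"
proof -
  interpret R: ring R by fact
  interpret S: ring S by fact
  interpret ring_hom_ring R S h using assms by (intro ring_hom_ringI2)
  note carr = R.generate_ring_in_carrier[OF H]
  show ?thesis
  proof
    show "generate_ring S (h ` H) \<subseteq> h ` generate_ring R H"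
    proof
      fix y assume "y \<in> generate_ring S (h ` H)"
      then show "y \<in> h ` generate_ring R H"
      proof (induction y rule: generate_ring.induct)
        case one
        show ?case using generate_ring.one[of R H] by (metis hom_one image_eqI)
      next
        case (incl y)
        then show ?case using generate_ring.incl[of _ H R] by blast
      next
        case (a_inv y)
        then obtain x where "x \<in> generate_ring R H" "y = h x" by blast
        then show ?case using generate_ring.a_inv[of x R H] carr
          by (intro image_eqI[of _ _ "\<ominus>\<^bsub>R\<^esub> x"]) auto
      next
        case (eng_add y1 y2)
        then obtain x1 x2 where "x1 \<in> generate_ring R H" "y1 = h x1" "x2 \<in> generate_ring R H" "y2 = h x2"
          by blast
        then show ?case using generate_ring.eng_add[of x1 R H x2] carr
          by (intro image_eqI[of _ _ "x1 \<oplus>\<^bsub>R\<^esub> x2"]) auto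
      next
        case (eng_mult y1 y2)
        then obtain x1 x2 where "x1 \<in> generate_ring R H" "y1 = h x1" "x2 \<in> generate_ring R H" "y2 = h x2"
          by blast
        then show ?case using generate_ring.eng_mult[of x1 R H x2] carr
          by (intro image_eqI[of _ _ "x1 \<otimes>\<^bsub>R\<^esub> x2"]) auto
      qed
    qed
    show "h ` generate_ring R H \<subseteq> generate_ring S (h ` H)"
    proof (rule image_subsetI)
      fix x assume "x \<in> generate_ring R H"
      then show "h x \<in> generate_ring S (h ` H)"
      proof (induction x rule: generate_ring.induct)
        case one
        show ?case using generate_ring.one[of S "h ` H"] by simp
      next
        case (incl x)
        then show ?case by (auto intro: generate_ring.incl)
      next
        case (a_inv x)
        then show ?case using generate_ring.a_inv[of "h x" S "h ` H"] carr by simp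
      next
        case (eng_add x1 x2)
        then show ?case using generate_ring.eng_add[of "h x1" S "h ` H" "h x2"] carr by simp
      next
        case (eng_mult x1 x2)
        then show ?case using generate_ring.eng_mult[of "h x1" S "h ` H" "h x2"] carr by simp
      qed
    qed
  qed
qed

lemma component_le_image:
  assumes "ring R" "ring S" and h: "h \<in> ring_hom R S" and A: "\<And>d. \<A> d \<subseteq> carrier R"
  shows "component_le S (\<lambda>d. h ` \<A> d) n = h ` component_le R \<A> n"
proof -
  interpret R: ring R by fact
  interpret S: ring S by fact
  interpret ring_hom_ring R S h using assms by (intro ring_hom_ringI2)
  have sum: "h (\<Oplus>\<^bsub>R\<^esub>d\<in>{..n}. f d) = (\<Oplus>\<^bsub>S\<^esub>d\<in>{..n}. h (f d))" if "\<forall>d\<in>{..n}. f d \<in> \<A> d" for f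
  proof -
    have "f \<in> {..n} \<rightarrow> carrier R" using that A by blast
    then show ?thesis by (simp add: comp_def)
  qed
  show ?thesis
  proof
    show "component_le S (\<lambda>d. h ` \<A> d) n \<subseteq> h ` component_le R \<A> n"
    proof
      fix y assume "y \<in> component_le S (\<lambda>d. h ` \<A> d) n"
      then obtain u where u: "y = (\<Oplus>\<^bsub>S\<^esub>d\<in>{..n}. u d)" "\<forall>d\<in>{..n}. u d \<in> h ` \<A> d"
        unfolding component_le_def by blast
      then have "\<forall>d\<in>{..n}. \<exists>x\<in>\<A> d. u d = h x" by blast
      then obtain f where f: "\<forall>d\<in>{..n}. f d \<in> \<A> d \<and> u d = h (f d)" by metis
      then have fR: "\<forall>d\<in>{..n}. f d \<in> carrier R" using A by blast
      have "y = (\<Oplus>\<^bsub>S\<^esub>d\<in>{..n}. h (f d))"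
        unfolding u(1) using f fR by (intro S.finsum_cong') auto
      then have "y = h (\<Oplus>\<^bsub>R\<^esub>d\<in>{..n}. f d)" using sum[of f] f by simp
      then show "y \<in> h ` component_le R \<A> n"
        unfolding component_le_def using f by (intro image_eqI CollectI exI[of _ f]) auto
    qed
    show "h ` component_le R \<A> n \<subseteq> component_le S (\<lambda>d. h ` \<A> d) n"
      unfolding component_le_def using sum by fastforce
  qed
qed

lemma beta_ring_iso:
  assumes "ring R" "ring S" and h: "h \<in> ring_iso R S" and A: "\<And>d. \<A> d \<subseteq> carrier R"
    and B: "\<And>d. \<B> d = h ` \<A> d"
  shows "beta S \<B> = beta R \<A>"
proof -
  interpret R: ring R by fact
  have hom: "h \<in> ring_hom R S" and bij: "bij_betw h (carrier R) (carrier S)"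
    using h by (auto simp: ring_iso_def)
  have comp: "component_le R \<A> n \<subseteq> carrier R" for n
    unfolding component_le_def using A by (auto intro!: R.finsum_closed)
  have "generate_ring S (component_le S \<B> n) = carrier S \<longleftrightarrow>
      generate_ring R (component_le R \<A> n) = carrier R" for n
  proof -
    have "generate_ring S (component_le S \<B> n) = h ` generate_ring R (component_le R \<A> n)"
      using component_le_image[OF assms(1,2) hom A] generate_ring_image[OF assms(1,2) hom comp]
      by (simp add: B[abs_def])
    moreover have "h ` generate_ring R (component_le R \<A> n) = h ` carrier R \<longleftrightarrow>
        generate_ring R (component_le R \<A> n) = carrier R"
      using bij R.generate_ring_incl[OF comp] by (intro inj_on_image_eq_iff) (auto simp: bij_betw_def)
    ultimately show ?thesis using bij by (simp add: bij_betw_def)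
  qed
  then show ?thesis by (simp add: beta_def)
qed

text \<open>A copy of the algebra on another type: \<open>d\<close> decodes elements of the image,
  and \<open>e\<close> encodes the results.\<close>

definition image_module :: "('a \<Rightarrow> 'b) \<Rightarrow> ('k, 'a, 'n) module_scheme \<Rightarrow> ('k, 'b) module" where
  "image_module e A = (let d = inv_into (carrier A) e in
    \<lparr>carrier = e ` carrier A,
     monoid.mult = (\<lambda>x y. e (d x \<otimes>\<^bsub>A\<^esub> d y)),
     monoid.one = e \<one>\<^bsub>A\<^esub>,
     ring.zero = e \<zero>\<^bsub>A\<^esub>,
     ring.add = (\<lambda>x y. e (d x \<oplus>\<^bsub>A\<^esub> d y)),
     module.smult = (\<lambda>c x. e (c \<odot>\<^bsub>A\<^esub> d x))\<rparr>)"

text \<open>The multilinear algebra lives on a function type, whereas \<open>beta_over\<close>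
  ranges over algebras on a sum type. Any injection of the carrier carries the whole structure over
  and preserves both invariants of the grading.\<close>

lemma graded_algebra_action_transport:
  fixes A :: "('k, 'a, 'n) module_scheme" (structure) and e :: "'a \<Rightarrow> 'b"
  assumes "graded_algebra_action k G A \<A> \<phi>" and inj: "inj_on e (carrier A)"
  obtains B :: "('k, 'b) module" and \<B> \<psi>
  where "graded_algebra_action k G B \<B> \<psi>" "beta B \<B> = beta A \<A>"
    "beta_invariants G B \<B> \<psi> = beta_invariants G A \<A> \<phi>"
proof -
  interpret AC: cring A
    using assms(1) by (simp add: graded_algebra_action_def graded_algebra_def graded_cring_def)
  interpret A: graded_algebra_action k G A \<A> \<phi> by fact
  interpret G: group G using A.group_hom by (rule group_hom.axioms(1))
  define B where "B = image_module e A"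
  define \<B> where "\<B> d = e ` \<A> d" for d
  define \<psi> where "\<psi> g = (\<lambda>x\<in>carrier B. e (\<phi> g (inv_into (carrier A) e x)))" for g
  have dec: "inv_into (carrier A) e (e x) = x" if "x \<in> carrier A" for x
    using inv_into_f_f[OF inj that] .
  have B_simps: "carrier B = e ` carrier A" "\<one>\<^bsub>B\<^esub> = e \<one>" "\<zero>\<^bsub>B\<^esub> = e \<zero>"
    "\<And>x y. x \<in> carrier A \<Longrightarrow> y \<in> carrier A \<Longrightarrow> e x \<otimes>\<^bsub>B\<^esub> e y = e (x \<otimes> y)"
    "\<And>x y. x \<in> carrier A \<Longrightarrow> y \<in> carrier A \<Longrightarrow> e x \<oplus>\<^bsub>B\<^esub> e y = e (x \<oplus> y)"
    "\<And>c x. x \<in> carrier A \<Longrightarrow> c \<odot>\<^bsub>B\<^esub> e x = e (c \<odot> x)"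
    by (simp_all add: B_def image_module_def dec Let_def)
  have psi: "\<psi> g (e x) = e (\<phi> g x)" if "x \<in> carrier A" for g x
    using that by (simp add: \<psi>_def B_simps(1) dec)
  have iso: "e \<in> ring_iso A B"
    using inj by (auto simp: ring_iso_def ring_hom_def bij_betw_def B_simps)
  then have hom: "e \<in> ring_hom A B" by (simp add: ring_iso_def)
  have "cring (B\<lparr>ring.zero := e \<zero>\<rparr>)"
    by (rule AC.ring_iso_imp_img_cring[OF iso])
  moreover have "B\<lparr>ring.zero := e \<zero>\<rparr> = B"
    by (simp add: B_def image_module_def Let_def)
  ultimately have crB: "cring B" by simp
  interpret B: cring B by (rule crB)
  have e_hom: "ring_hom_cring A B e"
    using hom by (simp add: ring_hom_cring_def ring_hom_cring_axioms_def AC.is_cring crB)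
  have carrB: "\<exists>x\<in>carrier A. y = e x" if "y \<in> carrier B" for y using that by (auto simp: B_simps(1))
  have eq_iff: "e x = e y \<longleftrightarrow> x = y" if "x \<in> carrier A" "y \<in> carrier A" for x y
    using inj_on_eq_iff[OF inj that] .
  have sub: "\<A> d \<subseteq> carrier A" for d
    using A.component_subgroup[of d] additive_subgroup.a_subset by blast
  have algB: "algebra k B"
  proof (rule algebraI[OF _ crB])
    show "cring k" using A.algebra_axioms by (simp add: algebra_def module_def)
  qed (auto simp: B_simps A.smult_closed A.smult_l_distr A.smult_r_distr A.smult_assoc1 A.smult_assoc2 A.smult_one)
  have gradB: "graded_cring B \<B>"
  proof (intro graded_cring.intro graded_cring_axioms.intro crB)
    fix d
    interpret Ad: additive_subgroup "\<A> d" A by (rule A.component_subgroup)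
    show "additive_subgroup (\<B> d) B"
    proof (intro additive_subgroup.intro B.add.subgroupI)
      show "\<B> d \<subseteq> carrier B" using sub by (auto simp: \<B>_def B_simps(1))
      show "\<B> d \<noteq> {}" unfolding \<B>_def using Ad.zero_closed by blast
      show "\<ominus>\<^bsub>B\<^esub> y \<in> \<B> d" if y: "y \<in> \<B> d" for y
      proof -
        obtain x where x: "x \<in> \<A> d" "y = e x" using y by (auto simp: \<B>_def)
        then have "\<ominus>\<^bsub>B\<^esub> y = e (\<ominus> x)"
          using sub ring_hom_cring.hom_a_inv[OF e_hom, of x] by auto
        then show ?thesis using Ad.a_inv_closed[OF x(1)]
          by (simp add: \<B>_def)
      qed
      show "y \<oplus>\<^bsub>B\<^esub> z \<in> \<B> d" if yz: "y \<in> \<B> d" "z \<in> \<B> d" for y z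
      proof -
        obtain x w where x: "x \<in> \<A> d" "y = e x" "w \<in> \<A> d" "z = e w" using yz by (auto simp: \<B>_def)
        then have "y \<oplus>\<^bsub>B\<^esub> z = e (x \<oplus> w)" using sub B_simps(5) by blast
        then show ?thesis using Ad.a_closed x by (simp add: \<B>_def)
      qed
    qed
  next
    fix y z d1 d2 assume "y \<in> \<B> d1" "z \<in> \<B> d2"
    then obtain x w where x: "x \<in> \<A> d1" "y = e x" "w \<in> \<A> d2" "z = e w" by (auto simp: \<B>_def)
    then have "y \<otimes>\<^bsub>B\<^esub> z = e (x \<otimes> w)" using sub B_simps(4) by blast
    then show "y \<otimes>\<^bsub>B\<^esub> z \<in> \<B> (d1 + d2)" using A.component_mult x by (simp add: \<B>_def)
  next
    fix y assume "y \<in> carrier B"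
    then obtain x where x: "x \<in> carrier A" "y = e x" using carrB by blast
    \<comment> \<open>\<open>D\<close> and \<open>D'\<close> are the decomposition conditions for
      \<open>x\<close> and for its image \<open>y\<close>. Each homogeneous family in the copy is
      the image of one in the original, so existence and uniqueness carry over.\<close>
    define D where "D f \<longleftrightarrow> (\<forall>d. f d \<in> \<A> d) \<and> finite {d. f d \<noteq> \<zero>} \<and> x = (\<Oplus>d\<in>{d. f d \<noteq> \<zero>}. f d)" for f
    define D' where "D' u \<longleftrightarrow> (\<forall>d. u d \<in> \<B> d) \<and> finite {d. u d \<noteq> \<zero>\<^bsub>B\<^esub>} \<and>
      y = (\<Oplus>\<^bsub>B\<^esub>d\<in>{d. u d \<noteq> \<zero>\<^bsub>B\<^esub>}. u d)" for u
    have DD: "D' (\<lambda>d. e (f d)) \<longleftrightarrow> D f" if f: "\<And>d. f d \<in> \<A> d" for f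
    proof -
      have fc: "f d \<in> carrier A" for d using f sub by blast
      have nz: "{d. e (f d) \<noteq> \<zero>\<^bsub>B\<^esub>} = {d. f d \<noteq> \<zero>}" using fc eq_iff by (auto simp: B_simps(3))
      have sum: "e (\<Oplus>d\<in>{d. f d \<noteq> \<zero>}. f d) = (\<Oplus>\<^bsub>B\<^esub>d\<in>{d. f d \<noteq> \<zero>}. e (f d))"
        using fc ring_hom_cring.hom_finsum[OF e_hom, of f "{d. f d \<noteq> \<zero>}"] by (simp add: comp_def Pi_def)
      have "(\<Oplus>d\<in>{d. f d \<noteq> \<zero>}. f d) \<in> carrier A" using fc by (intro AC.finsum_closed) auto
      then have "y = (\<Oplus>\<^bsub>B\<^esub>d\<in>{d. f d \<noteq> \<zero>}. e (f d)) \<longleftrightarrow> x = (\<Oplus>d\<in>{d. f d \<noteq> \<zero>}. f d)"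
        unfolding sum[symmetric] x(2) by (rule eq_iff[OF x(1)])
      then show ?thesis unfolding D_def D'_def nz using f by (simp add: \<B>_def)
    qed
    obtain f where f: "D f" and uniq: "\<And>f'. D f' \<Longrightarrow> f' = f"
      using A.decomposition[OF x(1)] unfolding D_def[symmetric] by (elim ex1E) blast
    have "\<exists>!u. D' u"
    proof (rule ex1I)
      show "D' (\<lambda>d. e (f d))" using f DD[of f] by (simp add: D_def)
      fix u assume u: "D' u"
      then have "\<forall>d. \<exists>a\<in>\<A> d. u d = e a" by (auto simp: D'_def \<B>_def)
      then obtain f' where f': "\<And>d. f' d \<in> \<A> d" "\<And>d. u d = e (f' d)" by metis
      then have "u = (\<lambda>d. e (f' d))" by blast
      then show "u = (\<lambda>d. e (f d))" using uniq[of f'] DD[OF f'(1)] u by simp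
    qed
    then show "\<exists>!u. (\<forall>d. u d \<in> \<B> d) \<and> finite {d. u d \<noteq> \<zero>\<^bsub>B\<^esub>} \<and>
      y = (\<Oplus>\<^bsub>B\<^esub>d\<in>{d. u d \<noteq> \<zero>\<^bsub>B\<^esub>}. u d)" by (simp add: D'_def)
  qed
  have phic: "\<phi> g x \<in> carrier A" if "g \<in> carrier G" "x \<in> carrier A" for g x
    using A.element_image[of g x] that by simp
  have psic: "\<psi> g y \<in> carrier B" if "g \<in> carrier G" "y \<in> carrier B" for g y
    using that carrB[of y] phic psi by (auto simp: B_simps(1))
  have psi_comp: "\<psi> (g \<otimes>\<^bsub>G\<^esub> h) y = \<psi> g (\<psi> h y)" if "g \<in> carrier G" "h \<in> carrier G" "y \<in> carrier B" for g h y
    using that carrB[of y] phic by (auto simp: psi A.composition_rule)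
  have psi_one: "\<psi> \<one>\<^bsub>G\<^esub> y = y" if "y \<in> carrier B" for y
    using carrB[OF that] fun_cong[OF A.id_eq_one] by (auto simp: psi) (metis restrict_apply')
  have actB: "group_action G (carrier B) \<psi>"
  proof (intro group_action.intro group_hom.intro group_hom_axioms.intro G.is_group group_BijGroup)
    have bij: "\<psi> g \<in> Bij (carrier B)" if g: "g \<in> carrier G" for g
    proof -
      have "bij_betw (\<psi> g) (carrier B) (carrier B)"
      proof (rule bij_betw_byWitness[where f' = "\<psi> (inv\<^bsub>G\<^esub> g)"])
        show "\<forall>y\<in>carrier B. \<psi> (inv\<^bsub>G\<^esub> g) (\<psi> g y) = y" "\<forall>y\<in>carrier B. \<psi> g (\<psi> (inv\<^bsub>G\<^esub> g) y) = y"
          using g psi_comp psi_one by (auto simp flip: psi_comp)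
      qed (use g psic in auto)
      then show ?thesis by (simp add: Bij_def \<psi>_def)
    qed
    show "\<psi> \<in> hom G (BijGroup (carrier B))"
    proof (rule homI)
      fix g h assume gh: "g \<in> carrier G" "h \<in> carrier G"
      have "\<psi> (g \<otimes>\<^bsub>G\<^esub> h) = compose (carrier B) (\<psi> g) (\<psi> h)"
      proof
        fix y show "\<psi> (g \<otimes>\<^bsub>G\<^esub> h) y = compose (carrier B) (\<psi> g) (\<psi> h) y"
        proof (cases "y \<in> carrier B")
          case True
          then show ?thesis using psi_comp[OF gh] by (simp add: compose_def)
        next
          case False
          then show ?thesis by (simp add: compose_def \<psi>_def)
        qed
      qed
      then show "\<psi> (g \<otimes>\<^bsub>G\<^esub> h) = \<psi> g \<otimes>\<^bsub>BijGroup (carrier B)\<^esub> \<psi> h"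
        using bij gh by (simp add: BijGroup_def)
    qed (simp add: BijGroup_def bij)
  qed
  have gaaB: "graded_algebra_action k G B \<B> \<psi>"
  proof (intro graded_algebra_action.intro graded_algebra.intro algB gradB actB
      graded_algebra_axioms.intro graded_algebra_action_axioms.intro)
    show "c \<odot>\<^bsub>B\<^esub> y \<in> \<B> d" if c: "c \<in> carrier k" and y: "y \<in> \<B> d" for c y d
    proof -
      obtain x where x: "x \<in> \<A> d" "y = e x" using y by (auto simp: \<B>_def)
      then have "c \<odot>\<^bsub>B\<^esub> y = e (c \<odot> x)" using sub B_simps(6) by blast
      then show ?thesis using A.component_smult[OF c x(1)] by (simp add: \<B>_def)
    qed
    show "\<psi> g y \<in> \<B> d" if g: "g \<in> carrier G" and y: "y \<in> \<B> d" for g y d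
    proof -
      obtain x where x: "x \<in> \<A> d" "y = e x" using y by (auto simp: \<B>_def)
      then have "\<psi> g y = e (\<phi> g x)" using sub psi by blast
      then show ?thesis using A.action_degree[OF g x(1)] by (simp add: \<B>_def)
    qed
    show "\<psi> g (c \<odot>\<^bsub>B\<^esub> y) = c \<odot>\<^bsub>B\<^esub> \<psi> g y" if gc: "g \<in> carrier G" "c \<in> carrier k" and y: "y \<in> carrier B" for g c y
    proof -
      obtain x where x: "x \<in> carrier A" "y = e x" using carrB[OF y] by blast
      then show ?thesis using gc phic A.smult_closed A.action_smult by (simp add: B_simps psi)
    qed
    show "\<psi> g \<in> ring_hom B B" if g: "g \<in> carrier G" for g
    proof (rule ring_hom_memI)
      fix y z assume "y \<in> carrier B" "z \<in> carrier B"
      then obtain x w where x: "x \<in> carrier A" "y = e x" "w \<in> carrier A" "z = e w" using carrB by blast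
      show "\<psi> g (y \<otimes>\<^bsub>B\<^esub> z) = \<psi> g y \<otimes>\<^bsub>B\<^esub> \<psi> g z"
        using x phic[OF g] ring_hom_mult[OF A.action_ring_hom[OF g]] by (simp add: B_simps psi)
      show "\<psi> g (y \<oplus>\<^bsub>B\<^esub> z) = \<psi> g y \<oplus>\<^bsub>B\<^esub> \<psi> g z"
        using x phic[OF g] ring_hom_add[OF A.action_ring_hom[OF g]] by (simp add: B_simps psi)
    next
      show "\<psi> g \<one>\<^bsub>B\<^esub> = \<one>\<^bsub>B\<^esub>"
        using ring_hom_one[OF A.action_ring_hom[OF g]] by (simp only: B_simps(2) psi AC.one_closed)
    qed (use g psic in auto)
  qed
  have "beta B \<B> = beta A \<A>"
    by (rule beta_ring_iso[OF AC.ring_axioms B.ring_axioms iso sub]) (simp add: \<B>_def)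
  moreover have "beta_invariants G B \<B> \<psi> = beta_invariants G A \<A> \<phi>"
  proof -
    define FA FB where "FA = fixed_points G A \<phi>" and "FB = fixed_points G B \<psi>"
    have img: "FB = e ` FA"
    proof -
      have "e x \<in> FB \<longleftrightarrow> x \<in> FA" if "x \<in> carrier A" for x
        using that phic eq_iff by (auto simp: FA_def FB_def fixed_points_def psi B_simps(1))
      moreover have "FB \<subseteq> e ` carrier A" "FA \<subseteq> carrier A"
        by (auto simp: FA_def FB_def fixed_points_def B_simps(1))
      ultimately show ?thesis by blast
    qed
    have FAc: "FA \<subseteq> carrier A" by (auto simp: FA_def fixed_points_def)
    have "subring FA A"
    proof (rule AC.subringI[OF FAc])
      have ghom: "ring_hom_cring A A (\<phi> g)" if "g \<in> carrier G" for g
        using A.action_ring_hom[OF that] by (simp add: ring_hom_cring_def ring_hom_cring_axioms_def AC.is_cring)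
      show "\<one> \<in> FA" using ring_hom_one[OF A.action_ring_hom] by (simp add: FA_def fixed_points_def)
      show "\<ominus> x \<in> FA" if "x \<in> FA" for x
        using that ring_hom_cring.hom_a_inv[OF ghom] by (simp add: FA_def fixed_points_def)
      show "x \<otimes> y \<in> FA" if "x \<in> FA" "y \<in> FA" for x y
        using that ring_hom_mult[OF A.action_ring_hom] by (simp add: FA_def fixed_points_def)
      show "x \<oplus> y \<in> FA" if "x \<in> FA" "y \<in> FA" for x y
        using that ring_hom_add[OF A.action_ring_hom] by (simp add: FA_def fixed_points_def)
    qed
    then have rA: "ring (A\<lparr>carrier := FA\<rparr>)" by (rule AC.subring_is_ring)
    have "subring (e ` FA) B" using \<open>subring FA A\<close>
      by (rule ring_hom_ring.img_is_subring[OF ring_hom_ringI2[OF AC.ring_axioms B.ring_axioms hom]])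
    then have rB: "ring (B\<lparr>carrier := FB\<rparr>)" unfolding img by (rule B.subring_is_ring)
    have isoF: "e \<in> ring_iso (A\<lparr>carrier := FA\<rparr>) (B\<lparr>carrier := FB\<rparr>)"
      using inj_on_subset[OF inj FAc] FAc
      by (auto simp: ring_iso_def ring_hom_def bij_betw_def img B_simps subset_iff)
    have "\<B> d \<inter> FB = e ` (\<A> d \<inter> FA)" for d
      unfolding img \<B>_def using inj_on_image_Int[OF inj sub FAc] by simp
    then show ?thesis
      unfolding beta_invariants_def FA_def[symmetric] FB_def[symmetric]
      by (intro beta_ring_iso[OF rA rB isoF]) auto
  qed
  ultimately show ?thesis using that gaaB by blast
qed

text \<open>The two summands of the target answer the two cases. For finite \<open>'k\<close> there
  are finitely many functions, which are numbered; for infinite \<open>'k\<close> a pairing on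
  \<open>'k\<close> encodes the values one index after another.\<close>

lemma finite_functions_inject:
  assumes "finite I"
  shows "\<exists>e :: ('i \<Rightarrow> 'k) \<Rightarrow> 'k + nat. inj_on e (I \<rightarrow>\<^sub>E UNIV)"
proof (cases "finite (UNIV :: 'k set)")
  case True
  then have "finite (I \<rightarrow>\<^sub>E (UNIV :: 'k set))" using assms by (simp add: finite_PiE)
  then obtain e :: "('i \<Rightarrow> 'k) \<Rightarrow> nat" where "inj_on e (I \<rightarrow>\<^sub>E UNIV)"
    using finite_imp_inj_to_nat_seg by blast
  then have "inj_on (\<lambda>a. Inr (e a) :: 'k + nat) (I \<rightarrow>\<^sub>E UNIV)" by (auto simp: inj_on_def)
  then show ?thesis by blast
next
  case False
  then have "|UNIV \<times> UNIV :: ('k \<times> 'k) set| =o |UNIV :: 'k set|" by (rule card_of_Times_same_infinite)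
  then obtain pair :: "'k \<times> 'k \<Rightarrow> 'k" where pair: "inj pair"
    using card_of_ordIso[of "UNIV \<times> UNIV :: ('k \<times> 'k) set" "UNIV :: 'k set"] by (auto simp: bij_betw_def)
  have "\<exists>e :: ('i \<Rightarrow> 'k) \<Rightarrow> 'k. inj_on e (I \<rightarrow>\<^sub>E UNIV)"
    using assms
  proof (induction I rule: finite_induct)
    case empty
    then show ?case by (auto simp: inj_on_def)
  next
    case (insert i I)
    then obtain e :: "('i \<Rightarrow> 'k) \<Rightarrow> 'k" where e: "inj_on e (I \<rightarrow>\<^sub>E UNIV)" by blast
    have "inj_on (\<lambda>a. pair (a i, e (restrict a I))) (insert i I \<rightarrow>\<^sub>E UNIV)"
    proof (rule inj_onI)
      fix a b assume ab: "a \<in> insert i I \<rightarrow>\<^sub>E UNIV" "b \<in> insert i I \<rightarrow>\<^sub>E UNIV"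
        "pair (a i, e (restrict a I)) = pair (b i, e (restrict b I))"
      then have eq: "a i = b i" "e (restrict a I) = e (restrict b I)" using injD[OF pair] by blast+
      have "restrict a I = restrict b I"
        using inj_on_eq_iff[OF e, of "restrict a I" "restrict b I"] eq(2) by auto
      then have "a j = b j" if "j \<in> I" for j using that by (metis restrict_apply')
      then show "a = b" using ab(1,2) eq(1) by (intro PiE_ext[OF ab(1,2)]) auto
    qed
    then show ?case by blast
  qed
  then obtain e :: "('i \<Rightarrow> 'k) \<Rightarrow> 'k" where "inj_on e (I \<rightarrow>\<^sub>E UNIV)" by blast
  then have "inj_on (\<lambda>a. Inl (e a) :: 'k + nat) (I \<rightarrow>\<^sub>E UNIV)" by (auto simp: inj_on_def)
  then show ?thesis by blast
qed

section \<open>The Noether number of a ring\<close>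

text \<open>The right side depends on \<open>k\<close> only through \<open>char_set k\<close>, and
  not on the type \<open>'u\<close>. This is what makes different rings and carrier types
  comparable.\<close>

lemma beta_over_eq:
  fixes k :: "('k, 'm) ring_scheme" and G :: "('g, 'h) monoid_scheme"
  assumes "cring k" "group G" "finite (carrier G)"
  shows "beta_over TYPE('u) k G =
    Sup {enat n | n. n > 0 \<and> (\<exists>p\<in>char_set k. indecomposable G n p)}" (is "_ = Sup ?S")
proof (rule antisym)
  show "beta_over TYPE('u) k G \<le> Sup ?S"
    unfolding beta_over_def
  proof (rule Sup_least)
    fix b assume "b \<in> {beta_invariants G A \<A> \<phi> | (A :: ('k, 'k + nat + 'u) module) \<A> \<phi>.
      graded_algebra_action k G A \<A> \<phi> \<and> beta A \<A> \<le> 1}"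
    then obtain A :: "('k, 'k + nat + 'u) module" and \<A> \<phi> where
      A: "b = beta_invariants G A \<A> \<phi>" "graded_algebra_action k G A \<A> \<phi>" "beta A \<A> \<le> 1"
      by blast
    show "b \<le> Sup ?S"
    \<comment> \<open>An infinite supremum leaves nothing to show. A finite value N says that no
      degree above N is indecomposable for any p in \<open>char_set k\<close>.\<close>
    proof (cases "Sup ?S")
      case (enat N)
      have "cring A"
        using A(2) by (simp add: graded_algebra_action_def graded_algebra_def graded_cring_def)
      then interpret finite_graded_action k G A \<A> \<phi>
        by (rule finite_graded_action.intro[OF assms(1) _ assms(2) A(2)
              finite_graded_action_axioms.intro[OF assms(3)]])
      have "\<not> indecomposable G n p" if "n > N" "p \<in> char_set k" for n p
      proof
        assume "indecomposable G n p"
        then have "enat n \<in> ?S" using that by auto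
        then have "enat n \<le> enat N" unfolding enat[symmetric] by (rule Sup_upper)
        then show False using that(1) by simp
      qed
      then show ?thesis unfolding A(1) enat by (rule beta_invariants_le[OF A(3)])
    qed simp
  qed
  show "Sup ?S \<le> beta_over TYPE('u) k G"
  proof (rule Sup_least)
    fix b assume "b \<in> ?S"
    then obtain n p where n: "b = enat n" "n > 0" "p \<in> char_set k" "indecomposable G n p" by blast
    interpret multilinear k G n
      using assms by (simp add: multilinear_def multilinear_axioms_def)
    obtain e0 :: "((nat \<rightharpoonup> 'g) \<Rightarrow> 'k) \<Rightarrow> 'k + nat" where e0: "inj_on e0 (maps \<rightarrow>\<^sub>E UNIV)"
      using finite_functions_inject[OF finite_maps] by blast
    \<comment> \<open>The copy of the multilinear algebra stays inside the first two summands, so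
      \<open>'u\<close> may be any type.\<close>
    define e :: "((nat \<rightharpoonup> 'g) \<Rightarrow> 'k) \<Rightarrow> 'k + nat + 'u" where
      "e a = (case e0 a of Inl x \<Rightarrow> Inl x | Inr m \<Rightarrow> Inr (Inl m))" for a
    have "inj_on e0 (carrier M)" by (rule inj_on_subset[OF e0]) (auto simp: M_simps)
    then have "inj_on e (carrier M)"
      by (auto simp: inj_on_def e_def split: sum.splits)
    then obtain B :: "('k, 'k + nat + 'u) module" and \<B> \<psi> where
      B: "graded_algebra_action k G B \<B> \<psi>" "beta B \<B> = beta M homog"
        "beta_invariants G B \<B> \<psi> = beta_invariants G M homog act"
      using graded_algebra_action_transport[OF action_M] by blast
    have "b \<le> beta_invariants G B \<B> \<psi>" unfolding B(3) n(1) using le_beta_invariants n by blast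
    also have "\<dots> \<le> beta_over TYPE('u) k G"
      unfolding beta_over_def
      by (rule Sup_upper, intro CollectI exI[of _ B] exI[of _ \<B>] exI[of _ \<psi>])
        (use B(1,2) beta_M in simp)
    finally show "b \<le> beta_over TYPE('u) k G" .
  qed
qed

theorem theorem4p5:
  fixes k :: "('k, 'm) ring_scheme"
    and G :: "('g, 'h) monoid_scheme"
    and F :: "nat \<Rightarrow> ('f, 'n) ring_scheme"
  assumes "cring k"
    and "group G"
    and "finite (carrier G)"
    and "\<And>p. p \<in> char_set k \<Longrightarrow> field (F p) \<and> has_characteristic (F p) p"
  shows "beta_over TYPE('u) k G = (SUP p\<in>char_set k. beta_over TYPE('v) (F p) G)"
proof -
  define S where "S p = {enat n | n. n > 0 \<and> indecomposable G n p}" for p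
  have "beta_over TYPE('v) (F p) G = Sup (S p)" if p: "p \<in> char_set k" for p
  proof -
    have "cring (F p)" using assms(4)[OF p] by (simp add: field_def domain_def)
    then show ?thesis
      using beta_over_eq[OF _ assms(2,3), of "F p"] char_set_field[of "F p" p] assms(4)[OF p]
      by (simp add: S_def)
  qed
  then have "(SUP p\<in>char_set k. beta_over TYPE('v) (F p) G) = (SUP p\<in>char_set k. Sup (S p))"
    by (rule SUP_cong[OF refl])
  \<comment> \<open>The degree sets of the single characteristics unite to the degree set of
    \<open>k\<close>, and an iterated supremum is the supremum over the union.\<close>
  also have "\<dots> = Sup (\<Union>p\<in>char_set k. S p)" using SUP_UNION[of "\<lambda>x. x" S "char_set k"] by simp
  also have "(\<Union>p\<in>char_set k. S p) = {enat n | n. n > 0 \<and> (\<exists>p\<in>char_set k. indecomposable G n p)}"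
    by (auto simp: S_def)
  finally show ?thesis using beta_over_eq[OF assms(1-3), where 'u = 'u] by simp
qed

end
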